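(* There is an absolute constant $c>0$ such that for every prime $p$, $F(p)\le c\,p$; that is, $F(p)=O(p)$.
   Context: For a prime $p$, $F(p)$ denotes the number of pairs of integers $(g,h)$ with $1\le g,h\le p-1$ and $g^h\equiv h\pmod p$. *)

theory Defs
  imports Complex_Main "HOL-Number_Theory.Number_Theory"
begin

definition F :: "nat \<Rightarrow> nat" where
  "F p = card {(g, h). g \<in> {1..p - 1} \<and> h \<in> {1..p - 1} \<and> [g ^ h = h] (mod p)}"

end

theory Submission
  imports Defs "HOL-Real_Asymp.Real_Asymp" "HOL-Analysis.Convex"
begin

text \<open>
  Sorting the h by d = gcd h (p - 1) and putting t = (p - 1) / d, h = d k, one gets
  F(p) \<le> (p - 1) * (sum over t dvd p - 1 of N(t) / t), where N(t) counts the k \<le> t coprime to t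
  with (d k)^t = 1 mod p; since d t = -1 mod p, this says that the reduced fraction k / t lies,
  up to sign, in the subgroup of order t. The sum over t has to be bounded. Put x = ln p.

  \<^item> t \<ge> p^0.9: Fourier analysis and inclusion-exclusion give N(t) \<le> t phi(t) / p + error, and the
    sum of phi(t) over the divisors of p - 1 is p - 1.
  \<^item> exp(x^0.3) \<le> t \<le> p^0.9: few k-fold products coincide (divisor bound), so N(t) saves a power of t.
  \<^item> t < x^0.9: N(t) = 0 unless t = 1, as k^t and t^t are too small to be congruent up to sign.
  \<^item> In between, products of powers of small fractions stay below p, hence fractions lying in a small
    subgroup are multiplicatively dependent. Therefore the k counted by N(t) are determined by their
    valuations at few primes, so N(t) \<le> t^eta with x^eta = O(ln x / ln ln x). The same principle shows
    that for fixed g only few primes q \<le> x / (ln x)^5 make N(g q) nonzero, so that only those t matter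
    all of whose prime factors are very small or larger than x / (ln x)^5. Rankin's method with
    Chebyshev's bound then controls the sum. For t up to exp((ln x)^1.02) this needs the stronger bound
    N(t) \<le> t^eta with x^eta = O((ln x)^0.04), obtained from products of k_i^(E^i) (digit expansions in
    base E), which holds unless t is a multiple of the order of some fraction of height below x^0.25;
    such t contribute little.
\<close>

text \<open>Nothing prevents p - 1 from being divisible by all primes up to a constant multiple of
  x. The reciprocals of its divisors then sum to the order of ln x, so for small t a bound N(t) <=
  t^eta alone cannot suffice: divisors with N(t) = 0 must be discarded, and this is what the
  sparseness of the primes q is for. The two tools meet at t = exp((ln x)^2 / (400 ln ln x)). Below
  it, t^eta is at most about x^(1/400), which the smallness of the sum over t with a medium-sized
  prime factor absorbs. Above it, Rankin's shift by 1 / ln x gains exp(ln x / (400 ln ln x)), and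
  this beats the Euler product over all primes only because x^eta is smaller than ln x by the factor
  ln ln x. From the bounds in terms of the iterated logarithm on, l stands for ln x = ln ln p. The
  ranges below exp(x^0.3) are treated for all large l and all p with ln p = exp l, so that their
  side conditions become asymptotic inequalities in one real variable.\<close>

section \<open>Reduction to divisors of p - 1\<close>

text \<open>
  Modulo \<^term>\<open>p\<close> the number \<^term>\<open>(p - 1) div t * k\<close> equals \<open>- k / t\<close>, so the condition is one
  on the reduced fraction \<open>k / t\<close>.
\<close>
definition Kset :: "nat \<Rightarrow> nat \<Rightarrow> nat set" where
  "Kset p t = {k \<in> {1..t}. coprime k t \<and> [((p - 1) div t * k) ^ t = 1] (mod p)}"

lemma finite_Kset [simp]: "finite (Kset p t)"
  unfolding Kset_def by simp

lemma KsetD: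
  assumes "k \<in> Kset p t"
  shows "1 \<le> k" "k \<le> t" "coprime k t" "[((p - 1) div t * k) ^ t = 1] (mod p)"
  using assms unfolding Kset_def by auto

lemma dvd_pred_prime:
  fixes p t :: nat
  assumes "prime p" "t dvd p - 1"
  shows "t > 0" "t < p"
proof -
  have "p - 1 > 0" using prime_gt_1_nat[OF assms(1)] by simp
  then show "t > 0" "t < p" using assms(2) dvd_imp_le[of t "p - 1"] dvd_pos_nat[of "p - 1" t] by auto
qed

lemma cofactor_coprime:
  fixes p t :: nat
  assumes "prime p" "t dvd p - 1"
  shows "(p - 1) div t > 0" "(p - 1) div t < p" "coprime ((p - 1) div t) p"
proof -
  have "p - 1 > 0" using prime_gt_1_nat[OF assms(1)] by simp
  then show pos: "(p - 1) div t > 0" and lt: "(p - 1) div t < p"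
    using assms(2) div_le_dividend[of "p - 1" t] dvd_div_eq_0_iff[OF assms(2)] by linarith+
  show "coprime ((p - 1) div t) p"
    using assms(1) pos lt by (metis coprime_commute nat_dvd_not_less prime_imp_coprime)
qed

text \<open>A Bezout relation between h and p - 1, combined with Fermat, prescribes the value of g
  to the power gcd h (p - 1); such an equation has no more roots than its degree.\<close>

lemma card_power_fixed_le_gcd:
  fixes p h :: nat
  assumes p: "prime p" and h: "h > 0"
  shows "card {g \<in> {1..p - 1}. [g ^ h = h] (mod p)} \<le> gcd h (p - 1)"
proof -
  have n0: "p - 1 > 0" using prime_gt_1_nat[OF p] by simp
  obtain a b where ab: "h * a = (p - 1) * b + gcd h (p - 1)"
    using bezout_nat[of h "p - 1"] h by auto
  have "{g \<in> {1..p - 1}. [g ^ h = h] (mod p)} \<subseteq> {x\<in>{..<p}. [x ^ gcd h (p - 1) = h ^ a] (mod p)}"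
  proof (safe)
    fix g assume g: "g \<in> {1..p - 1}" "[g ^ h = h] (mod p)"
    then show "g < p" using n0 by auto
    then have "\<not> p dvd g" using g nat_dvd_not_less by auto
    then have fermat: "[g ^ (p - 1) = 1] (mod p)" using fermat_theorem[OF p] by simp
    have "[(g ^ (p - 1)) ^ b * g ^ gcd h (p - 1) = 1 ^ b * g ^ gcd h (p - 1)] (mod p)"
      using fermat by (intro cong_mult cong_pow cong_refl)
    moreover have "(g ^ (p - 1)) ^ b * g ^ gcd h (p - 1) = (g ^ h) ^ a"
      by (metis ab power_add power_mult)
    moreover have "[(g ^ h) ^ a = h ^ a] (mod p)" using g(2) by (rule cong_pow)
    ultimately show "[g ^ gcd h (p - 1) = h ^ a] (mod p)"
      by (metis cong_sym cong_trans mult_1 power_one)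
  qed
  then have "card {g \<in> {1..p - 1}. [g ^ h = h] (mod p)} \<le> card {x\<in>{..<p}. [x ^ gcd h (p - 1) = h ^ a] (mod p)}"
    by (intro card_mono) auto
  also have "\<dots> \<le> gcd h (p - 1)"
    using p h by (intro roots_mod_prime_bound) auto
  finally show ?thesis .
qed

text \<open>Each h admitting some g contributes at most gcd h (p - 1) = (p - 1) / t, and division by
  (p - 1) / t embeds these h into \<open>Kset p t\<close>. Pulling out the factor p - 1 leaves the
  weight 1 / t.\<close>

lemma F_le_sum_Kset:
  assumes p: "prime p"
  shows "real (F p) \<le> real (p - 1) * (\<Sum>t | t dvd p - 1. real (card (Kset p t)) / real t)"
proof -
  define n where "n = p - 1"
  have n0: "n > 0" using prime_gt_1_nat[OF p] by (simp add: n_def)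
  define G where "G h = {g \<in> {1..n}. [g ^ h = h] (mod p)}" for h
  have "{(g, h). g \<in> {1..p - 1} \<and> h \<in> {1..p - 1} \<and> [g ^ h = h] (mod p)} = (\<lambda>(h,g). (g,h)) ` (SIGMA h:{1..n}. G h)"
    unfolding G_def n_def by force
  moreover have "inj_on (\<lambda>(h,g). (g,h)) (SIGMA h:{1..n}. G h)" by (auto simp: inj_on_def)
  ultimately have "F p = card (SIGMA h:{1..n}. G h)"
    unfolding F_def by (metis (no_types, lifting) card_image)
  also have "\<dots> = (\<Sum>h\<in>{1..n}. card (G h))"
    by (subst card_SigmaI) (auto simp: G_def)
  finally have F: "F p = (\<Sum>h\<in>{1..n}. card (G h))" .
  have Gle: "card (G h) \<le> gcd h n" if "h \<in> {1..n}" for h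
    unfolding G_def n_def using card_power_fixed_le_gcd[OF p, of h] that by (auto simp: n_def)
  \<comment> \<open>Here h is congruent to g^h, so its power with exponent n / gcd h n is a power of
    g^n = 1.\<close>
  have Gne: "[h ^ (n div gcd h n) = 1] (mod p)" if hh: "h \<in> {1..n}" and ne: "G h \<noteq> {}" for h
  proof -
    obtain g where g: "g \<in> {1..n}" "[g ^ h = h] (mod p)" using ne unfolding G_def by auto
    then have "\<not> p dvd g" using n0 nat_dvd_not_less unfolding n_def by auto
    then have fermat: "[g ^ n = 1] (mod p)" using fermat_theorem[OF p] by (simp add: n_def)
    have "[h ^ (n div gcd h n) = (g ^ h) ^ (n div gcd h n)] (mod p)"
      using g(2) by (intro cong_pow) (rule cong_sym)
    also have "(g ^ h) ^ (n div gcd h n) = (g ^ n) ^ (h div gcd h n)"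
      by (simp add: power_mult [symmetric] div_mult_swap dvd_div_mult mult.commute)
    also have "[(g ^ n) ^ (h div gcd h n) = 1 ^ (h div gcd h n)] (mod p)"
      using fermat by (rule cong_pow)
    finally show ?thesis by simp
  qed
  define S where "S t = {h\<in>{1..n}. n div gcd h n = t \<and> G h \<noteq> {}}" for t
  have cardS: "card (S t) \<le> card (Kset p t)" if t: "t dvd n" for t
  proof (rule card_inj_on_le[where f = "\<lambda>h. h div (n div t)"])
    have gcd_eq: "gcd h n = n div t" if "h \<in> S t" for h
      using that n0 unfolding S_def by (auto simp: div_div_eq_right)
    show "inj_on (\<lambda>h. h div (n div t)) (S t)"
    proof (rule inj_onI)
      fix h h' assume "h \<in> S t" "h' \<in> S t" "h div (n div t) = h' div (n div t)"
      moreover have "n div t dvd h" "n div t dvd h'" using gcd_eq calculation by (metis gcd_dvd1)+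
      ultimately show "h = h'" by (metis dvd_div_eq_iff)
    qed
    show "(\<lambda>h. h div (n div t)) ` S t \<subseteq> Kset p t"
    proof (safe)
      fix h assume hS: "h \<in> S t"
      have hn: "h \<in> {1..n}" "G h \<noteq> {}" "n div gcd h n = t" using hS by (auto simp: S_def)
      have d: "gcd h n = n div t" using gcd_eq[OF hS] .
      have dd: "n div t dvd h" by (metis d gcd_dvd1)
      have dpos: "n div t > 0" using t n0 by (metis dvd_div_eq_0_iff gr0I less_numeral_extra(3))
      have t_eq: "n div (n div t) = t" using hn(3) d by simp
      have "h div (n div t) \<le> n div (n div t)" using hn by (intro div_le_mono) auto
      then have 1: "h div (n div t) \<le> t" using t_eq by simp
      have 2: "h div (n div t) \<ge> 1" using dd hn dpos
        by (metis atLeastAtMost_iff dvd_div_eq_0_iff less_one not_le not_one_le_zero)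
      have 3: "coprime (h div (n div t)) t"
        using div_gcd_coprime[of h n] n0 d t_eq by (metis gr_implies_not0)
      have "[h ^ t = 1] (mod p)" using Gne[OF hn(1,2)] hn(3) by simp
      moreover have "n div t * (h div (n div t)) = h" using dd by simp
      ultimately show "h div (n div t) \<in> Kset p t"
        unfolding Kset_def using 1 2 3 by (simp add: n_def)
    qed
  qed simp
  have "real (F p) = (\<Sum>h\<in>{1..n}. real (card (G h)))" by (simp add: F)
  also have "\<dots> = (\<Sum>t | t dvd n. \<Sum>h | h \<in> {1..n} \<and> n div gcd h n = t. real (card (G h)))"
    using n0 by (subst sum.group[of "{1..n}" "{t. t dvd n}" "\<lambda>h. n div gcd h n"])
      (auto, metis dvd_div_mult_self dvd_triv_left gcd_dvd2)
  also have "\<dots> \<le> (\<Sum>t | t dvd n. real n * (real (card (Kset p t)) / real t))"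
  proof (rule sum_mono)
    fix t assume "t \<in> {t. t dvd n}"
    then have t: "t dvd n" by simp
    have tpos: "t > 0" using t n0 by (metis dvd_pos_nat)
    have "(\<Sum>h | h \<in> {1..n} \<and> n div gcd h n = t. real (card (G h))) = (\<Sum>h\<in>S t. real (card (G h)))"
      unfolding S_def by (rule sum.mono_neutral_right) auto
    also have "\<dots> \<le> (\<Sum>h\<in>S t. real (n div t))"
    proof (rule sum_mono)
      fix h assume "h \<in> S t"
      then have h: "h \<in> {1..n}" "n div gcd h n = t" by (auto simp: S_def)
      have "gcd h n = n div t" using h n0 by (auto simp: div_div_eq_right)
      then show "real (card (G h)) \<le> real (n div t)" using Gle[OF h(1)] by simp
    qed
    also have "\<dots> = real (card (S t)) * real (n div t)" by simp
    also have "\<dots> \<le> real (card (Kset p t)) * real (n div t)"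
      using cardS[OF t] by (intro mult_right_mono) auto
    also have "\<dots> = real n * (real (card (Kset p t)) / real t)"
      using t tpos by (simp add: real_of_nat_div)
    finally show "(\<Sum>h | h \<in> {1..n} \<and> n div gcd h n = t. real (card (G h))) \<le> real n * (real (card (Kset p t)) / real t)" .
  qed
  finally show ?thesis by (simp add: n_def sum_distrib_left)
qed

section \<open>Multiplicative relations from the pigeonhole principle\<close>

text \<open>Since (p - 1) / t times t is -1 mod p, multiplying by t^a turns ((p - 1) / t * k)^a into
  (-k)^a. The extra power t^b is there so that, when two exponent vectors a and b are compared, both
  products are multiplied by the same t^(a + b).\<close>

lemma prod_cofactor_cong:
  fixes a b k t :: "'a \<Rightarrow> nat"
  assumes p: "prime p" and dvd: "\<And>i. i \<in> I \<Longrightarrow> t i dvd p - 1"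
  shows "[int (\<Prod>i\<in>I. ((p - 1) div t i * k i) ^ a i) * int (\<Prod>i\<in>I. t i ^ (a i + b i)) =
          (-1) ^ (\<Sum>i\<in>I. a i) * int (\<Prod>i\<in>I. k i ^ a i * t i ^ b i)] (mod int p)"
proof -
  have "[(\<Prod>i\<in>I. int (((p - 1) div t i * k i) ^ a i * t i ^ (a i + b i))) =
         (\<Prod>i\<in>I. (-1) ^ a i * int (k i ^ a i * t i ^ b i))] (mod int p)"
  proof (rule cong_prod)
    fix i assume i: "i \<in> I"
    have "int ((p - 1) div t i * t i) = int (p - 1)" using dvd[OF i] by simp
    also have "\<dots> = int p - 1" using prime_gt_1_nat[OF p] by simp
    finally have "[int ((p - 1) div t i * t i) = -1] (mod int p)"
      by (simp add: cong_iff_dvd_diff)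
    then have "[int ((p - 1) div t i * t i) ^ a i * int (k i ^ a i * t i ^ b i) = (-1) ^ a i * int (k i ^ a i * t i ^ b i)] (mod int p)"
      by (intro cong_mult cong_pow cong_refl)
    moreover have "int ((p - 1) div t i * t i) ^ a i * int (k i ^ a i * t i ^ b i) =
      int (((p - 1) div t i * k i) ^ a i * t i ^ (a i + b i))"
      by (simp add: power_add power_mult_distrib mult_ac)
    ultimately show "[int (((p - 1) div t i * k i) ^ a i * t i ^ (a i + b i)) = (-1) ^ a i * int (k i ^ a i * t i ^ b i)] (mod int p)"
      by simp
  qed
  then show ?thesis
    by (simp only: of_nat_prod of_nat_mult prod.distrib power_sum)
qed

text \<open>Pigeonhole: the products with exponents below V are roots of z^M = 1, of which there are
  at most M < V^|I|, so two of them agree mod p. With denominators cleared this reads X = Y or X =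
  -Y mod p for positive X and Y of size at most T^(2 |I| V), and \<open>small\<close> leaves only
  equality of integers. M may be any common multiple of the \<open>t i\<close>; a small one permits
  a small V.\<close>

lemma Kset_relation:
  fixes k t :: "'a \<Rightarrow> nat"
  assumes p: "prime p" and fin: "finite I"
    and k: "\<And>i. i \<in> I \<Longrightarrow> k i \<in> Kset p (t i)"
    and t: "\<And>i. i \<in> I \<Longrightarrow> t i \<le> T" "\<And>i. i \<in> I \<Longrightarrow> t i dvd M" "\<And>i. i \<in> I \<Longrightarrow> t i dvd p - 1"
    and M: "M > 0" "M < V ^ card I" and small: "2 * T ^ (2 * card I * V) < p"
  shows "\<exists>a b. a \<noteq> b \<and> a \<in> I \<rightarrow>\<^sub>E {..<V} \<and> b \<in> I \<rightarrow>\<^sub>E {..<V} \<and>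
    (\<Prod>i\<in>I. k i ^ a i * t i ^ b i) = (\<Prod>i\<in>I. k i ^ b i * t i ^ a i)"
proof -
  define d where "d i = (p - 1) div t i" for i
  define f where "f a = (\<Prod>i\<in>I. (d i * k i) ^ a i) mod p" for a
  have p1: "p > 1" using prime_gt_1_nat[OF p] .
  have "f ` (I \<rightarrow>\<^sub>E {..<V}) \<subseteq> {z\<in>{..<p}. [z ^ M = 1] (mod p)}"
  proof safe
    fix a
    show "f a < p" unfolding f_def using p1 by simp
    have "[(\<Prod>i\<in>I. (d i * k i) ^ a i) ^ M = (\<Prod>i\<in>I. 1)] (mod p)"
      unfolding prod_power_distrib
    proof (rule cong_prod)
      fix i assume i: "i \<in> I"
      obtain c where c: "M = t i * c" using t(2)[OF i] by auto
      have "[((d i * k i) ^ t i) ^ (a i * c) = 1 ^ (a i * c)] (mod p)"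
        using KsetD(4)[OF k[OF i]] unfolding d_def by (rule cong_pow)
      then show "[((d i * k i) ^ a i) ^ M = 1] (mod p)"
        by (simp add: c power_mult [symmetric] mult_ac)
    qed
    then show "[f a ^ M = 1] (mod p)" unfolding f_def Cong.cong_def power_mod prod.neutral_const .
  qed
  then have "card (f ` (I \<rightarrow>\<^sub>E {..<V})) \<le> card {z\<in>{..<p}. [z ^ M = 1] (mod p)}"
    by (intro card_mono) auto
  also have "\<dots> \<le> M" using p M by (intro roots_mod_prime_bound) auto
  also have "\<dots> < card (I \<rightarrow>\<^sub>E {..<V})" using M fin by (simp add: card_PiE)
  finally have "\<not> inj_on f (I \<rightarrow>\<^sub>E {..<V})" using card_image by fastforce
  then obtain a b where ab: "a \<in> I \<rightarrow>\<^sub>E {..<V}" "b \<in> I \<rightarrow>\<^sub>E {..<V}" "f a = f b" "a \<noteq> b"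
    unfolding inj_on_def by blast
  define X where "X = (\<Prod>i\<in>I. k i ^ a i * t i ^ b i)"
  define Y where "Y = (\<Prod>i\<in>I. k i ^ b i * t i ^ a i)"
  have bound: "(\<Prod>i\<in>I. k i ^ a i * t i ^ b i) \<le> T ^ (2 * card I * V) \<and> (\<Prod>i\<in>I. k i ^ a i * t i ^ b i) > 0"
    if a: "a \<in> I \<rightarrow>\<^sub>E {..<V}" and b: "b \<in> I \<rightarrow>\<^sub>E {..<V}" for a b
  proof -
    have "k i ^ a i * t i ^ b i \<le> T ^ (2 * V)" if i: "i \<in> I" for i
    proof -
      have le: "k i \<le> T" "t i \<le> T" "T \<ge> 1" using KsetD(1,2)[OF k[OF i]] t(1)[OF i] by auto
      have "k i ^ a i * t i ^ b i \<le> T ^ a i * T ^ b i" using le by (intro mult_mono power_mono) auto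
      also have "\<dots> = T ^ (a i + b i)" by (simp add: power_add)
      also have "\<dots> \<le> T ^ (2 * V)"
      proof (rule power_increasing[OF _ le(3)])
        have "a i < V" "b i < V" using a b i by (auto simp: PiE_iff)
        then show "a i + b i \<le> 2 * V" by simp
      qed
      finally show ?thesis .
    qed
    then have "(\<Prod>i\<in>I. k i ^ a i * t i ^ b i) \<le> (\<Prod>i\<in>I. T ^ (2 * V))" by (intro prod_mono) auto
    also have "\<dots> = T ^ (2 * card I * V)" by (simp add: power_mult [symmetric] mult_ac)
    finally have 1: "(\<Prod>i\<in>I. k i ^ a i * t i ^ b i) \<le> T ^ (2 * card I * V)" .
    have "k i ^ a i * t i ^ b i > 0" if i: "i \<in> I" for i
      using KsetD(1,2)[OF k[OF i]] by simp
    then show ?thesis using 1 by (simp add: prod_pos)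
  qed
  have X: "X \<le> T ^ (2 * card I * V)" "X > 0" using bound[OF ab(1,2)] by (auto simp: X_def)
  have Y: "Y \<le> T ^ (2 * card I * V)" "Y > 0" using bound[OF ab(2,1)] by (auto simp: Y_def)
  have "[int (\<Prod>i\<in>I. (d i * k i) ^ a i) * int (\<Prod>i\<in>I. t i ^ (a i + b i)) = (-1) ^ (\<Sum>i\<in>I. a i) * int X] (mod int p)"
    unfolding X_def d_def by (rule prod_cofactor_cong[OF p t(3)])
  moreover have "[int (\<Prod>i\<in>I. (d i * k i) ^ b i) * int (\<Prod>i\<in>I. t i ^ (b i + a i)) = (-1) ^ (\<Sum>i\<in>I. b i) * int Y] (mod int p)"
    unfolding Y_def d_def by (rule prod_cofactor_cong[OF p t(3)])
  moreover have "[int (\<Prod>i\<in>I. (d i * k i) ^ a i) * int (\<Prod>i\<in>I. t i ^ (a i + b i)) =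
     int (\<Prod>i\<in>I. (d i * k i) ^ b i) * int (\<Prod>i\<in>I. t i ^ (b i + a i))] (mod int p)"
  proof -
    have "[(\<Prod>i\<in>I. (d i * k i) ^ a i) = (\<Prod>i\<in>I. (d i * k i) ^ b i)] (mod p)"
      using ab(3) unfolding f_def by (simp add: Cong.cong_def)
    then have "[int (\<Prod>i\<in>I. (d i * k i) ^ a i) = int (\<Prod>i\<in>I. (d i * k i) ^ b i)] (mod int p)"
      by (simp only: cong_int_iff)
    then show ?thesis by (simp only: add.commute) (rule cong_mult[OF _ cong_refl])
  qed
  ultimately have XY: "[(-1) ^ (\<Sum>i\<in>I. a i) * int X = (-1) ^ (\<Sum>i\<in>I. b i) * int Y] (mod int p)"
    by (meson cong_sym cong_trans)
  have "X = Y"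
  proof (cases "even (\<Sum>i\<in>I. a i) = even (\<Sum>i\<in>I. b i)")
    case True
    have "[int X = int Y] (mod int p)"
    proof (cases "even (\<Sum>i\<in>I. a i)")
      case True
      with \<open>even (\<Sum>i\<in>I. a i) = even (\<Sum>i\<in>I. b i)\<close> XY show ?thesis by simp
    next
      case False
      with \<open>even (\<Sum>i\<in>I. a i) = even (\<Sum>i\<in>I. b i)\<close> XY show ?thesis
        by (simp add: cong_minus_minus_iff)
    qed
    then have "[X = Y] (mod p)" by (simp only: cong_int_iff)
    moreover have "X < p" "Y < p" using X Y small by linarith+
    ultimately show ?thesis by (simp add: cong_less_modulus_unique_nat)
  next
    \<comment> \<open>Opposite signs: p would divide the positive number X + Y, which the factor 2
      in \<open>small\<close> keeps below p.\<close>
    case False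
    have "int p dvd int X + int Y"
    proof (cases "even (\<Sum>i\<in>I. a i)")
      case True
      with False XY show ?thesis by (simp add: cong_iff_dvd_diff)
    next
      case False
      with \<open>even (\<Sum>i\<in>I. a i) \<noteq> even (\<Sum>i\<in>I. b i)\<close> XY have "int p dvd - (int X + int Y)"
        by (simp add: cong_iff_dvd_diff)
      then show ?thesis by (simp only: dvd_minus_iff)
    qed
    then have "p dvd X + Y" by (metis of_nat_add of_nat_dvd_iff)
    then have "p \<le> X + Y" using X by (intro dvd_imp_le) auto
    then show ?thesis using X Y small by linarith
  qed
  then show ?thesis using ab unfolding X_def Y_def by blast
qed

lemma multiplicity_prod_mixed:
  fixes k t a b :: "'a \<Rightarrow> nat"
  assumes q: "prime q" and fin: "finite I" and pos: "\<And>i. i \<in> I \<Longrightarrow> k i > 0" "\<And>i. i \<in> I \<Longrightarrow> t i > 0"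
  shows "multiplicity q (\<Prod>i\<in>I. k i ^ a i * t i ^ b i) =
    (\<Sum>i\<in>I. a i * multiplicity q (k i) + b i * multiplicity q (t i))"
proof -
  have q: "prime_elem q" using q by simp
  have "multiplicity q (\<Prod>i\<in>I. k i ^ a i * t i ^ b i) = (\<Sum>i\<in>I. multiplicity q (k i ^ a i * t i ^ b i))"
    using pos by (intro prime_elem_multiplicity_prod_distrib[OF q] fin) force
  also have "\<dots> = (\<Sum>i\<in>I. a i * multiplicity q (k i) + b i * multiplicity q (t i))"
    using pos by (intro sum.cong refl)
      (simp add: prime_elem_multiplicity_mult_distrib[OF q] prime_elem_multiplicity_power_distrib[OF q])
  finally show ?thesis .
qed

text \<open>A single k suffices, whence the unit type as index set: with V = t + 1 > M = t the
  relation k^a t^b = k^b t^a with a different from b forces k = t, against coprimality.\<close>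

lemma Kset_empty_if_small:
  assumes p: "prime p" and t: "t dvd p - 1" "t > 1" and small: "2 * t ^ (2 * (t + 1)) < p"
  shows "Kset p t = {}"
proof (rule ccontr)
  assume "Kset p t \<noteq> {}"
  then obtain k where k: "k \<in> Kset p t" by auto
  have "\<exists>a b. a \<noteq> b \<and> a \<in> {()} \<rightarrow>\<^sub>E {..<t + 1} \<and> b \<in> {()} \<rightarrow>\<^sub>E {..<t + 1} \<and>
    (\<Prod>i\<in>{()}. k ^ a i * t ^ b i) = (\<Prod>i\<in>{()}. k ^ b i * t ^ a i)"
    using p k t small by (intro Kset_relation[where T = t and M = t]) auto
  then obtain a b :: "unit \<Rightarrow> nat" where ab: "a \<noteq> b" "k ^ a () * t ^ b () = k ^ b () * t ^ a ()" by auto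
  have ne: "a () \<noteq> b ()" using ab(1) by auto
  have cop: "coprime k t" and k1: "k \<ge> 1" using KsetD[OF k] by auto
  have *: False if "i < j" "k ^ i * t ^ j = k ^ j * t ^ i" for i j
  proof -
    have "k ^ i * t ^ i * t ^ (j - i) = k ^ i * t ^ i * k ^ (j - i)"
      using that by (simp add: mult.assoc mult.left_commute power_add [symmetric])
    then have "t ^ (j - i) = k ^ (j - i)" using k1 t by simp
    then have "t = k" using that power_eq_iff_eq_base[of "j - i" t k] by simp
    then show False using cop t by simp
  qed
  show False using ne *[of "a ()" "b ()"] *[of "b ()" "a ()"] ab(2)
    by (metis linorder_neqE_nat)
qed

section \<open>Multiplicative rank\<close>

text \<open>Fraction-free Gaussian elimination over an arbitrary coordinate set: vectors of rank at
  most m are determined by m pivot coordinates. That each pivot is a nonzero coordinate of some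
  vector is recorded because it later identifies the pivots as primes.\<close>

lemma gaussian_pivots:
  fixes F :: "('a \<Rightarrow> int) set"
  assumes dep: "\<And>S. S \<subseteq> F \<Longrightarrow> finite S \<Longrightarrow> card S = Suc m \<Longrightarrow>
      \<exists>c. (\<exists>v\<in>S. c v \<noteq> 0) \<and> (\<forall>q. (\<Sum>v\<in>S. c v * v q) = (0::int))"
  shows "\<exists>P. finite P \<and> card P \<le> m \<and> (\<forall>q\<in>P. \<exists>v\<in>F. v q \<noteq> 0) \<and>
     (\<forall>v\<in>F. \<forall>v'\<in>F. (\<forall>q\<in>P. v q = v' q) \<longrightarrow> v = v')"
  using dep
proof (induction m arbitrary: F)
  case 0
  have "v = (\<lambda>_. 0)" if v: "v \<in> F" for v
  proof -
    obtain c where c: "c v \<noteq> 0" "\<forall>q. c v * v q = (0::int)" using 0[of "{v}"] v by auto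
    then show ?thesis by auto
  qed
  then show ?case by (intro exI[of _ "{}"]) auto
next
  case (Suc m)
  show ?case
  proof (cases "\<exists>w\<in>F. \<exists>q. w q \<noteq> 0")
    case False
    then show ?thesis by (intro exI[of _ "{}"]) (simp, metis ext)
  next
    case True
    then obtain w q where w: "w \<in> F" "w q \<noteq> 0" by auto
    \<comment> \<open>Cross-multiplication eliminates coordinate q with pivot row w without leaving
      the integers; it sends w to 0.\<close>
    define \<phi> where "\<phi> v = (\<lambda>r. w q * v r - v q * w r)" for v :: "'a \<Rightarrow> int"
    have "\<exists>P. finite P \<and> card P \<le> m \<and> (\<forall>q\<in>P. \<exists>v\<in>\<phi> ` F. v q \<noteq> 0) \<and>
       (\<forall>v\<in>\<phi> ` F. \<forall>v'\<in>\<phi> ` F. (\<forall>q\<in>P. v q = v' q) \<longrightarrow> v = v')"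
    proof (rule Suc.IH)
      fix S assume S: "S \<subseteq> \<phi> ` F" "finite S" "card S = Suc m"
      show "\<exists>c. (\<exists>v\<in>S. c v \<noteq> 0) \<and> (\<forall>q. (\<Sum>v\<in>S. c v * v q) = (0::int))"
      proof (cases "(\<lambda>_. 0) \<in> S")
        \<comment> \<open>A zero vector is dependent by itself. Excluding it ensures that w is not
          among the chosen preimages, so that adjoining w really yields m + 2 vectors.\<close>
        case True
        then show ?thesis using S(2)
          by (intro exI[of _ "\<lambda>v. if v = (\<lambda>_. 0) then 1 else 0"])
             (auto intro!: sum.neutral)
      next
        case zero: False
        define R where "R = inv_into F \<phi> ` S"
        have inj: "inj_on (inv_into F \<phi>) S" using S(1) by (rule inj_on_inv_into)
        have \<phi>R: "\<phi> (inv_into F \<phi> s) = s" if "s \<in> S" for s using that S(1) by (metis f_inv_into_f subsetD)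
        have R: "R \<subseteq> F" "finite R" "card R = Suc m"
          unfolding R_def using S inj by (auto simp: card_image intro: inv_into_into)
        have \<phi>w: "\<phi> w = (\<lambda>_. 0)" by (auto simp: \<phi>_def)
        have wR: "w \<notin> R"
        proof
          assume "w \<in> R"
          then obtain s where "s \<in> S" "w = inv_into F \<phi> s" by (auto simp: R_def)
          then have "s = (\<lambda>_. 0)" using \<phi>R \<phi>w by metis
          then show False using zero \<open>s \<in> S\<close> by simp
        qed
        obtain c where c: "\<exists>v\<in>insert w R. c v \<noteq> 0" "\<And>r. (\<Sum>v\<in>insert w R. c v * v r) = (0::int)"
          using Suc.prems[of "insert w R"] R wR w(1) by auto
        have c2: "c w * w r + (\<Sum>v\<in>R. c v * v r) = 0" for r using c(2)[of r] R wR by simp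
        have nz: "\<exists>v\<in>R. c v \<noteq> 0"
        proof (rule ccontr)
          assume *: "\<not> ?thesis"
          then have "c w * w q = 0" using c2[of q] by simp
          then show False using w c(1) * by auto
        qed
        have rel: "(\<Sum>v\<in>R. c v * \<phi> v r) = 0" for r
        proof -
          have "(\<Sum>v\<in>R. c v * \<phi> v r) = w q * (\<Sum>v\<in>R. c v * v r) - w r * (\<Sum>v\<in>R. c v * v q)"
            by (simp add: \<phi>_def sum_distrib_left sum_subtractf algebra_simps)
          also have "(\<Sum>v\<in>R. c v * v r) = - c w * w r" using c2[of r] by simp
          also have "(\<Sum>v\<in>R. c v * v q) = - c w * w q" using c2[of q] by simp
          finally show ?thesis by simp
        qed
        show ?thesis
        proof (intro exI[of _ "\<lambda>s. c (inv_into F \<phi> s)"] conjI allI)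
          show "\<exists>v\<in>S. c (inv_into F \<phi> v) \<noteq> 0" using nz by (auto simp: R_def)
          fix r
          have "(\<Sum>v\<in>R. c v * \<phi> v r) = (\<Sum>s\<in>S. c (inv_into F \<phi> s) * \<phi> (inv_into F \<phi> s) r)"
            unfolding R_def by (rule sum.reindex_cong[OF inj]) auto
          also have "\<dots> = (\<Sum>s\<in>S. c (inv_into F \<phi> s) * s r)"
            using \<phi>R by (intro sum.cong) auto
          finally show "(\<Sum>s\<in>S. c (inv_into F \<phi> s) * s r) = 0" using rel[of r] by simp
        qed
      qed
    qed
    then obtain P where P: "finite P" "card P \<le> m" "\<forall>q\<in>P. \<exists>v\<in>\<phi> ` F. v q \<noteq> 0"
       "\<forall>v\<in>\<phi> ` F. \<forall>v'\<in>\<phi> ` F. (\<forall>q\<in>P. v q = v' q) \<longrightarrow> v = v'" by auto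
    show ?thesis
    proof (intro exI[of _ "insert q P"] conjI ballI impI)
      show "finite (insert q P)" "card (insert q P) \<le> Suc m" using P(1,2)
        by (auto simp: card_insert_if)
      fix r assume "r \<in> insert q P"
      then show "\<exists>v\<in>F. v r \<noteq> 0"
      proof
        assume "r \<in> P"
        then obtain v where v: "v \<in> F" "\<phi> v r \<noteq> 0" using P(3) by auto
        then have "v r \<noteq> 0 \<or> w r \<noteq> 0" by (auto simp: \<phi>_def)
        then show ?thesis using v w by auto
      qed (use w in auto)
    next
      fix v v' assume v: "v \<in> F" "v' \<in> F" "\<forall>r\<in>insert q P. v r = v' r"
      then have "\<forall>r\<in>P. \<phi> v r = \<phi> v' r" by (auto simp: \<phi>_def)
      then have "\<phi> v = \<phi> v'" using P(4) v by auto
      then have "w q * v r - v q * w r = w q * v' r - v' q * w r" for r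
        by (auto simp: \<phi>_def fun_eq_iff)
      then have "v r = v' r" for r using v(3) w by auto
      then show "v = v'" by auto
    qed
  qed
qed

text \<open>The vectors are the valuations of the fractions k / t at all primes. Any m + 1 of them
  are dependent, with coefficients a - b taken from a multiplicative relation; all moduli equal t,
  so M = t < V^(m + 1) is enough. The contribution of t is common to all k, so the valuations of k
  alone at the pivots already determine k.\<close>

lemma Kset_pivots:
  assumes p: "prime p" and t: "t dvd p - 1" and V: "t < V ^ Suc m" and small: "2 * t ^ (2 * Suc m * V) < p"
  shows "\<exists>P. finite P \<and> card P \<le> m \<and> (\<forall>q\<in>P. prime q) \<and>
     inj_on (\<lambda>k. restrict (\<lambda>q. multiplicity q k) P) (Kset p t)"
proof -
  have t0: "t > 0" by (rule dvd_pred_prime(1)[OF p t])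
  define vec where "vec k = (\<lambda>q. if prime q then int (multiplicity q k) - int (multiplicity q t) else 0)" for k :: nat
  have vec_inj: "k = k'" if "k \<in> Kset p t" "k' \<in> Kset p t" "vec k = vec k'" for k k'
  proof (rule multiplicity_eq_nat)
    show "k > 0" "k' > 0" using KsetD(1)[OF that(1)] KsetD(1)[OF that(2)] by simp_all
    fix q :: nat assume "prime q"
    then show "multiplicity q k = multiplicity q k'" using fun_cong[OF that(3), of q] by (simp add: vec_def)
  qed
  have "\<exists>P. finite P \<and> card P \<le> m \<and> (\<forall>q\<in>P. \<exists>v\<in>vec ` Kset p t. v q \<noteq> 0) \<and>
     (\<forall>v\<in>vec ` Kset p t. \<forall>v'\<in>vec ` Kset p t. (\<forall>q\<in>P. v q = v' q) \<longrightarrow> v = v')"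
  proof (rule gaussian_pivots)
    fix S assume S: "S \<subseteq> vec ` Kset p t" "finite S" "card S = Suc m"
    define I where "I = inv_into (Kset p t) vec ` S"
    have inj: "inj_on (inv_into (Kset p t) vec) S" using S(1) by (rule inj_on_inv_into)
    have vecI: "vec (inv_into (Kset p t) vec s) = s" if "s \<in> S" for s
      using that S(1) by (metis f_inv_into_f subsetD)
    have I: "I \<subseteq> Kset p t" "finite I" "card I = Suc m"
      unfolding I_def using S inj by (auto simp: card_image intro: inv_into_into)
    have "\<exists>a b. a \<noteq> b \<and> a \<in> I \<rightarrow>\<^sub>E {..<V} \<and> b \<in> I \<rightarrow>\<^sub>E {..<V} \<and>
      (\<Prod>i\<in>I. i ^ a i * t ^ b i) = (\<Prod>i\<in>I. i ^ b i * t ^ a i)"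
      using I p t t0 V small by (intro Kset_relation[where T = t and M = t]) auto
    then obtain a b where ab: "a \<noteq> b" "a \<in> I \<rightarrow>\<^sub>E {..<V}" "b \<in> I \<rightarrow>\<^sub>E {..<V}"
      "(\<Prod>i\<in>I. i ^ a i * t ^ b i) = (\<Prod>i\<in>I. i ^ b i * t ^ a i)" by blast
    obtain i0 where i0: "i0 \<in> I" "a i0 \<noteq> b i0" using ab(1-3) by (meson PiE_ext)
    have rel: "(\<Sum>i\<in>I. (int (a i) - int (b i)) * vec i q) = 0" for q
    proof (cases "prime q")
      case True
      have pos: "0 < i" if "i \<in> I" for i using KsetD(1)[of i p t] that I(1) by auto
      have mult: "multiplicity q (\<Prod>i\<in>I. i ^ a i * t ^ b i) = (\<Sum>i\<in>I. a i * multiplicity q i + b i * multiplicity q t)" for a b :: "nat \<Rightarrow> nat"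
        using pos t0 by (intro multiplicity_prod_mixed[OF True I(2)]) auto
      have "(\<Sum>i\<in>I. a i * multiplicity q i + b i * multiplicity q t) = (\<Sum>i\<in>I. b i * multiplicity q i + a i * multiplicity q t)"
        using mult[of a b] mult[of b a] ab(4) by simp
      then have "(\<Sum>i\<in>I. int (a i * multiplicity q i + b i * multiplicity q t)) = (\<Sum>i\<in>I. int (b i * multiplicity q i + a i * multiplicity q t))"
        by (simp only: of_nat_sum [symmetric])
      then have "(\<Sum>i\<in>I. int (a i * multiplicity q i + b i * multiplicity q t) - int (b i * multiplicity q i + a i * multiplicity q t)) = 0"
        by (simp add: sum_subtractf)
      also have "(\<Sum>i\<in>I. int (a i * multiplicity q i + b i * multiplicity q t) - int (b i * multiplicity q i + a i * multiplicity q t)) = (\<Sum>i\<in>I. (int (a i) - int (b i)) * vec i q)"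
        using True by (intro sum.cong) (auto simp: vec_def algebra_simps)
      finally show ?thesis .
    qed (simp add: vec_def)
    show "\<exists>c. (\<exists>v\<in>S. c v \<noteq> 0) \<and> (\<forall>q. (\<Sum>v\<in>S. c v * v q) = (0::int))"
    proof (intro exI[of _ "\<lambda>s. int (a (inv_into (Kset p t) vec s)) - int (b (inv_into (Kset p t) vec s))"] conjI allI)
      show "\<exists>v\<in>S. int (a (inv_into (Kset p t) vec v)) - int (b (inv_into (Kset p t) vec v)) \<noteq> 0"
        using i0 by (auto simp: I_def)
      fix q
      have "(\<Sum>i\<in>I. (int (a i) - int (b i)) * vec i q) = (\<Sum>s\<in>S. (int (a (inv_into (Kset p t) vec s)) - int (b (inv_into (Kset p t) vec s))) * vec (inv_into (Kset p t) vec s) q)"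
        unfolding I_def by (rule sum.reindex_cong[OF inj]) auto
      also have "\<dots> = (\<Sum>s\<in>S. (int (a (inv_into (Kset p t) vec s)) - int (b (inv_into (Kset p t) vec s))) * s q)"
        using vecI by (intro sum.cong) auto
      finally show "(\<Sum>s\<in>S. (int (a (inv_into (Kset p t) vec s)) - int (b (inv_into (Kset p t) vec s))) * s q) = 0"
        using rel[of q] by simp
    qed
  qed
  then obtain P where P: "finite P" "card P \<le> m" "\<forall>q\<in>P. \<exists>v\<in>vec ` Kset p t. v q \<noteq> 0"
     "\<forall>v\<in>vec ` Kset p t. \<forall>v'\<in>vec ` Kset p t. (\<forall>q\<in>P. v q = v' q) \<longrightarrow> v = v'" by auto
  have primes: "prime q" if "q \<in> P" for q using P(3) that by (auto simp: vec_def split: if_splits)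
  have "inj_on (\<lambda>k. restrict (\<lambda>q. multiplicity q k) P) (Kset p t)"
  proof (rule inj_onI)
    fix k k' assume k: "k \<in> Kset p t" "k' \<in> Kset p t"
      and eq: "restrict (\<lambda>q. multiplicity q k) P = restrict (\<lambda>q. multiplicity q k') P"
    have "multiplicity q k = multiplicity q k'" if "q \<in> P" for q
      using fun_cong[OF eq, of q] that by simp
    then have "\<forall>q\<in>P. vec k q = vec k' q" by (auto simp: vec_def)
    then have "vec k = vec k'" using P(4) k by auto
    then show "k = k'" using vec_inj k by auto
  qed
  then show ?thesis using P primes by blast
qed

section \<open>Counting integers by their valuations at a few primes\<close>

text \<open>Expanding a truncated Euler product gives one term per exponent vector, and by
  \<open>inj\<close> distinct k use distinct vectors. Only the P-part of k enters: k itself may have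
  other prime factors.\<close>

lemma sum_prime_weights_le:
  fixes A P :: "nat set" and s :: real
  assumes fin: "finite A" "finite P" and pr: "\<And>q. q \<in> P \<Longrightarrow> prime q" and s: "s > 0"
    and pos: "\<And>k. k \<in> A \<Longrightarrow> k > 0" and inj: "inj_on (\<lambda>k. restrict (\<lambda>q. multiplicity q k) P) A"
  shows "(\<Sum>k\<in>A. real (\<Prod>q\<in>P. q ^ multiplicity q k) powr - s) \<le> (\<Prod>q\<in>P. 1 / (1 - real q powr - s))"
proof -
  define \<phi> where "\<phi> k = restrict (\<lambda>q. multiplicity q k) P" for k :: nat
  obtain N where N: "\<And>k. k \<in> A \<Longrightarrow> k \<le> N" using fin(1) by (meson finite_nat_set_iff_bounded_le)
  have mult_le: "multiplicity q k \<le> N" if "k \<in> A" "q \<in> P" for q k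
  proof -
    have "q ^ multiplicity q k \<le> k" using pos[OF that(1)] multiplicity_dvd[of q k] by (intro dvd_imp_le) auto
    moreover have "multiplicity q k < q ^ multiplicity q k"
      using prime_gt_1_nat[OF pr[OF that(2)]] by (intro power_gt_expt) auto
    ultimately show ?thesis using N[OF that(1)] by linarith
  qed
  have "real (\<Prod>q\<in>P. q ^ multiplicity q k) powr - s = (\<Prod>q\<in>P. (real q powr - s) ^ \<phi> k q)" for k
  proof -
    have "real (\<Prod>q\<in>P. q ^ multiplicity q k) powr - s = (\<Prod>q\<in>P. (real q ^ multiplicity q k) powr - s)"
      by (simp add: prod_powr_distrib)
    also have "\<dots> = (\<Prod>q\<in>P. (real q powr - s) ^ \<phi> k q)"
    proof (rule prod.cong[OF refl])
      fix q assume "q \<in> P"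
      then have q: "real q > 0" "\<phi> k q = multiplicity q k"
        using prime_gt_0_nat[OF pr] by (auto simp: \<phi>_def)
      have "(real q powr - s) ^ multiplicity q k = real q powr (- s * real (multiplicity q k))"
        using q(1) by (metis powr_gt_zero powr_powr powr_realpow)
      also have "\<dots> = (real q ^ multiplicity q k) powr - s"
        using q(1) by (metis mult.commute powr_powr powr_realpow)
      finally show "(real q ^ multiplicity q k) powr - s = (real q powr - s) ^ \<phi> k q"
        using q(2) by simp
    qed
    finally show ?thesis .
  qed
  then have "(\<Sum>k\<in>A. real (\<Prod>q\<in>P. q ^ multiplicity q k) powr - s) = (\<Sum>a\<in>\<phi> ` A. \<Prod>q\<in>P. (real q powr - s) ^ a q)"
    using inj unfolding \<phi>_def [symmetric] by (subst sum.reindex) auto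
  also have "\<dots> \<le> (\<Sum>a\<in>P \<rightarrow>\<^sub>E {..N}. \<Prod>q\<in>P. (real q powr - s) ^ a q)"
  proof (rule sum_mono2)
    show "finite (P \<rightarrow>\<^sub>E {..N})" using fin by (intro finite_PiE) auto
    show "\<phi> ` A \<subseteq> P \<rightarrow>\<^sub>E {..N}" using mult_le by (auto simp: \<phi>_def)
  qed (auto intro!: prod_nonneg)
  also have "\<dots> = (\<Prod>q\<in>P. \<Sum>a\<in>{..N}. (real q powr - s) ^ a)"
    using fin by (subst prod_sum_PiE) auto
  also have "\<dots> \<le> (\<Prod>q\<in>P. 1 / (1 - real q powr - s))"
  proof (rule prod_mono, safe)
    fix q assume "q \<in> P"
    then have "real q > 1" using pr prime_gt_1_nat by auto
    then have u: "real q powr - s < 1" using s powr_less_one[of "real q" "-s"] by simp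
    have "(\<Sum>a\<le>N. (real q powr - s) ^ a) \<le> (\<Sum>a. (real q powr - s) ^ a)"
      using u by (intro sum_le_suminf summable_geometric) auto
    then show "(\<Sum>a\<le>N. (real q powr - s) ^ a) \<le> 1 / (1 - real q powr - s)"
      using u by (simp add: suminf_geometric)
  qed (auto intro!: sum_nonneg)
  finally show ?thesis .
qed

text \<open>Rankin's trick: the P-part of k divides k and hence is at most t, so every k receives a
  weight t^s / (P-part)^s of at least 1.\<close>

lemma card_le_prime_product:
  fixes A P :: "nat set" and s :: real
  assumes fin: "finite P" and pr: "\<And>q. q \<in> P \<Longrightarrow> prime q" and s: "s > 0"
    and A: "A \<subseteq> {1..t}" and inj: "inj_on (\<lambda>k. restrict (\<lambda>q. multiplicity q k) P) A"
  shows "real (card A) \<le> real t powr s * (\<Prod>q\<in>P. 1 / (1 - real q powr - s))"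
proof -
  have "real (card A) = (\<Sum>k\<in>A. 1)" by simp
  also have "\<dots> \<le> (\<Sum>k\<in>A. real t powr s * real (\<Prod>q\<in>P. q ^ multiplicity q k) powr - s)"
  proof (rule sum_mono)
    fix k assume "k \<in> A"
    then have k: "k > 0" "k \<le> t" using A by auto
    define X where "X = (\<Prod>q\<in>P. q ^ multiplicity q k)"
    have "X = (\<Prod>q\<in>P \<inter> prime_factors k. q ^ multiplicity q k)"
      unfolding X_def using fin pr by (intro prod.mono_neutral_right) (auto simp: prime_factors_multiplicity)
    also have "\<dots> dvd (\<Prod>q\<in>prime_factors k. q ^ multiplicity q k)" by (intro prod_dvd_prod_subset) auto
    also have "\<dots> = k" using k by (simp add: prod_prime_factors)
    finally have X: "X \<le> t" "X > 0" using k dvd_imp_le[of X k] dvd_pos_nat[of k X] by auto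
    have "real t powr s * real X powr - s = (real t / real X) powr s"
      using X by (simp add: powr_minus powr_divide divide_simps)
    also have "\<dots> \<ge> 1 powr s" using X s by (intro powr_mono2) auto
    finally show "1 \<le> real t powr s * real (\<Prod>q\<in>P. q ^ multiplicity q k) powr - s" by (simp add: X_def)
  qed
  also have "\<dots> = real t powr s * (\<Sum>k\<in>A. real (\<Prod>q\<in>P. q ^ multiplicity q k) powr - s)"
    by (rule sum_distrib_left [symmetric])
  also have "\<dots> \<le> real t powr s * (\<Prod>q\<in>P. 1 / (1 - real q powr - s))"
    using A inj finite_subset[OF A] by (intro mult_left_mono sum_prime_weights_le fin pr s) auto
  finally show ?thesis .
qed

section \<open>Digit expansions and exceptional divisors\<close>

text \<open>The exponents E^i act like digits: E^I = 1 + (E - 1) (1 + E + ... + E^(I - 1)), so the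
  top factor outweighs all lower ones. If the top entries differ, let u / w be their ratio in lowest
  terms. With e = E^I and s the sum of the lower exponents, u^e divides the lower product on one
  side and w^e the one on the other, so h^e <= T^s, contradicting T <= h^(E - 1).\<close>

lemma digit_products_inj:
  fixes f f' :: "nat \<Rightarrow> nat"
  assumes K: "\<And>k. k \<in> K \<Longrightarrow> 1 \<le> k \<and> k \<le> T"
    and sep: "\<And>k k'. k \<in> K \<Longrightarrow> k' \<in> K \<Longrightarrow> k \<noteq> k' \<Longrightarrow> h \<le> max (k div gcd k k') (k' div gcd k k')"
    and h: "h \<ge> 2" and E: "E \<ge> 1" "T \<le> h ^ (E - 1)"
    and f: "\<And>i. i < I \<Longrightarrow> f i \<in> K" "\<And>i. i < I \<Longrightarrow> f' i \<in> K"
    and eq: "(\<Prod>i<I. f i ^ (E ^ i)) = (\<Prod>i<I. f' i ^ (E ^ i))"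
  shows "\<forall>i<I. f i = f' i"
  using f eq
proof (induction I)
  case (Suc I)
  define e where "e = E ^ I"
  define s where "s = (\<Sum>i<I. E ^ i)"
  have e_eq: "e = Suc ((E - 1) * s)"
  proof -
    have "int E ^ I - 1 = (int E - 1) * (\<Sum>i<I. int E ^ i)" by (rule power_diff_1_eq)
    then have "int e = int (Suc ((E - 1) * s))" using E(1) by (simp add: e_def s_def of_nat_diff algebra_simps)
    then show ?thesis by (simp only: of_nat_eq_iff)
  qed
  have prod_le: "(\<Prod>i<I. g i ^ (E ^ i)) \<le> T ^ s \<and> (\<Prod>i<I. g i ^ (E ^ i)) > 0" if "\<And>i. i < Suc I \<Longrightarrow> g i \<in> K" for g
  proof -
    have *: "1 \<le> g i \<and> g i \<le> T" if "i < I" for i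
      using K[of "g i"] \<open>\<And>i. i < Suc I \<Longrightarrow> g i \<in> K\<close>[of i] that by simp
    have "(\<Prod>i<I. g i ^ (E ^ i)) \<le> (\<Prod>i<I. T ^ (E ^ i))" using * by (intro prod_mono) (auto intro: power_mono)
    also have "\<dots> = T ^ s" by (simp add: s_def power_sum)
    finally show ?thesis using * by (auto intro!: prod_pos simp: Suc_le_eq)
  qed
  define X where "X = (\<Prod>i<I. f i ^ (E ^ i))"
  define Y where "Y = (\<Prod>i<I. f' i ^ (E ^ i))"
  have X: "X \<le> T ^ s" "X > 0" using prod_le[of f] Suc.prems(1) by (auto simp: X_def)
  have Y: "Y \<le> T ^ s" "Y > 0" using prod_le[of f'] Suc.prems(2) by (auto simp: Y_def)
  have XY: "X * f I ^ e = Y * f' I ^ e" using Suc.prems(3) by (simp add: X_def Y_def e_def)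
  have fI: "f I \<in> K" "f' I \<in> K" using Suc.prems by auto
  have top: "f I = f' I"
  proof (rule ccontr)
    assume ne: "f I \<noteq> f' I"
    define d where "d = gcd (f I) (f' I)"
    define u where "u = f I div d"
    define w where "w = f' I div d"
    have d0: "d > 0" using K[OF fI(1)] by (simp add: d_def)
    have uw: "f I = d * u" "f' I = d * w" by (simp_all add: u_def w_def d_def)
    have cop: "coprime u w" unfolding u_def w_def d_def using K[OF fI(1)] by (intro div_gcd_coprime) auto
    have hle: "h \<le> max u w" using sep[OF fI ne] by (simp add: u_def w_def d_def)
    have eq: "X * u ^ e = Y * w ^ e" using XY d0 by (simp add: uw power_mult_distrib)
    have "u ^ e dvd Y * w ^ e" by (metis eq dvd_triv_right)
    then have "u ^ e dvd Y" using cop coprime_dvd_mult_left_iff coprime_power_left_iff coprime_power_right_iff by metis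
    then have ule: "u ^ e \<le> T ^ s" using Y dvd_imp_le order_trans by blast
    have "w ^ e dvd X * u ^ e" by (metis eq dvd_triv_right)
    then have "w ^ e dvd X" using cop coprime_dvd_mult_left_iff coprime_power_left_iff coprime_power_right_iff coprime_commute by metis
    then have wle: "w ^ e \<le> T ^ s" using X dvd_imp_le order_trans by blast
    have "h ^ e \<le> (max u w) ^ e" using hle by (rule power_mono) simp
    also have "\<dots> \<le> T ^ s" using ule wle by (simp add: max_def)
    also have "\<dots> \<le> (h ^ (E - 1)) ^ s" using E(2) by (rule power_mono) simp
    also have "\<dots> = h ^ ((E - 1) * s)" by (simp add: power_mult)
    also have "\<dots> < h ^ e" using h by (intro power_strict_increasing) (auto simp: e_eq)
    finally show False by simp
  qed
  moreover have "f I > 0" using K[OF fI(1)] by simp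
  ultimately have "X = Y" using XY by simp
  then have "\<forall>i<I. f i = f' i"
    unfolding X_def Y_def using Suc.prems(1,2) by (intro Suc.IH) simp_all
  then show ?case using top less_Suc_eq by auto
qed simp

text \<open>Tuples of length I are mapped to the products of (d k_i)^(E^i) mod p. The values are
  among the at most t roots of z^t = 1, and the map is injective: the power of d is the same for all
  tuples and cancels, and by \<open>small\<close> the remaining products are below p, so congruence
  is equality.\<close>

lemma Kset_card_power_le:
  assumes p: "prime p" and t: "t dvd p - 1"
    and sep: "\<And>k k'. k \<in> Kset p t \<Longrightarrow> k' \<in> Kset p t \<Longrightarrow> k \<noteq> k' \<Longrightarrow> h \<le> max (k div gcd k k') (k' div gcd k k')"
    and h: "h \<ge> 2" and E: "E \<ge> 2" "t \<le> h ^ (E - 1)" and small: "t ^ (E ^ I) < p"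
  shows "card (Kset p t) ^ I \<le> t"
proof -
  have n0: "p - 1 > 0" using prime_gt_1_nat[OF p] by simp
  have t0: "t > 0" by (rule dvd_pred_prime(1)[OF p t])
  define d where "d = (p - 1) div t"
  have copd: "coprime d p" unfolding d_def by (rule cofactor_coprime(3)[OF p t])
  define S where "S = (\<Sum>i<I. E ^ i)"
  have S: "S \<le> E ^ I" unfolding S_def using E(1)
  proof (induction I)
    case (Suc I)
    have "(\<Sum>i<Suc I. E ^ i) \<le> E ^ I + E ^ I" using Suc by simp
    also have "\<dots> \<le> E * E ^ I" using E(1) by (metis mult_2 mult_le_mono1)
    finally show ?case by simp
  qed simp
  define \<phi> where "\<phi> f = (\<Prod>i<I. (d * f i) ^ (E ^ i)) mod p" for f :: "nat \<Rightarrow> nat"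
  define W where "W = {..<I} \<rightarrow>\<^sub>E Kset p t"
  have "inj_on \<phi> W"
  proof (rule inj_onI)
    fix f f' assume f: "f \<in> W" "f' \<in> W" and eq: "\<phi> f = \<phi> f'"
    have split: "(\<Prod>i<I. (d * g i) ^ (E ^ i)) = d ^ S * (\<Prod>i<I. g i ^ (E ^ i))" for g :: "nat \<Rightarrow> nat"
      by (simp add: power_mult_distrib prod.distrib S_def power_sum)
    have "[d ^ S * (\<Prod>i<I. f i ^ (E ^ i)) = d ^ S * (\<Prod>i<I. f' i ^ (E ^ i))] (mod p)"
      using eq unfolding \<phi>_def split Cong.cong_def .
    then have c: "[(\<Prod>i<I. f i ^ (E ^ i)) = (\<Prod>i<I. f' i ^ (E ^ i))] (mod p)"
      using copd cong_mult_lcancel_nat[of "d ^ S" p] by simp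
    have lt: "(\<Prod>i<I. g i ^ (E ^ i)) < p" if g: "g \<in> W" for g
    proof -
      have "(\<Prod>i<I. g i ^ (E ^ i)) \<le> (\<Prod>i<I. t ^ (E ^ i))"
        using g KsetD(2) by (intro prod_mono) (auto simp: W_def PiE_iff intro!: power_mono)
      also have "\<dots> = t ^ S" by (simp add: S_def power_sum)
      also have "\<dots> \<le> t ^ (E ^ I)" using S t0 by (intro power_increasing) auto
      finally show ?thesis using small by simp
    qed
    have "(\<Prod>i<I. f i ^ (E ^ i)) = (\<Prod>i<I. f' i ^ (E ^ i))"
      using c lt[OF f(1)] lt[OF f(2)] by (simp add: cong_less_modulus_unique_nat)
    then have "\<forall>i<I. f i = f' i"
      using f E KsetD(1,2) by (intro digit_products_inj[where K = "Kset p t" and T = t and h = h and E = E] sep h)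
        (auto simp: W_def PiE_iff)
    then show "f = f'" using f unfolding W_def by (intro PiE_ext) auto
  qed
  then have "card W = card (\<phi> ` W)" by (simp add: card_image)
  also have "\<dots> \<le> card {z\<in>{..<p}. [z ^ t = 1] (mod p)}"
  proof (rule card_mono)
    show "\<phi> ` W \<subseteq> {z\<in>{..<p}. [z ^ t = 1] (mod p)}"
    proof safe
      fix f assume f: "f \<in> W"
      show "\<phi> f < p" unfolding \<phi>_def using n0 by simp
      have "[(\<Prod>i<I. (d * f i) ^ (E ^ i)) ^ t = (\<Prod>i<I. 1)] (mod p)"
        unfolding prod_power_distrib
      proof (rule cong_prod)
        fix i assume "i \<in> {..<I}"
        then have "f i \<in> Kset p t" using f by (auto simp: W_def)
        then have "[((d * f i) ^ t) ^ (E ^ i) = 1 ^ (E ^ i)] (mod p)"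
          using KsetD(4) unfolding d_def by (intro cong_pow) auto
        then show "[((d * f i) ^ (E ^ i)) ^ t = 1] (mod p)"
          by (simp add: power_mult [symmetric] mult.commute)
      qed
      then show "[\<phi> f ^ t = 1] (mod p)" unfolding \<phi>_def Cong.cong_def power_mod by simp
    qed
  qed simp
  also have "\<dots> \<le> t" using p t0 by (intro roots_mod_prime_bound) auto
  finally show ?thesis unfolding W_def by (simp add: card_PiE)
qed

section \<open>Exceptional divisors: orders of fractions of small height\<close>

text \<open>The common factors (p - 1) / t and gcd k k' are invertible mod p and cancel from the
  congruence of t-th powers. So two elements whose reduced ratio has small height make t a multiple
  of the order of that fraction, which is what \<open>exceptional_sum_le\<close> exploits.\<close>

lemma Kset_close_pair:
  assumes p: "prime p" and t: "t dvd p - 1" and k: "k \<in> Kset p t" "k' \<in> Kset p t" "k \<noteq> k'"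
  shows "k div gcd k k' \<noteq> k' div gcd k k'" "k div gcd k k' \<ge> 1" "k' div gcd k k' \<ge> 1"
    "[(k div gcd k k') ^ t = (k' div gcd k k') ^ t] (mod p)"
proof -
  have n0: "p - 1 > 0" using prime_gt_1_nat[OF p] by simp
  have t0: "t > 0" by (rule dvd_pred_prime(1)[OF p t])
  define d where "d = (p - 1) div t"
  have copd: "coprime d p" unfolding d_def by (rule cofactor_coprime(3)[OF p t])
  define g where "g = gcd k k'"
  have k1: "k \<ge> 1" "k \<le> t" "k' \<ge> 1" using KsetD(1,2) k by auto
  have tp: "t < p" using t n0 dvd_imp_le[of t "p - 1"] by linarith
  have g: "g > 0" "g \<le> t" using k1 by (auto simp: g_def intro: order_trans[OF gcd_le1_nat])
  have copg: "coprime g p"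
    using p g tp by (metis coprime_commute nat_dvd_not_less order_le_less_trans prime_imp_coprime)
  have kk: "k = g * (k div g)" "k' = g * (k' div g)" by (simp_all add: g_def)
  show "k div gcd k k' \<noteq> k' div gcd k k'" using kk k(3) unfolding g_def by metis
  show "k div gcd k k' \<ge> 1" "k' div gcd k k' \<ge> 1" using kk k1 unfolding g_def
    by (metis Suc_leI bot_nat_0.not_eq_extremum mult_0_right not_one_le_zero One_nat_def)+
  have "[(d * k) ^ t = (d * k') ^ t] (mod p)"
    using KsetD(4)[OF k(1)] KsetD(4)[OF k(2)] unfolding d_def by (meson cong_sym cong_trans)
  then have "[(d * g) ^ t * (k div g) ^ t = (d * g) ^ t * (k' div g) ^ t] (mod p)"
    by (simp only: power_mult_distrib [symmetric] mult.assoc kk [symmetric])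
  then show "[(k div gcd k k') ^ t = (k' div gcd k k') ^ t] (mod p)"
    using copd copg unfolding g_def [symmetric] by (subst (asm) cong_mult_lcancel_nat) auto
qed

lemma harm_le: "(\<Sum>j\<in>{1..N}. 1 / real j) \<le> 1 + ln (real N)" if "N \<ge> 1"
  using that
proof (induction N rule: dec_induct)
  case (step N)
  have "1 / real (Suc N) = 1 - real N / real (Suc N)" by (simp add: field_simps)
  also have "\<dots> \<le> - ln (real N / real (Suc N))"
    using ln_le_minus_one[of "real N / real (Suc N)"] step by simp
  also have "\<dots> = ln (real (Suc N)) - ln (real N)" using step by (simp add: ln_div)
  finally show ?case using step by simp
qed simp

lemma sum_multiples_le:
  assumes e: "e > 0" and A: "A \<subseteq> {1..T}" "\<And>t. t \<in> A \<Longrightarrow> e dvd t" and T: "T \<ge> 1"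
  shows "(\<Sum>t\<in>A. 1 / real t) \<le> (1 + ln (real T)) / real e"
proof -
  have "(\<Sum>t\<in>A. 1 / real t) \<le> (\<Sum>t\<in>(*) e ` {1..T}. 1 / real t)"
  proof (rule sum_mono2)
    show "A \<subseteq> (*) e ` {1..T}"
    proof
      fix t assume t: "t \<in> A"
      then obtain c where c: "t = e * c" using A(2) by auto
      have "t \<in> {1..T}" using t A(1) by auto
      moreover have "c \<le> e * c" using e by simp
      ultimately have "c \<in> {1..T}" using c by (cases c) auto
      then show "t \<in> (*) e ` {1..T}" using c by auto
    qed
  qed auto
  also have "\<dots> = (\<Sum>j\<in>{1..T}. 1 / real (e * j))"
    using e by (subst sum.reindex) (auto simp: inj_on_def)
  also have "\<dots> = (\<Sum>j\<in>{1..T}. 1 / real j) / real e" by (simp add: sum_divide_distrib field_simps)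
  also have "\<dots> \<le> (1 + ln (real T)) / real e" using harm_le[OF T] e by (intro divide_right_mono) auto
  finally show ?thesis .
qed

lemma sum_UNION_le:
  fixes f :: "'b \<Rightarrow> real"
  assumes "finite I" "\<And>i. i \<in> I \<Longrightarrow> finite (B i)" "\<And>x. f x \<ge> 0"
  shows "sum f (\<Union>i\<in>I. B i) \<le> (\<Sum>i\<in>I. sum f (B i))"
  using assms(1,2)
proof (induction I rule: finite_induct)
  case (insert i I)
  have "sum f (B i \<union> (\<Union>i\<in>I. B i)) + sum f (B i \<inter> (\<Union>i\<in>I. B i)) = sum f (B i) + sum f (\<Union>i\<in>I. B i)"
    using insert by (intro sum.union_inter) auto
  moreover have "sum f (B i \<inter> (\<Union>i\<in>I. B i)) \<ge> 0" using assms(3) by (intro sum_nonneg)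
  ultimately show ?case using insert by simp
qed simp

text \<open>For fixed u and w the offending t are multiples of the order e of u / w. The powers u^e
  and w^e are distinct but congruent, so h^e >= p. Hence e >= ln p / ln h, and these t contribute at
  most (1 + ln T) / e; there are at most h^2 pairs.\<close>

lemma exceptional_sum_le:
  assumes p: "prime p" and T: "T \<ge> 1" and h: "h \<ge> 2" "h \<le> p"
    and A: "A \<subseteq> {1..T}"
    and exc: "\<And>t. t \<in> A \<Longrightarrow> \<exists>u w. u \<noteq> w \<and> 1 \<le> u \<and> 1 \<le> w \<and> u < h \<and> w < h \<and> [u ^ t = w ^ t] (mod p)"
  shows "(\<Sum>t\<in>A. 1 / real t) \<le> real h ^ 2 * (ln (real h) / ln (real p) * (1 + ln (real T)))"
proof -
  define B where "B u w = {t\<in>{1..T}. [u ^ t = w ^ t] (mod p)}" for u w :: nat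
  define R where "R = {(u, w) \<in> {1..<h} \<times> {1..<h}. u \<noteq> w}"
  have p1: "p > 1" using prime_gt_1_nat[OF p] .
  have finR: "finite R" unfolding R_def by (rule finite_subset[of _ "{1..<h} \<times> {1..<h}"]) auto
  have B: "(\<Sum>t\<in>B u w. 1 / real t) \<le> ln (real h) / ln (real p) * (1 + ln (real T))" if uw: "(u, w) \<in> R" for u w
  proof -
    have uw': "1 \<le> u" "u < h" "1 \<le> w" "w < h" "u \<noteq> w" using uw by (auto simp: R_def)
    have wp: "\<not> p dvd w" "\<not> p dvd u" using uw' h nat_dvd_not_less by auto
    \<comment> \<open>The residue of u / w: by Fermat, w^(p - 2) inverts w.\<close>
    define z where "z = u * w ^ (p - 2)"
    have w1: "[w ^ (p - 1) = 1] (mod p)" using fermat_theorem[OF p wp(1)] .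
    have copw: "coprime w p" using p wp(1) by (metis coprime_commute prime_imp_coprime)
    have iff: "[u ^ t = w ^ t] (mod p) \<longleftrightarrow> [z ^ t = 1] (mod p)" for t
    proof -
      have "[z ^ t * w ^ t = u ^ t] (mod p)"
      proof -
        have "z ^ t * w ^ t = u ^ t * (w ^ (p - 1)) ^ t"
          using p1 prime_ge_2_nat[OF p] by (simp add: z_def power_mult_distrib [symmetric] mult.assoc power_Suc2 [symmetric] del: power_Suc)
             (simp add: Suc_diff_Suc numeral_2_eq_2)
        also have "[\<dots> = u ^ t * 1 ^ t] (mod p)" using w1 by (intro cong_mult cong_pow cong_refl)
        finally show ?thesis by simp
      qed
      then have "[u ^ t = w ^ t] (mod p) \<longleftrightarrow> [z ^ t * w ^ t = 1 * w ^ t] (mod p)"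
        unfolding Cong.cong_def by auto
      also have "\<dots> \<longleftrightarrow> [z ^ t = 1] (mod p)"
        using copw by (intro cong_mult_rcancel_nat) auto
      finally show ?thesis .
    qed
    define e where "e = ord p z"
    have ze: "[z ^ e = 1] (mod p)" unfolding e_def by (rule ord)
    have dvd: "e dvd t" if "t \<in> B u w" for t
    proof -
      have "[z ^ t = 1] (mod p)" using that iff[of t] unfolding B_def by blast
      then show ?thesis unfolding e_def by (simp only: ord_divides)
    qed
    show ?thesis
    proof (cases "B u w = {}")
      case False
      then obtain t where t: "t \<in> B u w" by auto
      then have "e > 0" using dvd[OF t] by (auto simp: B_def dest: dvd_pos_nat)
      have "[u ^ e = w ^ e] (mod p)" using iff ze by simp
      moreover have "u ^ e \<noteq> w ^ e" using uw'(5) \<open>e > 0\<close> power_eq_iff_eq_base[of e u w] by auto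
      ultimately have "\<not> (u ^ e < p \<and> w ^ e < p)" using cong_less_modulus_unique_nat by blast
      moreover have "u ^ e \<le> h ^ e" "w ^ e \<le> h ^ e" using uw' by (auto intro: power_mono)
      ultimately have "p \<le> h ^ e" by linarith
      then have "real p \<le> real h ^ e" by (metis of_nat_le_iff of_nat_power)
      then have "ln (real p) \<le> ln (real h ^ e)" using p1 h by (subst ln_le_cancel_iff) auto
      also have "\<dots> = real e * ln (real h)" using h by (simp add: ln_realpow)
      finally have "1 / real e \<le> ln (real h) / ln (real p)"
        using \<open>e > 0\<close> p1 by (simp add: field_simps)
      moreover have "(\<Sum>t\<in>B u w. 1 / real t) \<le> (1 + ln (real T)) / real e"
        using \<open>e > 0\<close> dvd T by (intro sum_multiples_le) (auto simp: B_def)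
      moreover have "(1 + ln (real T)) * (1 / real e) \<le> (1 + ln (real T)) * (ln (real h) / ln (real p))"
        using calculation(1) T by (intro mult_left_mono) auto
      ultimately show ?thesis by (simp add: mult_ac)
    qed (use h p1 T in auto)
  qed
  have "(\<Sum>t\<in>A. 1 / real t) \<le> (\<Sum>t\<in>(\<Union>r\<in>R. B (fst r) (snd r)). 1 / real t)"
  proof (rule sum_mono2)
    show "A \<subseteq> (\<Union>r\<in>R. B (fst r) (snd r))"
    proof
      fix t assume t: "t \<in> A"
      obtain u w where "u \<noteq> w \<and> 1 \<le> u \<and> 1 \<le> w \<and> u < h \<and> w < h \<and> [u ^ t = w ^ t] (mod p)" using exc[OF t] by auto
      then show "t \<in> (\<Union>r\<in>R. B (fst r) (snd r))"
        using t A by (intro UN_I[of "(u, w)"]) (auto simp: R_def B_def)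
    qed
  qed (use finR in \<open>auto simp: B_def\<close>)
  also have "\<dots> \<le> (\<Sum>r\<in>R. \<Sum>t\<in>B (fst r) (snd r). 1 / real t)"
    using finR by (intro sum_UNION_le) (auto simp: B_def)
  also have "\<dots> \<le> (\<Sum>r\<in>R. ln (real h) / ln (real p) * (1 + ln (real T)))"
    using B by (intro sum_mono) auto
  also have "\<dots> = real (card R) * (ln (real h) / ln (real p) * (1 + ln (real T)))" by simp
  also have "\<dots> \<le> real h ^ 2 * (ln (real h) / ln (real p) * (1 + ln (real T)))"
  proof (rule mult_right_mono)
    have "card R \<le> card ({1..<h} \<times> {1..<h})" unfolding R_def by (intro card_mono) auto
    also have "\<dots> \<le> h ^ 2" by (simp add: power2_eq_square mult_le_mono)
    finally show "real (card R) \<le> real h ^ 2" by (metis of_nat_le_iff of_nat_power)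
  qed (use h p1 T in auto)
  finally show ?thesis .
qed

section \<open>Sparsity of prime extensions\<close>

lemma card_primes_dvd_le:
  fixes z L :: nat
  assumes "finite Q" "\<And>q. q \<in> Q \<Longrightarrow> prime q \<and> q dvd z" "z > 0" "z < 2 ^ L"
  shows "card Q \<le> L"
proof -
  have "2 ^ card Q = (\<Prod>q\<in>Q. 2::nat)" by simp
  also have "\<dots> \<le> (\<Prod>q\<in>Q. q)" using assms(2) by (intro prod_mono) (auto dest: prime_ge_2_nat)
  also have "\<dots> \<le> (\<Prod>q\<in>prime_factors z. q)"
  proof (rule dvd_imp_le)
    show "\<Prod>Q dvd \<Prod>(prime_factors z)"
      using assms by (intro prod_dvd_prod_subset) (auto simp: prime_factors_dvd)
    show "0 < \<Prod>(prime_factors z)" by (intro prod_pos) (auto intro: prime_gt_0_nat)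
  qed
  also have "\<dots> \<le> (\<Prod>q\<in>prime_factors z. q ^ multiplicity q z)"
    by (intro prod_mono) (auto simp: prime_factors_multiplicity intro!: self_le_power prime_ge_1_nat)
  also have "\<dots> = z" using assms(3) by (simp add: prod_prime_factors)
  also have "\<dots> < 2 ^ L" by fact
  finally show ?thesis by (simp add: less_imp_le)
qed

text \<open>Each choice rules out at most L elements, so fewer than card Q / L choices cannot
  exhaust Q. The constraint is one-sided: later elements avoid the sets of earlier ones.\<close>

lemma greedy_sequence:
  fixes D :: "nat \<Rightarrow> nat set" and Q :: "nat set"
  assumes fin: "finite Q" and D: "\<And>q. q \<in> Q \<Longrightarrow> finite (D q) \<and> card (D q) \<le> L"
    and big: "j * L < card Q \<or> j = 0"
  shows "\<exists>s. (\<forall>i<j. s i \<in> Q) \<and> (\<forall>i'<j. \<forall>i<i'. s i' \<notin> D (s i))"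
  using big
proof (induction j)
  case (Suc j)
  then have "j * L < card Q \<or> j = 0" by (cases j) auto
  then obtain s where s: "\<forall>i<j. s i \<in> Q" "\<forall>i'<j. \<forall>i<i'. s i' \<notin> D (s i)" using Suc.IH by auto
  have "card (\<Union>i<j. D (s i)) \<le> (\<Sum>i<j. card (D (s i)))" by (rule card_UN_le) simp
  also have "\<dots> \<le> (\<Sum>i<j. L)" using s D by (intro sum_mono) auto
  also have "\<dots> < card Q" using Suc.prems by auto
  finally have "\<not> Q \<subseteq> (\<Union>i<j. D (s i))" using s D
    by (meson card_mono finite_UN_I finite_lessThan lessThan_iff linorder_not_less)
  then obtain x where x: "x \<in> Q" "x \<notin> (\<Union>i<j. D (s i))" by auto
  show ?case
    by (rule exI[of _ "s(j := x)"]) (use s x in \<open>auto simp: less_Suc_eq\<close>)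
qed simp

text \<open>The moduli g q share the factor g, so m of them have a common multiple of size T Y^m,
  and V need exceed Y only by a bounded factor once m is of the order of ln T. From too many q one
  picks m primes s_i, none dividing g, each avoiding the numerators attached to the earlier ones. In
  the resulting relation take the last i with a i different from b i. At the prime s_i all other
  terms have equal valuations on both sides, whereas g s_i is divisible by s_i and its numerator is
  not; this forces a i = b i. The bound counts L primes dividing g and L + 1 exclusions per chosen
  prime.\<close>

lemma sparse_prime_extensions:
  assumes p: "prime p" and fin: "finite Q"
    and Q: "\<And>q. q \<in> Q \<Longrightarrow> prime q \<and> q \<le> Y \<and> g * q \<le> T \<and> g * q dvd p - 1 \<and> Kset p (g * q) \<noteq> {}"
    and g: "g > 0" and L: "T < 2 ^ L" and m: "m > 0" and V: "T * Y ^ m < V ^ m"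
    and small: "2 * T ^ (2 * m * V) < p"
  shows "card Q \<le> L + m * (L + 1)"
proof (rule ccontr)
  assume neg: "\<not> ?thesis"
  define Q' where "Q' = {q \<in> Q. \<not> q dvd g}"
  have "Q \<noteq> {}" using neg by auto
  then obtain q0 where q0: "q0 \<in> Q" by auto
  have gT: "g \<le> T" using Q[OF q0] g by (metis One_nat_def Suc_leI le_trans mult.right_neutral mult_le_mono2 prime_gt_0_nat)
  have "card {q \<in> Q. q dvd g} \<le> L"
    using g gT L fin Q by (intro card_primes_dvd_le[where z = g]) auto
  moreover have "card Q = card Q' + card {q \<in> Q. q dvd g}"
    unfolding Q'_def using fin by (subst card_Un_disjoint [symmetric]) (auto intro!: arg_cong[where f = card])
  ultimately have Q'_big: "m * (L + 1) < card Q'" using neg by linarith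
  define \<kappa> where "\<kappa> q = (SOME k. k \<in> Kset p (g * q))" for q
  have \<kappa>: "\<kappa> q \<in> Kset p (g * q)" if "q \<in> Q" for q
    unfolding \<kappa>_def using Q[OF that] by (simp add: some_in_eq)
  \<comment> \<open>Including q itself makes the chosen primes distinct.\<close>
  define D where "D q = insert q {r \<in> Q'. r dvd \<kappa> q}" for q
  have finQ': "finite Q'" using fin by (simp add: Q'_def)
  have "\<exists>s. (\<forall>i<m. s i \<in> Q') \<and> (\<forall>i'<m. \<forall>i<i'. s i' \<notin> D (s i))"
  proof (rule greedy_sequence[OF finQ'])
    fix q assume q: "q \<in> Q'"
    then have qQ: "q \<in> Q" by (simp add: Q'_def)
    have "card {r \<in> Q'. r dvd \<kappa> q} \<le> L"
    proof (rule card_primes_dvd_le[where z = "\<kappa> q"])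
      show "\<kappa> q < 2 ^ L" using KsetD(2)[OF \<kappa>[OF qQ]] Q[OF qQ] L by linarith
      show "\<kappa> q > 0" using KsetD(1)[OF \<kappa>[OF qQ]] by simp
      show "finite {r \<in> Q'. r dvd \<kappa> q}" using finQ' by simp
    qed (use Q in \<open>auto simp: Q'_def\<close>)
    then show "finite (D q) \<and> card (D q) \<le> L + 1"
      unfolding D_def using finQ' by (simp add: card_insert_if)
  qed (use Q'_big in simp)
  then obtain s where s: "\<And>i. i < m \<Longrightarrow> s i \<in> Q'" "\<And>i i'. i' < m \<Longrightarrow> i < i' \<Longrightarrow> s i' \<notin> D (s i)" by blast
  have sQ: "s i \<in> Q" "\<not> s i dvd g" if "i < m" for i using s(1)[OF that] by (auto simp: Q'_def)
  define M where "M = g * (\<Prod>i<m. s i)"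
  have "(\<Prod>i<m. s i) \<le> (\<Prod>i<m. Y)" using sQ Q by (intro prod_mono) auto
  then have M: "M \<le> T * Y ^ m" unfolding M_def using gT by (intro mult_le_mono) auto
  have "\<exists>a b. a \<noteq> b \<and> a \<in> {..<m} \<rightarrow>\<^sub>E {..<V} \<and> b \<in> {..<m} \<rightarrow>\<^sub>E {..<V} \<and>
    (\<Prod>i<m. \<kappa> (s i) ^ a i * (g * s i) ^ b i) = (\<Prod>i<m. \<kappa> (s i) ^ b i * (g * s i) ^ a i)"
  proof (rule Kset_relation[OF p, where T = T and M = M])
    show "\<And>i. i \<in> {..<m} \<Longrightarrow> g * s i dvd M" unfolding M_def by (intro mult_dvd_mono dvd_prodI) auto
    show "0 < M" unfolding M_def using g sQ Q by (auto intro!: prod_pos simp: prime_gt_0_nat)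
    show "M < V ^ card {..<m}" using M V by simp
  qed (use sQ Q \<kappa> small in auto)
  then obtain a b where ab: "a \<noteq> b" "a \<in> {..<m} \<rightarrow>\<^sub>E {..<V}" "b \<in> {..<m} \<rightarrow>\<^sub>E {..<V}"
    "(\<Prod>i<m. \<kappa> (s i) ^ a i * (g * s i) ^ b i) = (\<Prod>i<m. \<kappa> (s i) ^ b i * (g * s i) ^ a i)" by blast
  define J where "J = {i. i < m \<and> a i \<noteq> b i}"
  have "J \<noteq> {}" unfolding J_def using ab(1-3) by (metis (mono_tags, lifting) PiE_ext empty_Collect_eq lessThan_iff)
  moreover have finJ: "finite J" unfolding J_def by auto
  ultimately have MaxJ: "Max J \<in> J" by (rule Max_in[rotated])
  define i where "i = Max J"
  have i: "i < m" "a i \<noteq> b i" using MaxJ by (auto simp: J_def i_def)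
  have above: "a l = b l" if "l < m" "i < l" for l
    using that finJ Max_ge[of J l] by (fastforce simp: J_def i_def)
  define q where "q = s i"
  have qpr: "prime q" using sQ i Q by (auto simp: q_def)
  have kpos: "\<kappa> (s l) > 0" if "l < m" for l using KsetD(1)[OF \<kappa>[OF sQ(1)[OF that]]] by simp
  have tpos: "g * s l > 0" if "l < m" for l using g Q[OF sQ(1)[OF that]] by (simp add: prime_gt_0_nat)
  have mult: "multiplicity q (\<Prod>l<m. \<kappa> (s l) ^ a l * (g * s l) ^ b l) =
     (\<Sum>l<m. a l * multiplicity q (\<kappa> (s l)) + b l * multiplicity q (g * s l))" for a b :: "nat \<Rightarrow> nat"
    using kpos tpos by (intro multiplicity_prod_mixed[OF qpr]) auto
  have eq: "(\<Sum>l<m. a l * multiplicity q (\<kappa> (s l)) + b l * multiplicity q (g * s l)) =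
       (\<Sum>l<m. b l * multiplicity q (\<kappa> (s l)) + a l * multiplicity q (g * s l))"
    using mult[of a b] mult[of b a] ab(4) by simp
  have "a l * multiplicity q (\<kappa> (s l)) + b l * multiplicity q (g * s l) =
        b l * multiplicity q (\<kappa> (s l)) + a l * multiplicity q (g * s l)" if l: "l < m" "l \<noteq> i" for l
  proof (cases "l < i")
    case True
    then have nD: "q \<notin> D (s l)" using s(2)[OF i(1) True] by (simp add: q_def)
    have "\<not> q dvd \<kappa> (s l)" "q \<noteq> s l" using nD s(1)[OF i(1)] by (auto simp: D_def q_def)
    moreover have "\<not> q dvd g" using sQ(2)[OF i(1)] by (simp add: q_def)
    moreover have "\<not> q dvd s l" using calculation(2) qpr Q[OF sQ(1)[OF l(1)]] primes_dvd_imp_eq by blast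
    ultimately have "multiplicity q (\<kappa> (s l)) = 0" "multiplicity q (g * s l) = 0"
      using qpr by (auto intro!: not_dvd_imp_multiplicity_0 simp: prime_dvd_mult_iff)
    then show ?thesis by simp
  next
    case False
    then show ?thesis using above[of l] l by simp
  qed
  then have "(\<Sum>l\<in>{..<m}-{i}. a l * multiplicity q (\<kappa> (s l)) + b l * multiplicity q (g * s l)) =
       (\<Sum>l\<in>{..<m}-{i}. b l * multiplicity q (\<kappa> (s l)) + a l * multiplicity q (g * s l))"
    by (intro sum.cong) auto
  then have "a i * multiplicity q (\<kappa> (s i)) + b i * multiplicity q (g * s i) =
       b i * multiplicity q (\<kappa> (s i)) + a i * multiplicity q (g * s i)"
    using eq i(1) by (simp add: sum.remove[of "{..<m}" i])
  moreover have "multiplicity q (\<kappa> (s i)) = 0"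
  proof (rule not_dvd_imp_multiplicity_0)
    have "coprime (\<kappa> (s i)) (g * s i)" using KsetD(3)[OF \<kappa>[OF sQ(1)[OF i(1)]]] .
    then show "\<not> q dvd \<kappa> (s i)" unfolding q_def using qpr[unfolded q_def]
      by (meson coprime_common_divisor dvd_triv_right not_prime_unit)
  qed
  moreover have "multiplicity q (g * s i) > 0"
    using qpr tpos[OF i(1)] by (simp add: prime_multiplicity_gt_zero_iff q_def)
  ultimately show False using i(2) by simp
qed

section \<open>Rankin's method and Chebyshev bounds\<close>

lemma euler_product_bound:
  fixes S Q :: "nat set" and s :: real
  assumes fin: "finite S" "finite Q" and pr: "\<And>q. q \<in> Q \<Longrightarrow> prime q" and s: "s > 0"
    and S: "\<And>t. t \<in> S \<Longrightarrow> t > 0 \<and> prime_factors t \<subseteq> Q"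
  shows "(\<Sum>t\<in>S. real t powr - s) \<le> (\<Prod>q\<in>Q. 1 / (1 - real q powr - s))"
proof -
  have "(\<Sum>t\<in>S. real t powr - s) = (\<Sum>t\<in>S. real (\<Prod>q\<in>Q. q ^ multiplicity q t) powr - s)"
  proof (rule sum.cong[OF refl])
    fix t assume t: "t \<in> S"
    have "(\<Prod>q\<in>Q. q ^ multiplicity q t) = (\<Prod>q\<in>prime_factors t. q ^ multiplicity q t)"
      using S[OF t] fin pr by (intro prod.mono_neutral_right) (auto simp: prime_factors_multiplicity)
    also have "\<dots> = t" using S[OF t] by (simp add: prod_prime_factors)
    finally show "real t powr - s = real (\<Prod>q\<in>Q. q ^ multiplicity q t) powr - s" by (simp only:)
  qed
  also have "\<dots> \<le> (\<Prod>q\<in>Q. 1 / (1 - real q powr - s))"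
  proof (rule sum_prime_weights_le[OF fin pr s])
    show "inj_on (\<lambda>k. restrict (\<lambda>q. multiplicity q k) Q) S"
    proof (rule inj_onI)
      fix t t' assume t: "t \<in> S" "t' \<in> S" and eq: "restrict (\<lambda>q. multiplicity q t) Q = restrict (\<lambda>q. multiplicity q t') Q"
      show "t = t'"
      proof (rule multiplicity_eq_nat)
        show "t > 0" "t' > 0" using S t by auto
        fix q :: nat assume q: "prime q"
        show "multiplicity q t = multiplicity q t'"
        proof (cases "q \<in> Q")
          case True
          then show ?thesis using fun_cong[OF eq, of q] by simp
        next
          case False
          then have "q \<notin> prime_factors t" "q \<notin> prime_factors t'" using S t by auto
          then show ?thesis using q by (simp add: prime_factors_multiplicity)
        qed
      qed
    qed
  qed (use S in auto)
  finally show ?thesis .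
qed

lemma inverse_one_minus_le_exp:
  fixes u :: real assumes "0 \<le> u" "u < 1"
  shows "1 / (1 - u) \<le> exp (u / (1 - u))"
proof -
  have "1 / (1 - u) = 1 + u / (1 - u)" using assms by (simp add: field_simps)
  also have "\<dots> \<le> exp (u / (1 - u))" by (rule exp_ge_add_one_self)
  finally show ?thesis .
qed

lemma euler_product_le_exp:
  fixes s :: real
  assumes "\<And>q. q \<in> Q \<Longrightarrow> prime q" "s > 0"
  shows "(\<Prod>q\<in>Q. 1 / (1 - real q powr - s)) \<le> exp (1 / (1 - 2 powr - s) * (\<Sum>q\<in>Q. real q powr - s))"
proof (cases "finite Q")
  case True
  have u2: "2 powr - s < (1::real)" using assms(2) by (intro powr_less_one) auto
  have "(\<Prod>q\<in>Q. 1 / (1 - real q powr - s)) \<le> (\<Prod>q\<in>Q. exp (1 / (1 - 2 powr - s) * real q powr - s))"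
  proof (rule prod_mono, safe)
    fix q assume "q \<in> Q"
    then have "q \<ge> 2" using assms(1) prime_ge_2_nat by auto
    then have u: "real q powr - s \<le> 2 powr - s" using assms(2) by (intro powr_mono2') auto
    have "1 / (1 - real q powr - s) \<le> exp (real q powr - s / (1 - real q powr - s))"
      using u u2 by (intro inverse_one_minus_le_exp) auto
    also have "\<dots> \<le> exp (1 / (1 - 2 powr - s) * real q powr - s)"
    proof -
      have "real q powr - s / (1 - real q powr - s) \<le> real q powr - s / (1 - 2 powr - s)"
        using u u2 by (intro divide_left_mono mult_pos_pos) auto
      then show ?thesis by simp
    qed
    finally show "1 / (1 - real q powr - s) \<le> exp (1 / (1 - 2 powr - s) * real q powr - s)" .
    show "0 \<le> 1 / (1 - real q powr - s)" using u u2 by simp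
  qed
  also have "\<dots> = exp (1 / (1 - 2 powr - s) * (\<Sum>q\<in>Q. real q powr - s))"
    using True by (simp add: exp_sum sum_distrib_left)
  finally show ?thesis .
qed simp

text \<open>The part t^(-\<theta>) of the decay is traded for the lower bound \<open>T0\<close>; the
  rest is an Euler product with exponent s = 1 - b - \<theta>. The condition b + \<theta> <= 1/2
  keeps s >= 1/2, where 1 / (1 - 2^(-s)) <= 4 supplies the absolute constant.\<close>

lemma rankin_bound:
  fixes S Q :: "nat set" and b \<theta> T0 :: real
  assumes fin: "finite S" "finite Q" and pr: "\<And>q. q \<in> Q \<Longrightarrow> prime q"
    and S: "\<And>t. t \<in> S \<Longrightarrow> t > 0 \<and> prime_factors t \<subseteq> Q \<and> T0 \<le> real t"
    and T0: "T0 > 0" and \<theta>: "\<theta> \<ge> 0" and b: "b + \<theta> \<le> 1 / 2"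
  shows "(\<Sum>t\<in>S. real t powr (b - 1)) \<le> T0 powr - \<theta> * exp (4 * (\<Sum>q\<in>Q. real q powr (b + \<theta> - 1)))"
proof -
  define s where "s = 1 - b - \<theta>"
  have s: "s \<ge> 1 / 2" using b by (simp add: s_def)
  have "(\<Sum>t\<in>S. real t powr (b - 1)) \<le> (\<Sum>t\<in>S. T0 powr - \<theta> * real t powr - s)"
  proof (rule sum_mono)
    fix t assume t: "t \<in> S"
    have "real t powr (b - 1) = real t powr - \<theta> * real t powr - s"
      by (simp add: powr_add [symmetric] s_def)
    also have "\<dots> \<le> T0 powr - \<theta> * real t powr - s"
      using S[OF t] T0 \<theta> by (intro mult_right_mono powr_mono2') auto
    finally show "real t powr (b - 1) \<le> T0 powr - \<theta> * real t powr - s" .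
  qed
  also have "\<dots> = T0 powr - \<theta> * (\<Sum>t\<in>S. real t powr - s)" by (simp add: sum_distrib_left)
  also have "\<dots> \<le> T0 powr - \<theta> * exp (4 * (\<Sum>q\<in>Q. real q powr - s))"
  proof (rule mult_left_mono)
    have "(\<Sum>t\<in>S. real t powr - s) \<le> (\<Prod>q\<in>Q. 1 / (1 - real q powr - s))"
      using S s by (intro euler_product_bound fin pr) auto
    also have "\<dots> \<le> exp (1 / (1 - 2 powr - s) * (\<Sum>q\<in>Q. real q powr - s))"
      using s pr by (intro euler_product_le_exp) auto
    also have "\<dots> \<le> exp (4 * (\<Sum>q\<in>Q. real q powr - s))"
    proof -
      have "2 powr - s \<le> 2 powr - (1 / 2 :: real)" using s by (intro powr_mono) auto
      also have "\<dots> = 1 / sqrt 2" by (subst powr_minus_divide, subst powr_half_sqrt) auto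
      also have "\<dots> \<le> 3 / 4"
      proof -
        have "4 / 3 \<le> sqrt (2::real)" by (rule real_le_rsqrt) (simp add: power2_eq_square)
        then show ?thesis by (simp add: field_simps)
      qed
      finally have "1 / (1 - 2 powr - s) \<le> (4::real)" by (simp add: field_simps)
      then have "1 / (1 - 2 powr - s) * (\<Sum>q\<in>Q. real q powr - s) \<le> 4 * (\<Sum>q\<in>Q. real q powr - s)"
        by (intro mult_right_mono sum_nonneg) auto
      then show ?thesis by (simp only: exp_le_cancel_iff)
    qed
    finally show "(\<Sum>t\<in>S. real t powr - s) \<le> exp (4 * (\<Sum>q\<in>Q. real q powr - s))" .
  qed simp
  finally show ?thesis by (simp add: s_def algebra_simps)
qed

section \<open>Chebyshev's bound and sums over primes\<close>

text \<open>Every prime strictly between m = 2^i and 2m divides the central binomial coefficient,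
  which is at most 4^m; hence m^count <= 4^m. The case i = 1 is separate because there m = 2 is
  itself a prime of the block.\<close>

lemma card_primes_dyadic:
  fixes i :: nat
  assumes "i \<ge> 1"
  shows "real (card {q. prime q \<and> 2 ^ i \<le> q \<and> q < (2::nat) ^ (i + 1)}) \<le> 2 * 2 ^ i / real i"
proof (cases "i = 1")
  case True
  have "{q. prime q \<and> 2 ^ i \<le> q \<and> q < (2::nat) ^ (i + 1)} \<subseteq> {2, 3}" using True by auto
  then have "card {q. prime q \<and> 2 ^ i \<le> q \<and> q < (2::nat) ^ (i + 1)} \<le> card {2, 3::nat}" by (intro card_mono) auto
  then show ?thesis using True by simp
next
  case False
  define m where "m = (2::nat) ^ i"
  define P where "P = {q. prime q \<and> 2 ^ i \<le> q \<and> q < (2::nat) ^ (i + 1)}"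
  have fin: "finite P" unfolding P_def by (rule finite_subset[of _ "{..<2 ^ (i + 1)}"]) auto
  have gt: "m < q" if "q \<in> P" for q
  proof -
    have "\<not> prime m" using False assms by (simp add: m_def prime_power_iff)
    then have "q \<noteq> m" using that by (auto simp: P_def)
    then show ?thesis using that by (auto simp: P_def m_def)
  qed
  have lt: "q < 2 * m" if "q \<in> P" for q using that by (auto simp: P_def m_def)
  have pr: "prime q" if "q \<in> P" for q using that by (auto simp: P_def)
  have dvd: "q dvd (2 * m) choose m" if "q \<in> P" for q
  proof -
    have "fact (2 * m) = fact m * fact m * ((2 * m) choose m)"
      using binomial_fact_lemma[of m "2 * m"] by (simp add: mult_2)
    moreover have "q dvd fact (2 * m)" using pr[OF that] lt[OF that] by (simp add: prime_dvd_fact_iff)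
    moreover have "\<not> q dvd fact m" using pr[OF that] gt[OF that] by (simp add: prime_dvd_fact_iff)
    ultimately show ?thesis using pr[OF that] by (simp add: prime_dvd_mult_iff)
  qed
  have pos: "(2 * m) choose m > 0" by simp
  have "m ^ card P = (\<Prod>q\<in>P. m)" by simp
  also have "\<dots> \<le> (\<Prod>q\<in>P. q)" using gt by (intro prod_mono) (auto intro: less_imp_le)
  also have "\<dots> \<le> (2 * m) choose m"
  proof (rule dvd_imp_le[OF _ pos])
    have "(\<Prod>q\<in>P. q) dvd (\<Prod>q\<in>prime_factors ((2 * m) choose m). q)"
      using dvd pr pos by (intro prod_dvd_prod_subset) (auto simp: prime_factors_dvd)
    also have "\<dots> dvd (\<Prod>q\<in>prime_factors ((2 * m) choose m). q ^ multiplicity q ((2 * m) choose m))"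
      by (intro prod_dvd_prod) (auto simp: prime_factors_multiplicity intro!: dvd_power)
    also have "\<dots> = (2 * m) choose m" using pos by (simp add: prod_prime_factors)
    finally show "\<Prod>P dvd (2 * m) choose m" .
  qed
  also have "\<dots> \<le> (\<Sum>k\<le>2 * m. (2 * m) choose k)" by (rule member_le_sum) auto
  also have "\<dots> = 2 ^ (2 * m)" by (rule choose_row_sum)
  finally have "(2::nat) ^ (i * card P) \<le> 2 ^ (2 * m)" by (simp add: m_def power_mult)
  then have "i * card P \<le> 2 * m" by simp
  then have "real i * real (card P) \<le> 2 * real m" by (metis of_nat_le_iff of_nat_mult of_nat_numeral)
  then show ?thesis using assms unfolding P_def m_def by (simp add: field_simps)
qed

text \<open>The block starting at 2^i has at most 2 * 2^i / i primes, each with reciprocal at most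
  2^(-i).\<close>

lemma sum_prime_reciprocals_dyadic:
  fixes Q :: "nat set"
  assumes fin: "finite Q" and Q: "\<And>q. q \<in> Q \<Longrightarrow> prime q \<and> 2 ^ a \<le> q \<and> q < 2 ^ (b + 1)" and a: "a \<ge> 1"
  shows "(\<Sum>q\<in>Q. 1 / real q) \<le> (\<Sum>i\<in>{a..b}. 2 / real i)"
proof -
  define P where "P i = {q. prime q \<and> 2 ^ i \<le> q \<and> q < (2::nat) ^ (i + 1)}" for i
  have finP: "finite (P i)" for i unfolding P_def by (rule finite_subset[of _ "{..<2 ^ (i + 1)}"]) auto
  have "(\<Sum>q\<in>Q. 1 / real q) \<le> (\<Sum>q\<in>(\<Union>i\<in>{a..b}. P i). 1 / real q)"
  proof (rule sum_mono2)
    show "Q \<subseteq> (\<Union>i\<in>{a..b}. P i)"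
    proof
      fix q assume q: "q \<in> Q"
      then have q': "prime q" "2 ^ a \<le> q" "q < 2 ^ (b + 1)" using Q by auto
      obtain i where i: "2 ^ i \<le> q" "q < 2 ^ (i + 1)"
        using ex_power_ivl1[of 2 q] prime_gt_0_nat[OF q'(1)] by auto
      have "(2::nat) ^ a < 2 ^ (i + 1)" "(2::nat) ^ i < 2 ^ (b + 1)" using i q' by linarith+
      then have "a < i + 1" "i < b + 1"
        using power_less_imp_less_exp[of "2::nat" a "i + 1"] power_less_imp_less_exp[of "2::nat" i "b + 1"] by linarith+
      then show "q \<in> (\<Union>i\<in>{a..b}. P i)" using i q' by (intro UN_I[of i]) (auto simp: P_def)
    qed
  qed (use finP in auto)
  also have "\<dots> \<le> (\<Sum>i\<in>{a..b}. \<Sum>q\<in>P i. 1 / real q)"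
    using finP by (intro sum_UNION_le) auto
  also have "\<dots> \<le> (\<Sum>i\<in>{a..b}. 2 / real i)"
  proof (rule sum_mono)
    fix i assume i: "i \<in> {a..b}"
    have "(\<Sum>q\<in>P i. 1 / real q) \<le> (\<Sum>q\<in>P i. 1 / 2 ^ i)"
    proof (rule sum_mono)
      fix q assume "q \<in> P i"
      then have "2 ^ i \<le> q" by (auto simp: P_def)
      then have "(2::real) ^ i \<le> real q" by (metis of_nat_le_iff of_nat_numeral of_nat_power)
      moreover have "(0::real) < 2 ^ i" by simp
      ultimately show "1 / real q \<le> 1 / 2 ^ i" by (intro divide_left_mono mult_pos_pos) linarith+
    qed
    also have "\<dots> = real (card (P i)) / 2 ^ i" by simp
    also have "\<dots> \<le> (2 * 2 ^ i / real i) / 2 ^ i"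
      unfolding P_def using i a by (intro divide_right_mono card_primes_dyadic) auto
    finally show "(\<Sum>q\<in>P i. 1 / real q) \<le> 2 / real i" by simp
  qed
  finally show ?thesis .
qed

text \<open>Bounding q^b by y^b leaves the upper half of Mertens' estimate, of order ln ln y, which
  follows from the dyadic blocks and a harmonic sum.\<close>

lemma sum_small_primes_le:
  fixes Q :: "nat set" and y b :: real
  assumes fin: "finite Q" and Q: "\<And>q. q \<in> Q \<Longrightarrow> prime q \<and> real q \<le> y" and y: "y \<ge> 2" and b: "b \<ge> 0"
  shows "(\<Sum>q\<in>Q. real q powr (b - 1)) \<le> y powr b * (2 + 2 * ln (log 2 y))"
proof -
  define I where "I = nat \<lfloor>log 2 y\<rfloor>"
  have l1: "log 2 y \<ge> 1" using y by simp
  then have I: "I \<ge> 1" "real I \<le> log 2 y" unfolding I_def by (auto simp: le_nat_iff le_floor_iff)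
  have lt: "q < 2 ^ (I + 1)" if "q \<in> Q" for q
  proof -
    have "log 2 (real q) \<le> log 2 y" using Q[OF that] prime_gt_0_nat[of q] y by (subst log_le_cancel_iff) auto
    also have "\<dots> < real (I + 1)" using l1 unfolding I_def by linarith
    finally have "real q < 2 powr real (I + 1)"
      using Q[OF that] prime_gt_0_nat[of q] by (subst (asm) log_less_iff) auto
    then have "real q < real (2 ^ (I + 1))" by (metis of_nat_numeral of_nat_power powr_realpow zero_less_numeral)
    then show ?thesis by (simp only: of_nat_less_iff)
  qed
  have "(\<Sum>q\<in>Q. real q powr (b - 1)) \<le> (\<Sum>q\<in>Q. y powr b * (1 / real q))"
  proof (rule sum_mono)
    fix q assume q: "q \<in> Q"
    have q0: "real q > 0" using Q[OF q] prime_gt_0_nat[of q] by simp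
    have "real q powr (b - 1) = real q powr b * (1 / real q)" using q0 by (simp add: powr_diff)
    also have "\<dots> \<le> y powr b * (1 / real q)" using Q[OF q] b q0 by (intro mult_right_mono powr_mono2) auto
    finally show "real q powr (b - 1) \<le> y powr b * (1 / real q)" .
  qed
  also have "\<dots> = y powr b * (\<Sum>q\<in>Q. 1 / real q)" by (simp add: sum_distrib_left)
  also have "\<dots> \<le> y powr b * (\<Sum>i\<in>{1..I}. 2 / real i)"
    using lt Q by (intro mult_left_mono sum_prime_reciprocals_dyadic fin) (auto dest: prime_ge_2_nat)
  also have "(\<Sum>i\<in>{1..I}. 2 / real i) = 2 * (\<Sum>i\<in>{1..I}. 1 / real i)" by (simp add: sum_distrib_left)
  also have "y powr b * (2 * (\<Sum>i\<in>{1..I}. 1 / real i)) \<le> y powr b * (2 * (1 + ln (log 2 y)))"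
  proof (intro mult_left_mono)
    have "(\<Sum>i\<in>{1..I}. 1 / real i) \<le> 1 + ln (real I)" by (rule harm_le[OF I(1)])
    also have "\<dots> \<le> 1 + ln (log 2 y)" using I by (simp add: ln_le_cancel_iff)
    finally show "(\<Sum>i\<in>{1..I}. 1 / real i) \<le> 1 + ln (log 2 y)" .
  qed auto
  finally show ?thesis by (simp add: algebra_simps)
qed

lemma card_large_prime_factors:
  fixes n :: nat and x :: real
  assumes n: "n > 0" "real n \<le> exp x" and x: "x > 1"
    and Q: "Q \<subseteq> prime_factors n" "\<And>q. q \<in> Q \<Longrightarrow> x \<le> real q"
  shows "real (card Q) \<le> x / ln x"
proof -
  have fin: "finite Q" using Q(1) finite_subset by auto
  have "(\<Prod>q\<in>Q. q) dvd (\<Prod>q\<in>prime_factors n. q)" using Q(1) by (intro prod_dvd_prod_subset) auto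
  also have "\<dots> dvd (\<Prod>q\<in>prime_factors n. q ^ multiplicity q n)"
    by (intro prod_dvd_prod) (auto simp: prime_factors_multiplicity intro!: dvd_power)
  also have "\<dots> = n" using n by (simp add: prod_prime_factors)
  finally have le: "\<Prod>Q \<le> n" using n by (simp add: dvd_imp_le)
  have "x ^ card Q = (\<Prod>q\<in>Q. x)" by simp
  also have "\<dots> \<le> (\<Prod>q\<in>Q. real q)" using Q(2) x by (intro prod_mono) auto
  also have "\<dots> = real (\<Prod>Q)" by simp
  also have "\<dots> \<le> real n" using le by (simp only: of_nat_le_iff)
  also have "\<dots> \<le> exp x" by fact
  finally have "x ^ card Q \<le> exp x" .
  then have "ln (x ^ card Q) \<le> ln (exp x)" using x by (intro ln_mono) auto
  then have "real (card Q) * ln x \<le> x" using x by (simp add: ln_realpow)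
  then show ?thesis using x by (simp add: pos_le_divide_eq)
qed

text \<open>The window from x^(1 - \<epsilon>) to x meets about \<epsilon> log 2 x dyadic blocks of
  weight at most 8 / log 2 x each, whence 8 \<epsilon>. Beyond x, a number n <= e^x has at most x /
  ln x prime factors, each of weight at most x^(b - 1). The shortness of the window is what makes
  the exclusion of medium-sized primes pay off. The constant 13 is 16 ln 2 rounded up to 12, plus 1
  from the primes beyond x.\<close>

lemma sum_large_prime_factors_le:
  fixes n :: nat and x b \<epsilon> :: real
  assumes n: "n > 0" "real n \<le> exp x" and x: "x \<ge> 16" and b: "0 \<le> b" "b \<le> 1" and \<epsilon>: "0 \<le> \<epsilon>" "\<epsilon> \<le> 1 / 2"
    and Q: "Q \<subseteq> prime_factors n" "\<And>q. q \<in> Q \<Longrightarrow> x powr (1 - \<epsilon>) \<le> real q"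
  shows "(\<Sum>q\<in>Q. real q powr (b - 1)) \<le> x powr b * (8 * \<epsilon> + 13 / ln x)"
proof -
  have fin: "finite Q" using Q(1) finite_subset by auto
  have pr: "prime q" if "q \<in> Q" for q using that Q(1) by auto
  define A where "A = {q \<in> Q. real q \<le> x}"
  define B where "B = {q \<in> Q. \<not> real q \<le> x}"
  have QAB: "Q = A \<union> B" "A \<inter> B = {}" by (auto simp: A_def B_def)
  define z where "z = x powr (1 - \<epsilon>)"
  define lx where "lx = log 2 x"
  have lx4: "lx \<ge> 4"
  proof -
    have "log 2 16 \<le> log 2 x" using x by (subst log_le_cancel_iff) auto
    moreover have "log 2 16 = (4::real)" using log_pow_cancel[of 2 4] by simp
    ultimately show ?thesis by (simp add: lx_def)
  qed
  have lz: "log 2 z = (1 - \<epsilon>) * lx" using x by (simp add: z_def lx_def log_powr)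
  have lz2: "log 2 z \<ge> lx / 2" unfolding lz using \<epsilon> lx4 mult_right_mono[of "1/2" "1 - \<epsilon>" lx] by simp
  define a where "a = nat \<lfloor>log 2 z\<rfloor>"
  define c where "c = nat \<lfloor>lx\<rfloor>"
  have a: "real a \<le> log 2 z" "real a > log 2 z - 1" unfolding a_def using lz2 lx4 by linarith+
  have c: "real c \<le> lx" "real c > lx - 1" unfolding c_def using lx4 by linarith+
  have a1: "a \<ge> 1" using a lz2 lx4 by linarith
  have a4: "real a \<ge> lx / 4" using a lz2 lx4 by linarith
  have A_le: "(\<Sum>q\<in>A. real q powr (b - 1)) \<le> x powr b * (8 * \<epsilon> + 12 / ln x)"
  proof -
    have "(\<Sum>q\<in>A. real q powr (b - 1)) \<le> (\<Sum>q\<in>A. x powr b * (1 / real q))"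
    proof (rule sum_mono)
      fix q assume q: "q \<in> A"
      have q0: "real q > 0" using pr[of q] q prime_gt_0_nat[of q] by (auto simp: A_def)
      have "real q powr (b - 1) = real q powr b * (1 / real q)" using q0 by (simp add: powr_diff)
      also have "\<dots> \<le> x powr b * (1 / real q)" using q b q0 by (intro mult_right_mono powr_mono2) (auto simp: A_def)
      finally show "real q powr (b - 1) \<le> x powr b * (1 / real q)" .
    qed
    also have "\<dots> = x powr b * (\<Sum>q\<in>A. 1 / real q)" by (simp add: sum_distrib_left)
    also have "\<dots> \<le> x powr b * (8 * \<epsilon> + 12 / ln x)"
    proof (intro mult_left_mono)
      have "(\<Sum>q\<in>A. 1 / real q) \<le> (\<Sum>i\<in>{a..c}. 2 / real i)"
      proof (rule sum_prime_reciprocals_dyadic[OF _ _ a1])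
        fix q assume q: "q \<in> A"
        then have q0: "real q > 0" "prime q" using pr[of q] prime_gt_0_nat[of q] by (auto simp: A_def)
        have "2 powr real a \<le> 2 powr log 2 z" using a by (intro powr_mono) auto
        also have "\<dots> = z" using x by (simp add: z_def)
        also have "\<dots> \<le> real q" using q Q(2) by (auto simp: z_def A_def)
        finally have "real (2 ^ a) \<le> real q" by (simp add: powr_realpow)
        then have 1: "2 ^ a \<le> q" by (simp only: of_nat_le_iff)
        have "log 2 (real q) \<le> lx" unfolding lx_def using q q0 x by (subst log_le_cancel_iff) (auto simp: A_def)
        also have "\<dots> < real (c + 1)" using c by simp
        finally have "real q < 2 powr real (c + 1)" using q0 by (subst (asm) log_less_iff) auto
        then have "real q < real (2 ^ (c + 1))" by (metis of_nat_numeral of_nat_power powr_realpow zero_less_numeral)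
        then have 2: "q < 2 ^ (c + 1)" by (simp only: of_nat_less_iff)
        show "prime q \<and> 2 ^ a \<le> q \<and> q < 2 ^ (c + 1)" using 1 2 q0 by simp
      qed (use fin in \<open>simp add: A_def\<close>)
      also have "\<dots> \<le> (\<Sum>i\<in>{a..c}. 2 / (lx / 4))"
      proof (rule sum_mono)
        fix i assume "i \<in> {a..c}"
        then have "real i \<ge> lx / 4" using a4 by (meson atLeastAtMost_iff of_nat_mono order_trans)
        then show "2 / real i \<le> 2 / (lx / 4)" using lx4 by (intro divide_left_mono mult_pos_pos) auto
      qed
      also have "\<dots> = real (Suc c - a) * (8 / lx)" by simp
      also have "\<dots> \<le> (\<epsilon> * lx + 2) * (8 / lx)"
      proof (rule mult_right_mono)
        have "real c - real a \<le> \<epsilon> * lx + 1" using a c unfolding lz by (simp add: algebra_simps)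
        moreover have "0 \<le> \<epsilon> * lx" using \<epsilon> lx4 by simp
        ultimately show "real (Suc c - a) \<le> \<epsilon> * lx + 2" by linarith
      qed (use lx4 in simp)
      also have "\<dots> = 8 * \<epsilon> + 16 / lx" using lx4 by (simp add: field_simps)
      also have "16 / lx = 16 * ln 2 / ln x" by (simp add: lx_def log_def)
      also have "8 * \<epsilon> + \<dots> \<le> 8 * \<epsilon> + 12 / ln x"
      proof -
        have "2 \<le> exp (3 / 4 :: real)" using exp_lower_Taylor_quadratic[of "3 / 4 :: real"] by (simp add: power2_eq_square)
        then have "ln 2 \<le> ln (exp (3 / 4 :: real))" by (intro ln_mono) auto
        then have "16 * ln 2 \<le> (12::real)" by simp
        then show ?thesis using x by (simp add: divide_right_mono)
      qed
      finally show "(\<Sum>q\<in>A. 1 / real q) \<le> 8 * \<epsilon> + 12 / ln x" .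
    qed simp
    finally show ?thesis .
  qed
  have B_le: "(\<Sum>q\<in>B. real q powr (b - 1)) \<le> x powr b * (1 / ln x)"
  proof -
    have "(\<Sum>q\<in>B. real q powr (b - 1)) \<le> (\<Sum>q\<in>B. x powr (b - 1))"
      using x b by (intro sum_mono powr_mono2') (auto simp: B_def)
    also have "\<dots> = real (card B) * x powr (b - 1)" by simp
    also have "\<dots> \<le> x / ln x * x powr (b - 1)"
      using x Q(1) by (intro mult_right_mono card_large_prime_factors[OF n]) (auto simp: B_def)
    also have "\<dots> = x powr b * (1 / ln x)" using x by (simp add: powr_diff)
    finally show ?thesis .
  qed
  have "(\<Sum>q\<in>Q. real q powr (b - 1)) = (\<Sum>q\<in>A. real q powr (b - 1)) + (\<Sum>q\<in>B. real q powr (b - 1))"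
    unfolding QAB(1) using fin QAB(2) by (intro sum.union_disjoint) (auto simp: A_def B_def)
  also have "\<dots> \<le> x powr b * (8 * \<epsilon> + 12 / ln x) + x powr b * (1 / ln x)" using A_le B_le by linarith
  also have "\<dots> = x powr b * (8 * \<epsilon> + 13 / ln x)" by (simp add: algebra_simps add_divide_distrib)
  finally show ?thesis .
qed

text \<open>No prime number estimate enters: primes up to L are replaced by all integers up to L,
  and n < 2^L has at most L prime factors beyond.\<close>

lemma sum_prime_factors_crude:
  fixes n :: nat and s :: real
  assumes n: "n > 0" "n < 2 ^ L" and s: "0 \<le> s" "s \<le> 1" and L: "L \<ge> 1" and Q: "Q \<subseteq> prime_factors n"
  shows "(\<Sum>q\<in>Q. real q powr - s) \<le> real L powr (1 - s) * (2 + ln (real L))"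
proof -
  have fin: "finite Q" using Q finite_subset by auto
  have pr: "prime q" if "q \<in> Q" for q using that Q by auto
  have card: "card Q \<le> L" using n Q fin by (intro card_primes_dvd_le[where z = n]) auto
  define A where "A = {q \<in> Q. q \<le> L}"
  define B where "B = {q \<in> Q. \<not> q \<le> L}"
  have "(\<Sum>q\<in>A. real q powr - s) \<le> (\<Sum>q\<in>A. real L powr (1 - s) * (1 / real q))"
  proof (rule sum_mono)
    fix q assume q: "q \<in> A"
    have q0: "real q > 0" using pr[of q] q prime_gt_0_nat[of q] by (auto simp: A_def)
    have "real q powr - s = real q powr (1 - s) * (1 / real q)" using q0 by (simp add: powr_diff powr_minus field_simps)
    also have "\<dots> \<le> real L powr (1 - s) * (1 / real q)" using q s q0 by (intro mult_right_mono powr_mono2) (auto simp: A_def)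
    finally show "real q powr - s \<le> real L powr (1 - s) * (1 / real q)" .
  qed
  also have "\<dots> = real L powr (1 - s) * (\<Sum>q\<in>A. 1 / real q)" by (simp add: sum_distrib_left)
  also have "\<dots> \<le> real L powr (1 - s) * (1 + ln (real L))"
  proof (intro mult_left_mono)
    have "(\<Sum>q\<in>A. 1 / real q) \<le> (\<Sum>q\<in>{1..L}. 1 / real q)"
      using pr prime_gt_0_nat by (intro sum_mono2) (force simp: A_def Suc_le_eq)+
    also have "\<dots> \<le> 1 + ln (real L)" by (rule harm_le[OF L])
    finally show "(\<Sum>q\<in>A. 1 / real q) \<le> 1 + ln (real L)" .
  qed auto
  finally have A: "(\<Sum>q\<in>A. real q powr - s) \<le> real L powr (1 - s) * (1 + ln (real L))" .
  have "(\<Sum>q\<in>B. real q powr - s) \<le> (\<Sum>q\<in>B. real L powr - s)"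
    using s L by (intro sum_mono powr_mono2') (auto simp: B_def)
  also have "\<dots> = real (card B) * real L powr - s" by simp
  also have "\<dots> \<le> real L * real L powr - s"
  proof -
    have "card B \<le> card Q" using fin by (intro card_mono) (auto simp: B_def)
    then show ?thesis using card by (intro mult_right_mono) auto
  qed
  also have "\<dots> = real L powr (1 - s)" using L by (simp add: powr_diff powr_minus field_simps)
  finally have B: "(\<Sum>q\<in>B. real q powr - s) \<le> real L powr (1 - s)" .
  have "(\<Sum>q\<in>Q. real q powr - s) = (\<Sum>q\<in>A \<union> B. real q powr - s)" by (intro sum.cong) (auto simp: A_def B_def)
  also have "\<dots> = (\<Sum>q\<in>A. real q powr - s) + (\<Sum>q\<in>B. real q powr - s)"
    using fin by (intro sum.union_disjoint) (auto simp: A_def B_def)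
  also have "\<dots> \<le> real L powr (1 - s) * (2 + ln (real L))" using A B by (simp add: algebra_simps)
  finally show ?thesis .
qed

lemma half_le_ln2: "1 / 2 \<le> ln (2::real)"
  using ln_le_minus_one[of "1 / 2 :: real"] by (simp add: ln_div)

lemma sum_prime_factors_le_ln:
  fixes n :: nat and s x :: real
  assumes n: "n > 0" "ln (real n) \<le> x" and s: "0 \<le> s" "s \<le> 1"
  shows "(\<Sum>q\<in>prime_factors n. real q powr - s) \<le> (2 * x + 1) powr (1 - s) * (2 + ln (2 * x + 1))"
proof -
  define L where "L = nat \<lfloor>log 2 (real n)\<rfloor> + 1"
  have l0: "log 2 (real n) \<ge> 0" using n by simp
  have L: "log 2 (real n) < real L" "real L \<le> log 2 (real n) + 1" unfolding L_def using l0 by linarith+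
  have "real n < 2 powr real L" using L(1) n by (subst (asm) log_less_iff) auto
  then have "real n < real (2 ^ L)" by (metis of_nat_numeral of_nat_power powr_realpow zero_less_numeral)
  then have nL: "n < 2 ^ L" by (simp only: of_nat_less_iff)
  have "1 / ln 2 \<le> (2::real)" using half_le_ln2 by (simp add: field_simps)
  then have "ln (real n) * (1 / ln 2) \<le> ln (real n) * 2" using n by (intro mult_left_mono) auto
  then have L2: "real L \<le> 2 * x + 1" using L n by (simp add: log_def)
  have L1: "real L \<ge> 1" by (simp add: L_def)
  have "(\<Sum>q\<in>prime_factors n. real q powr - s) \<le> real L powr (1 - s) * (2 + ln (real L))"
    using n nL s by (intro sum_prime_factors_crude) (auto simp: L_def)
  also have "\<dots> \<le> (2 * x + 1) powr (1 - s) * (2 + ln (2 * x + 1))"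
  proof (rule mult_mono)
    show "real L powr (1 - s) \<le> (2 * x + 1) powr (1 - s)" using L2 L1 s by (intro powr_mono2) auto
    show "2 + ln (real L) \<le> 2 + ln (2 * x + 1)" using L2 L1 by (simp add: ln_mono)
    show "0 \<le> 2 + ln (real L)" using L1 by (intro add_nonneg_nonneg ln_ge_zero) auto
  qed simp
  finally show ?thesis .
qed

section \<open>Divisor bound and product sets\<close>

text \<open>Rankin's trick with s = 1/200: the number of divisors is at most n^s times the sum of
  t^(-s), and the latter is n^o(1) because the sum of q^(-s) over the primes dividing n is O((ln
  n)^(199/200) ln ln n). Each of the two factors uses half of the exponent 1/100; small n go into
  the constant.\<close>

lemma divisor_count_bound:
  "\<exists>C::real. C > 0 \<and> (\<forall>n>0. real (card {t. t dvd n}) \<le> C * real n powr (1 / 100))"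
proof -
  define s :: real where "s = 1 / 200"
  define c :: real where "c = 1 / (1 - 2 powr - s)"
  have "2 powr - s < (1::real)" unfolding s_def by (intro powr_less_one) auto
  then have c: "c > 0" by (simp add: c_def)
  then have "\<forall>\<^sub>F x in at_top. c * ((2 * x + 1) powr (199 / 200) * (2 + ln (2 * x + 1))) \<le> (x::real) / 200"
    by real_asymp
  then obtain x0 :: real where x0: "\<And>x. x \<ge> x0 \<Longrightarrow> c * ((2 * x + 1) powr (199 / 200) * (2 + ln (2 * x + 1))) \<le> x / 200"
    unfolding eventually_at_top_linorder by blast
  have "real (card {t. t dvd n}) \<le> exp \<bar>x0\<bar> * real n powr (1 / 100)" if n: "n > 0" for n
  proof (cases "ln (real n) \<ge> x0")
    case False
    have "card {t. t dvd n} \<le> card {1..n}" using n by (intro card_mono) (auto intro: dvd_imp_le dvd_pos_nat simp: Suc_le_eq)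
    then have "real (card {t. t dvd n}) \<le> real n" by simp
    also have "\<dots> = exp (ln (real n))" using n by simp
    also have "\<dots> \<le> exp \<bar>x0\<bar>" using False by simp
    also have "\<dots> \<le> exp \<bar>x0\<bar> * real n powr (1 / 100)" using n by (simp add: ge_one_powr_ge_zero)
    finally show ?thesis .
  next
    case True
    have sum: "(\<Sum>q\<in>prime_factors n. real q powr - s) \<le> (2 * ln (real n) + 1) powr (199 / 200) * (2 + ln (2 * ln (real n) + 1))"
      using sum_prime_factors_le_ln[OF n order_refl, of s] by (simp add: s_def)
    have "real (card {t. t dvd n}) = (\<Sum>t | t dvd n. 1)" by simp
    also have "\<dots> \<le> (\<Sum>t | t dvd n. real n powr s * real t powr - s)"
    proof (rule sum_mono)
      fix t assume "t \<in> {t. t dvd n}"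
      then have t: "t > 0" "t \<le> n" using n by (auto intro: dvd_pos_nat dvd_imp_le)
      have "real t powr s \<le> real n powr s" using t by (intro powr_mono2) (auto simp: s_def)
      then have "1 \<le> real n powr s / real t powr s" using t by simp
      then show "1 \<le> real n powr s * real t powr - s" by (simp add: powr_minus_divide)
    qed
    also have "\<dots> = real n powr s * (\<Sum>t | t dvd n. real t powr - s)" by (simp add: sum_distrib_left)
    also have "\<dots> \<le> real n powr s * exp (c * (\<Sum>q\<in>prime_factors n. real q powr - s))"
    proof (rule mult_left_mono)
      have "(\<Sum>t | t dvd n. real t powr - s) \<le> (\<Prod>q\<in>prime_factors n. 1 / (1 - real q powr - s))"
      proof (rule euler_product_bound)
        fix t assume "t \<in> {t. t dvd n}"
        then show "t > 0 \<and> prime_factors t \<subseteq> prime_factors n"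
          using n by (auto intro: dvd_pos_nat dest: dvd_prime_factors[rotated])
      qed (use n in \<open>auto simp: s_def\<close>)
      also have "\<dots> \<le> exp (c * (\<Sum>q\<in>prime_factors n. real q powr - s))"
        unfolding c_def by (rule euler_product_le_exp) (auto simp: s_def)
      finally show "(\<Sum>t | t dvd n. real t powr - s) \<le> exp (c * (\<Sum>q\<in>prime_factors n. real q powr - s))" .
    qed simp
    also have "\<dots> \<le> real n powr s * exp (ln (real n) / 200)"
    proof (rule mult_left_mono)
      have "c * (\<Sum>q\<in>prime_factors n. real q powr - s) \<le> c * ((2 * ln (real n) + 1) powr (199 / 200) * (2 + ln (2 * ln (real n) + 1)))"
        using sum c by (intro mult_left_mono) auto
      also have "\<dots> \<le> ln (real n) / 200" by (rule x0[OF True])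
      finally show "exp (c * (\<Sum>q\<in>prime_factors n. real q powr - s)) \<le> exp (ln (real n) / 200)" by simp
    qed simp
    also have "\<dots> = real n powr (1 / 100)"
      using n by (simp add: powr_def s_def exp_add [symmetric] algebra_simps)
    also have "\<dots> = 1 * real n powr (1 / 100)" by simp
    also have "\<dots> \<le> exp \<bar>x0\<bar> * real n powr (1 / 100)" by (intro mult_right_mono) auto
    finally show ?thesis .
  qed
  then show ?thesis by (intro exI[of _ "exp \<bar>x0\<bar>"]) auto
qed

text \<open>A v-fold product X <= t^v is determined by the residue of d^v X, one of at most t roots
  of z^t = 1, together with X div p. Each X arises from at most D^v tuples, since all entries divide
  X.\<close>

lemma Kset_product_bound:
  assumes p: "prime p" and t: "t dvd p - 1"
    and D: "\<And>X. 0 < X \<Longrightarrow> X \<le> t ^ v \<Longrightarrow> card {d. d dvd X} \<le> D"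
  shows "card (Kset p t) ^ v \<le> t * (t ^ v div p + 1) * D ^ v"
proof -
  have n0: "p - 1 > 0" using prime_gt_1_nat[OF p] by simp
  have t0: "t > 0" by (rule dvd_pred_prime(1)[OF p t])
  define d where "d = (p - 1) div t"
  have copd: "coprime d p" unfolding d_def by (rule cofactor_coprime(3)[OF p t])
  define W where "W = {..<v} \<rightarrow>\<^sub>E Kset p t"
  define H where "H = {z\<in>{..<p}. [z ^ t = 1] (mod p)}"
  define \<X> where "\<X> = {X \<in> {1..t ^ v}. [(d ^ v * X) ^ t = 1] (mod p)}"
  have cardX: "card \<X> \<le> t * (t ^ v div p + 1)"
  proof -
    have "card \<X> \<le> card (H \<times> {..t ^ v div p})"
    proof (rule card_inj_on_le[where f = "\<lambda>X. (d ^ v * X mod p, X div p)"])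
      show "inj_on (\<lambda>X. (d ^ v * X mod p, X div p)) \<X>"
      proof (rule inj_onI)
        fix X Y assume "(d ^ v * X mod p, X div p) = (d ^ v * Y mod p, Y div p)"
        then have eq: "[d ^ v * X = d ^ v * Y] (mod p)" "X div p = Y div p" by (auto simp: Cong.cong_def)
        then have "[X = Y] (mod p)" using copd cong_mult_lcancel_nat[of "d ^ v" p] by simp
        then show "X = Y" using eq(2) unfolding Cong.cong_def by (metis div_mult_mod_eq)
      qed
      show "(\<lambda>X. (d ^ v * X mod p, X div p)) ` \<X> \<subseteq> H \<times> {..t ^ v div p}"
      proof safe
        fix X assume X: "X \<in> \<X>"
        then show "X div p \<le> t ^ v div p" by (auto simp: \<X>_def intro: div_le_mono)
        have "[(d ^ v * X mod p) ^ t = 1] (mod p)" using X unfolding \<X>_def Cong.cong_def power_mod by simp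
        then show "d ^ v * X mod p \<in> H" using n0 by (simp add: H_def)
      qed
      show "finite (H \<times> {..t ^ v div p})" by (simp add: H_def)
    qed
    also have "\<dots> = card H * (t ^ v div p + 1)" by (simp add: card_cartesian_product)
    also have "\<dots> \<le> t * (t ^ v div p + 1)"
      unfolding H_def using p t0 by (intro mult_le_mono1 roots_mod_prime_bound) auto
    finally show ?thesis .
  qed
  have WX: "(\<Prod>i<v. f i) \<in> \<X>" if f: "f \<in> W" for f
  proof -
    have fK: "f i \<in> Kset p t" if "i < v" for i using f that by (auto simp: W_def)
    have "(\<Prod>i<v. f i) \<le> (\<Prod>i<v. t)" using fK KsetD(2) by (intro prod_mono) auto
    moreover have "(\<Prod>i<v. f i) \<ge> 1"
    proof -
      have "f i > 0" if "i < v" for i using KsetD(1)[OF fK[OF that]] by simp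
      then have "(\<Prod>i<v. f i) > 0" by (intro prod_pos) auto
      then show ?thesis by (simp only: One_nat_def Suc_le_eq)
    qed
    moreover have "[(d ^ v * (\<Prod>i<v. f i)) ^ t = (\<Prod>i<v. 1)] (mod p)"
    proof -
      have "(d ^ v * (\<Prod>i<v. f i)) ^ t = (\<Prod>i<v. (d * f i) ^ t)"
        by (simp add: prod_power_distrib [symmetric] prod.distrib)
      moreover have "[(\<Prod>i<v. (d * f i) ^ t) = (\<Prod>i<v. 1)] (mod p)"
        using fK KsetD(4) unfolding d_def by (intro cong_prod) auto
      ultimately show ?thesis by simp
    qed
    ultimately show ?thesis by (simp add: \<X>_def)
  qed
  have finW: "finite W" unfolding W_def by (intro finite_PiE) auto
  have "card W = card (\<Union>X\<in>\<X>. {f \<in> W. (\<Prod>i<v. f i) = X})"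
    using WX by (intro arg_cong[where f = card]) auto
  also have "\<dots> \<le> (\<Sum>X\<in>\<X>. card {f \<in> W. (\<Prod>i<v. f i) = X})"
    by (rule card_UN_le) (simp add: \<X>_def)
  also have "\<dots> \<le> (\<Sum>X\<in>\<X>. D ^ v)"
  proof (rule sum_mono)
    fix X assume "X \<in> \<X>"
    then have X: "0 < X" "X \<le> t ^ v" by (auto simp: \<X>_def)
    have "card {f \<in> W. (\<Prod>i<v. f i) = X} \<le> card ({..<v} \<rightarrow>\<^sub>E {d. d dvd X})"
    proof (intro card_mono finite_PiE subsetI)
      fix f assume "f \<in> {f \<in> W. (\<Prod>i<v. f i) = X}"
      then have "f \<in> extensional {..<v}" "X = (\<Prod>i<v. f i)" by (auto simp: W_def PiE_def)
      then show "f \<in> {..<v} \<rightarrow>\<^sub>E {d. d dvd X}" by (simp add: PiE_def Pi_def dvd_prodI)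
    qed (use X in auto)
    also have "\<dots> = card {d. d dvd X} ^ v" by (simp add: card_PiE)
    also have "\<dots> \<le> D ^ v" using D[OF X] by (intro power_mono) auto
    finally show "card {f \<in> W. (\<Prod>i<v. f i) = X} \<le> D ^ v" .
  qed
  also have "\<dots> = card \<X> * D ^ v" by simp
  also have "\<dots> \<le> t * (t ^ v div p + 1) * D ^ v" using cardX by (intro mult_le_mono1)
  finally show ?thesis by (simp add: W_def card_PiE)
qed

section \<open>Equidistribution of subgroups in intervals\<close>

definition addchar :: "nat \<Rightarrow> int \<Rightarrow> complex" where
  "addchar p z = cis (2 * pi * of_int z / real p)"

lemma addchar_add: "addchar p (a + b) = addchar p a * addchar p b"
  by (simp add: addchar_def cis_mult add_divide_distrib distrib_left)

lemma addchar_diff: "addchar p (a - b) = addchar p a * cnj (addchar p b)"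
  by (simp add: addchar_def cis_mult cis_cnj diff_divide_distrib right_diff_distrib)

lemma addchar_0 [simp]: "addchar p 0 = 1"
  by (simp add: addchar_def)

lemma addchar_multiple: assumes "p > 0" shows "addchar p (int p * c) = 1"
proof -
  have "2 * pi * of_int (int p * c) / real p = 2 * pi * of_int c" using assms by simp
  then show ?thesis unfolding addchar_def by (simp only: cis_multiple_2pi Ints_of_int)
qed

lemma addchar_cong: assumes "p > 0" "[a = b] (mod int p)" shows "addchar p a = addchar p b"
proof -
  obtain c where "a - b = int p * c" using assms(2) by (auto simp: cong_iff_dvd_diff)
  then have "a = b + int p * c" by simp
  then show ?thesis using assms(1) by (simp add: addchar_add addchar_multiple)
qed

lemma addchar_eq_1_iff: assumes "p > 0" shows "addchar p z = 1 \<longleftrightarrow> int p dvd z"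
proof
  assume "addchar p z = 1"
  then have "cos (2 * pi * of_int z / real p) = 1" unfolding addchar_def by (metis cis.sel(1) one_complex.sel(1))
  then obtain n :: int where n: "2 * pi * of_int z / real p = of_int n * 2 * pi"
    using cos_one_2pi_int by blast
  then have "of_int z = (of_int n * real p :: real)" using assms by (simp add: field_simps)
  then have "of_int z = (of_int (n * int p) :: real)" by simp
  then have "z = n * int p" by (simp only: of_int_eq_iff)
  then show "int p dvd z" by simp
next
  assume "int p dvd z"
  then show "addchar p z = 1" using assms addchar_multiple by auto
qed

lemma sum_addchar:
  assumes "p > 0"
  shows "(\<Sum>a<p. addchar p (int a * z)) = (if int p dvd z then of_nat p else 0)"
proof (cases "int p dvd z")
  case True
  then have "addchar p (int a * z) = 1" for a using assms by (simp add: addchar_eq_1_iff)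
  then show ?thesis using True by simp
next
  case False
  have pow: "addchar p (int a * z) = addchar p z ^ a" for a
    by (induction a) (simp_all add: distrib_right addchar_add)
  have ne: "addchar p z \<noteq> 1" using False assms addchar_eq_1_iff by blast
  have "(\<Sum>a<p. addchar p (int a * z)) = (\<Sum>a<p. addchar p z ^ a)" by (simp add: pow)
  also have "\<dots> = (addchar p z ^ p - 1) / (addchar p z - 1)" using ne by (simp add: geometric_sum)
  also have "addchar p z ^ p = 1" using pow[of p] addchar_multiple[OF assms, of z] by simp
  finally show ?thesis using False by simp
qed

text \<open>Orthogonality of the additive characters. The map \<phi> is general so that both
  subgroup elements and dilated intervals are covered.\<close>

lemma parseval_addchar:
  fixes X :: "'a set" and \<phi> :: "'a \<Rightarrow> int"
  assumes p: "p > 0" and fin: "finite X"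
    and inj: "\<And>x y. x \<in> X \<Longrightarrow> y \<in> X \<Longrightarrow> [\<phi> x = \<phi> y] (mod int p) \<Longrightarrow> x = y"
  shows "(\<Sum>a<p. (cmod (\<Sum>x\<in>X. addchar p (int a * \<phi> x)))\<^sup>2) = real p * real (card X)"
proof -
  have "complex_of_real (\<Sum>a<p. (cmod (\<Sum>x\<in>X. addchar p (int a * \<phi> x)))\<^sup>2) =
     (\<Sum>a<p. (\<Sum>x\<in>X. addchar p (int a * \<phi> x)) * cnj (\<Sum>x\<in>X. addchar p (int a * \<phi> x)))"
    by (simp only: of_real_sum complex_norm_square)
  also have "\<dots> = (\<Sum>a<p. \<Sum>x\<in>X. \<Sum>y\<in>X. addchar p (int a * (\<phi> x - \<phi> y)))"
    by (simp add: sum_product addchar_diff right_diff_distrib)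
  also have "\<dots> = (\<Sum>x\<in>X. \<Sum>y\<in>X. \<Sum>a<p. addchar p (int a * (\<phi> x - \<phi> y)))"
    by (subst sum.swap, rule sum.cong[OF refl], rule sum.swap)
  also have "\<dots> = (\<Sum>x\<in>X. \<Sum>y\<in>X. if x = y then of_nat p else 0)"
    using inj p by (intro sum.cong refl) (auto simp: sum_addchar cong_iff_dvd_diff)
  also have "\<dots> = of_nat p * of_nat (card X)" using fin by simp
  finally have "complex_of_real (\<Sum>a<p. (cmod (\<Sum>x\<in>X. addchar p (int a * \<phi> x)))\<^sup>2) = complex_of_real (real p * real (card X))"
    by simp
  then show ?thesis by (simp only: of_real_eq_iff)
qed

definition rootset :: "nat \<Rightarrow> nat \<Rightarrow> nat set" where
  "rootset p t = {z \<in> {..<p}. [z ^ t = 1] (mod p)}"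

lemma finite_rootset [simp]: "finite (rootset p t)"
  by (simp add: rootset_def)

lemma rootset_not_dvd:
  assumes "prime p" "t > 0" "g \<in> rootset p t"
  shows "\<not> p dvd g"
proof
  assume "p dvd g"
  then have "[g ^ t = 0] (mod p)" using assms(2) by (metis cong_0_iff dvd_power dvd_trans)
  then have "[1 = 0] (mod p)" using assms(3) unfolding rootset_def by (metis (mono_tags, lifting) cong_sym cong_trans mem_Collect_eq)
  then have "p dvd 1" by (simp add: cong_0_iff)
  then show False using assms(1) by simp
qed

text \<open>Multiplication by g permutes the subgroup.\<close>

lemma rootset_sum_shift:
  assumes p: "prime p" and t: "t > 0" and g: "g \<in> rootset p t"
  shows "(\<Sum>h\<in>rootset p t. addchar p (int (a * g) * int h)) = (\<Sum>h\<in>rootset p t. addchar p (int a * int h))"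
proof -
  have p0: "p > 0" using p prime_gt_0_nat by auto
  have cop: "coprime g p" using rootset_not_dvd[OF p t g] p by (metis coprime_commute prime_imp_coprime)
  have maps: "g * h mod p \<in> rootset p t" if "h \<in> rootset p t" for h
  proof -
    have "[g ^ t * h ^ t = 1 * 1] (mod p)" using g that by (intro cong_mult) (auto simp: rootset_def)
    then have "[(g * h mod p) ^ t = 1] (mod p)" unfolding Cong.cong_def power_mod by (simp add: power_mult_distrib)
    then show ?thesis using p0 by (simp add: rootset_def)
  qed
  have inj: "inj_on (\<lambda>h. g * h mod p) (rootset p t)"
  proof (rule inj_onI)
    fix h h' assume h: "h \<in> rootset p t" "h' \<in> rootset p t" "g * h mod p = g * h' mod p"
    then have "[g * h = g * h'] (mod p)" by (simp add: Cong.cong_def)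
    then have "[h = h'] (mod p)" using cop cong_mult_lcancel_nat by blast
    then show "h = h'" using h by (auto simp: rootset_def intro: cong_less_modulus_unique_nat)
  qed
  have img: "(\<lambda>h. g * h mod p) ` rootset p t = rootset p t"
    using inj maps by (intro endo_inj_surj) auto
  have "(\<Sum>h\<in>rootset p t. addchar p (int a * int h)) = (\<Sum>h\<in>(\<lambda>h. g * h mod p) ` rootset p t. addchar p (int a * int h))"
    by (simp only: img)
  also have "\<dots> = (\<Sum>h\<in>rootset p t. addchar p (int a * int (g * h mod p)))"
    using inj by (subst sum.reindex) auto
  also have "\<dots> = (\<Sum>h\<in>rootset p t. addchar p (int (a * g) * int h))"
  proof (rule sum.cong[OF refl])
    fix h
    have "[int (g * h mod p) = int (g * h)] (mod int p)" by (simp add: Cong.cong_def zmod_int)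
    then have "[int a * int (g * h mod p) = int a * int (g * h)] (mod int p)" by (rule cong_scalar_left)
    then show "addchar p (int a * int (g * h mod p)) = addchar p (int (a * g) * int h)"
      using p0 addchar_cong by (simp add: mult.assoc)
  qed
  finally show ?thesis by simp
qed

lemma one_in_rootset: "prime p \<Longrightarrow> 1 \<in> rootset p t"
  using prime_gt_1_nat[of p] by (simp add: rootset_def)

text \<open>The sum takes the same value at every frequency in the coset a H, so Parseval over all
  frequencies bounds |H| |S(a)|^2 by p |H|.\<close>

lemma rootset_sum_bound:
  assumes p: "prime p" and t: "t > 0" and a: "\<not> p dvd a"
  shows "(cmod (\<Sum>h\<in>rootset p t. addchar p (int a * int h)))\<^sup>2 \<le> real p"
proof -
  define H where "H = rootset p t"
  define S where "S b = (\<Sum>h\<in>H. addchar p (int b * int h))" for b :: nat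
  have p0: "p > 0" using p prime_gt_0_nat by auto
  have cop: "coprime a p" using a p by (metis coprime_commute prime_imp_coprime)
  have cardH: "card H > 0" using one_in_rootset[OF p, of t] unfolding H_def by (auto simp: card_gt_0_iff)
  have Smod: "S (b mod p) = S b" for b
  proof -
    have "[int (b mod p) * int h = int b * int h] (mod int p)" for h
      by (rule cong_scalar_right) (simp add: Cong.cong_def zmod_int)
    then show ?thesis unfolding S_def using p0 by (intro sum.cong refl addchar_cong) auto
  qed
  have "real (card H) * (cmod (S a))\<^sup>2 = (\<Sum>g\<in>H. (cmod (S (a * g mod p)))\<^sup>2)"
    using rootset_sum_shift[OF p t, of _ a] by (simp add: Smod) (simp add: S_def H_def)
  also have "\<dots> = (\<Sum>b\<in>(\<lambda>g. a * g mod p) ` H. (cmod (S b))\<^sup>2)"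
  proof (subst sum.reindex)
    show "inj_on (\<lambda>g. a * g mod p) H"
    proof (rule inj_onI)
      fix h h' assume h: "h \<in> H" "h' \<in> H" "a * h mod p = a * h' mod p"
      then have "[a * h = a * h'] (mod p)" by (simp add: Cong.cong_def)
      then have "[h = h'] (mod p)" using cop cong_mult_lcancel_nat by blast
      then show "h = h'" using h by (auto simp: H_def rootset_def intro: cong_less_modulus_unique_nat)
    qed
  qed simp
  also have "\<dots> \<le> (\<Sum>b<p. (cmod (S b))\<^sup>2)"
    using p0 by (intro sum_mono2) auto
  also have "\<dots> = real p * real (card H)"
    unfolding S_def
  proof (rule parseval_addchar[OF p0])
    show "finite H" by (simp add: H_def)
    fix x y assume "x \<in> H" "y \<in> H" "[int x = int y] (mod int p)"
    then show "x = y" by (auto simp: cong_int_iff H_def rootset_def intro: cong_less_modulus_unique_nat)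
  qed
  finally have "real (card H) * (cmod (S a))\<^sup>2 \<le> real (card H) * real p" by (simp add: mult.commute)
  then show ?thesis using cardH by (simp add: S_def H_def)
qed

text \<open>Counting over sums k + j from two intervals splits the Fourier coefficient into one
  factor per interval. Cauchy-Schwarz and Parseval bound the sum of their products by p sqrt (K J),
  which avoids estimating the geometric sum of a single interval; the subgroup sum contributes sqrt
  p.\<close>

lemma pair_count_bound:
  fixes p t l K J :: nat
  assumes p: "prime p" and t: "t > 0" and l: "\<not> p dvd l" and K: "K < p" and J: "J \<le> p"
  shows "\<bar>real (\<Sum>j<J. card {k \<in> {1..K}. [(l * (k + j)) ^ t = 1] (mod p)}) - real (card (rootset p t)) * real K * real J / real p\<bar>
    \<le> sqrt (real p * real K * real J)"
proof -
  define H where "H = rootset p t"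
  have p0: "p > 0" using p prime_gt_0_nat by auto
  have cop: "coprime l p" using l p by (metis coprime_commute prime_imp_coprime)
  define S where "S a = (\<Sum>h\<in>H. addchar p (int a * int h))" for a :: nat
  define DK where "DK a = (\<Sum>k\<in>{1..K}. addchar p (int a * int (l * k)))" for a :: nat
  define DJ where "DJ a = (\<Sum>j<J. addchar p (int a * int (l * j)))" for a :: nat
  define N where "N = (\<Sum>j<J. card {k \<in> {1..K}. [(l * (k + j)) ^ t = 1] (mod p)})"
  have ind: "(\<Sum>h\<in>H. \<Sum>a<p. addchar p (int a * (int (l * (k + j)) - int h))) =
     (if [(l * (k + j)) ^ t = 1] (mod p) then of_nat p else 0)" for k j
  proof -
    have "(\<Sum>h\<in>H. \<Sum>a<p. addchar p (int a * (int (l * (k + j)) - int h))) = (\<Sum>h\<in>H. if h = l * (k + j) mod p then of_nat p else 0)"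
    proof (rule sum.cong[OF refl])
      fix h assume h: "h \<in> H"
      have "int p dvd int (l * (k + j)) - int h \<longleftrightarrow> [int (l * (k + j)) = int h] (mod int p)" by (simp add: cong_iff_dvd_diff)
      also have "\<dots> \<longleftrightarrow> [l * (k + j) = h] (mod p)" by (simp only: cong_int_iff)
      also have "\<dots> \<longleftrightarrow> h = l * (k + j) mod p" using h by (auto simp: Cong.cong_def H_def rootset_def)
      finally show "(\<Sum>a<p. addchar p (int a * (int (l * (k + j)) - int h))) = (if h = l * (k + j) mod p then of_nat p else 0)"
        using p0 by (simp add: sum_addchar)
    qed
    also have "\<dots> = (if l * (k + j) mod p \<in> H then of_nat p else 0)" by (simp add: H_def)
    also have "l * (k + j) mod p \<in> H \<longleftrightarrow> [(l * (k + j)) ^ t = 1] (mod p)"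
      using p0 unfolding H_def rootset_def Cong.cong_def by (simp add: power_mod)
    finally show ?thesis .
  qed
  have "of_nat (p * N) = (\<Sum>j<J. \<Sum>k\<in>{1..K}. if [(l * (k + j)) ^ t = 1] (mod p) then of_nat p else (0::complex))"
    unfolding N_def by (simp add: sum_distrib_left sum.If_cases Int_def mult.commute)
  also have "\<dots> = (\<Sum>j<J. \<Sum>k\<in>{1..K}. \<Sum>h\<in>H. \<Sum>a<p. addchar p (int a * (int (l * (k + j)) - int h)))"
    by (simp only: ind)
  also have "\<dots> = (\<Sum>j<J. \<Sum>k\<in>{1..K}. \<Sum>a<p. \<Sum>h\<in>H. addchar p (int a * (int (l * (k + j)) - int h)))"
    by (intro sum.cong refl sum.swap)
  also have "\<dots> = (\<Sum>j<J. \<Sum>k\<in>{1..K}. \<Sum>a<p. addchar p (int a * int (l * k)) * addchar p (int a * int (l * j)) * cnj (S a))"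
    unfolding S_def
    by (intro sum.cong refl) (simp add: addchar_diff addchar_add distrib_left right_diff_distrib sum_distrib_left)
  also have "\<dots> = (\<Sum>j<J. \<Sum>a<p. \<Sum>k\<in>{1..K}. addchar p (int a * int (l * k)) * addchar p (int a * int (l * j)) * cnj (S a))"
    by (intro sum.cong refl sum.swap)
  also have "\<dots> = (\<Sum>a<p. \<Sum>j<J. \<Sum>k\<in>{1..K}. addchar p (int a * int (l * k)) * addchar p (int a * int (l * j)) * cnj (S a))"
    by (rule sum.swap)
  also have "\<dots> = (\<Sum>a<p. DK a * DJ a * cnj (S a))"
    unfolding DK_def DJ_def
    by (rule sum.cong[OF refl], subst sum.swap)
       (simp only: sum_distrib_right [symmetric] sum_distrib_left [symmetric])
  also have "\<dots> = DK 0 * DJ 0 * cnj (S 0) + (\<Sum>a\<in>{1..<p}. DK a * DJ a * cnj (S a))"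
    using p0 by (simp add: lessThan_atLeast0 sum.atLeast_Suc_lessThan)
  also have "DK 0 * DJ 0 * cnj (S 0) = of_nat (K * J * card H)" by (simp add: DK_def DJ_def S_def)
  finally have main: "of_nat (p * N) - of_nat (K * J * card H) = (\<Sum>a\<in>{1..<p}. DK a * DJ a * cnj (S a))" by simp
  have "\<bar>real (p * N) - real (K * J * card H)\<bar> = cmod (complex_of_real (real (p * N) - real (K * J * card H)))"
    by (simp only: norm_of_real real_norm_def)
  also have "complex_of_real (real (p * N) - real (K * J * card H)) = of_nat (p * N) - of_nat (K * J * card H)" by simp
  also have "cmod \<dots> = cmod (\<Sum>a\<in>{1..<p}. DK a * DJ a * cnj (S a))" by (simp only: main)
  also have "\<dots> \<le> (\<Sum>a\<in>{1..<p}. cmod (DK a * DJ a * cnj (S a)))" by (rule norm_sum)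
  also have "\<dots> \<le> (\<Sum>a\<in>{1..<p}. sqrt (real p) * (cmod (DK a) * cmod (DJ a)))"
  proof (rule sum_mono)
    fix a assume "a \<in> {1..<p}"
    then have "\<not> p dvd a" using nat_dvd_not_less by auto
    then have "(cmod (S a))\<^sup>2 \<le> real p" unfolding S_def H_def by (rule rootset_sum_bound[OF p t])
    then have "cmod (S a) \<le> sqrt (real p)" by (rule real_le_rsqrt)
    then have "cmod (S a) * (cmod (DK a) * cmod (DJ a)) \<le> sqrt (real p) * (cmod (DK a) * cmod (DJ a))"
      by (intro mult_right_mono) auto
    then show "cmod (DK a * DJ a * cnj (S a)) \<le> sqrt (real p) * (cmod (DK a) * cmod (DJ a))"
      by (simp add: norm_mult mult_ac)
  qed
  also have "\<dots> \<le> (\<Sum>a<p. sqrt (real p) * (cmod (DK a) * cmod (DJ a)))"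
    by (intro sum_mono2) auto
  also have "\<dots> = sqrt (real p) * (\<Sum>a<p. cmod (DK a) * cmod (DJ a))" by (simp add: sum_distrib_left)
  also have "\<dots> \<le> sqrt (real p) * sqrt ((real p * real K) * (real p * real J))"
  proof (rule mult_left_mono)
    have inj: "x = y" if "[int (l * x) = int (l * y)] (mod int p)" "\<bar>int x - int y\<bar> < int p" for x y
    proof -
      have "[l * x = l * y] (mod p)" using that(1) by (simp only: cong_int_iff)
      then have "[x = y] (mod p)" using cop cong_mult_lcancel_nat by blast
      then have "int p dvd int x - int y" by (simp add: cong_int_iff [symmetric] cong_iff_dvd_diff)
      then have "int x - int y = 0" using that(2) by (metis abs_of_nat dvd_imp_le_int linorder_not_less)
      then show "x = y" by simp
    qed
    have "(\<Sum>a<p. (cmod (DK a))\<^sup>2) = real p * real (card {1..K})"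
      unfolding DK_def
    proof (rule parseval_addchar[OF p0])
      fix x y assume "x \<in> {1..K}" "y \<in> {1..K}" "[int (l * x) = int (l * y)] (mod int p)"
      then show "x = y" using K by (intro inj) auto
    qed simp
    then have sK: "(\<Sum>a<p. (cmod (DK a))\<^sup>2) = real p * real K" by simp
    have "(\<Sum>a<p. (cmod (DJ a))\<^sup>2) = real p * real (card {..<J})"
      unfolding DJ_def
    proof (rule parseval_addchar[OF p0])
      fix x y assume "x \<in> {..<J}" "y \<in> {..<J}" "[int (l * x) = int (l * y)] (mod int p)"
      then show "x = y" using J by (intro inj) auto
    qed simp
    then have sJ: "(\<Sum>a<p. (cmod (DJ a))\<^sup>2) = real p * real J" by simp
    have "(\<Sum>a<p. cmod (DK a) * cmod (DJ a))\<^sup>2 \<le> (\<Sum>a<p. (cmod (DK a))\<^sup>2) * (\<Sum>a<p. (cmod (DJ a))\<^sup>2)"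
      by (rule Cauchy_Schwarz_ineq_sum)
    then show "(\<Sum>a<p. cmod (DK a) * cmod (DJ a)) \<le> sqrt ((real p * real K) * (real p * real J))"
      unfolding sK sJ by (rule real_le_rsqrt)
  qed simp
  also have "\<dots> = real p * sqrt (real p * real K * real J)"
    by (simp add: real_sqrt_mult)
  finally have "\<bar>real p * real N - real K * real J * real (card H)\<bar> \<le> real p * sqrt (real p * real K * real J)" by simp
  then have "\<bar>real p * real N - real K * real J * real (card H)\<bar> / real p \<le> sqrt (real p * real K * real J)"
    using p0 by (simp add: divide_le_eq mult.commute)
  moreover have "\<bar>real p * real N - real K * real J * real (card H)\<bar> / real p = \<bar>real N - real (card H) * real K * real J / real p\<bar>"
  proof -
    have "real N - real (card H) * real K * real J / real p = (real p * real N - real K * real J * real (card H)) / real p"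
      using p0 by (simp add: field_simps)
    then show ?thesis by (simp add: abs_divide)
  qed
  ultimately show ?thesis unfolding N_def H_def by simp
qed

text \<open>Averaging over J shifts, with J about sqrt p: a shift by j changes the count by at most
  j, so smoothing costs at most J, and the smoothed error is at most p / sqrt J. The exponent 3/4 is
  not optimised; it only has to stay well below 9/10.\<close>

lemma interval_count_bound:
  fixes p t l K :: nat
  assumes p: "prime p" and t: "t > 0" and l: "\<not> p dvd l" and K: "K < p"
  shows "\<bar>real (card {k \<in> {1..K}. [(l * k) ^ t = 1] (mod p)}) - real (card (rootset p t)) * real K / real p\<bar>
    \<le> 3 * real p powr (3 / 4)"
proof -
  define J where "J = nat \<lceil>sqrt (real p)\<rceil>"
  have p2: "real p \<ge> 2" using prime_ge_2_nat[OF p] by simp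
  have sq1: "sqrt (real p) \<ge> 1" using p2 by simp
  have J: "real J \<ge> sqrt (real p)" "real J < sqrt (real p) + 1" unfolding J_def using sq1 by linarith+
  have J0: "J > 0" using J sq1 by (cases J) auto
  have Jp: "J \<le> p"
  proof -
    have "sqrt (real p) \<le> real p" using p2 by (intro real_le_lsqrt) (auto simp: power2_eq_square)
    then have "\<lceil>sqrt (real p)\<rceil> \<le> int p" by (simp add: ceiling_le_iff)
    then show ?thesis unfolding J_def by linarith
  qed
  define P where "P x = [(l * x) ^ t = 1] (mod p)" for x
  define c where "c j = card {k \<in> {1..K}. P (k + j)}" for j
  have shift: "\<bar>real (c j) - real (c 0)\<bar> \<le> real j" for j
  proof -
    have e1: "c j = card {k \<in> {1 + j..K + j}. P k}"
      unfolding c_def by (rule bij_betw_same_card[of "\<lambda>k. k + j"])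
        (rule bij_betwI[where g = "\<lambda>k. k - j"], auto)
    have e0: "c 0 = card {k \<in> {1..K}. P k}" by (simp add: c_def)
    have "card {k \<in> {1 + j..K + j}. P k} \<le> card ({k \<in> {1..K}. P k} \<union> {K + 1..K + j})" by (intro card_mono) auto
    also have "\<dots> \<le> card {k \<in> {1..K}. P k} + card {K + 1..K + j}" by (rule card_Un_le)
    finally have 1: "c j \<le> c 0 + j" using e1 e0 by simp
    have "card {k \<in> {1..K}. P k} \<le> card ({k \<in> {1 + j..K + j}. P k} \<union> {1..j})" by (intro card_mono) auto
    also have "\<dots> \<le> card {k \<in> {1 + j..K + j}. P k} + card {1..j}" by (rule card_Un_le)
    finally have 2: "c 0 \<le> c j + j" using e1 e0 by simp
    show ?thesis using 1 2 by linarith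
  qed
  define M where "M = real (card (rootset p t)) * real K / real p"
  have "\<bar>real J * real (c 0) - (\<Sum>j<J. real (c j))\<bar> = \<bar>\<Sum>j<J. real (c 0) - real (c j)\<bar>" by (simp add: sum_subtractf)
  also have "\<dots> \<le> (\<Sum>j<J. \<bar>real (c 0) - real (c j)\<bar>)" by (rule sum_abs)
  also have "\<dots> \<le> (\<Sum>j<J. real J)"
  proof (rule sum_mono)
    fix j assume "j \<in> {..<J}"
    then have "real j \<le> real J" by simp
    then show "\<bar>real (c 0) - real (c j)\<bar> \<le> real J" using shift[of j] by linarith
  qed
  finally have 1: "\<bar>real J * real (c 0) - (\<Sum>j<J. real (c j))\<bar> \<le> real J * real J" by simp
  have "\<bar>real (\<Sum>j<J. c j) - real (card (rootset p t)) * real K * real J / real p\<bar> \<le> sqrt (real p * real K * real J)"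
    unfolding c_def P_def by (rule pair_count_bound[OF p t l K Jp])
  then have 2: "\<bar>(\<Sum>j<J. real (c j)) - real J * M\<bar> \<le> sqrt (real p * real K * real J)" by (simp add: M_def mult_ac)
  have "sqrt (real p * real K * real J) \<le> sqrt (real p * real p * real J)"
    using K by (intro real_sqrt_le_mono mult_right_mono mult_left_mono) auto
  also have "\<dots> = real p * sqrt (real J)" by (simp add: real_sqrt_mult)
  finally have 3: "sqrt (real p * real K * real J) \<le> real p * sqrt (real J)" .
  have "real J * \<bar>real (c 0) - M\<bar> = \<bar>real J * real (c 0) - real J * M\<bar>"
    by (simp add: right_diff_distrib [symmetric] abs_mult)
  also have "\<dots> \<le> real J * real J + real p * sqrt (real J)" using 1 2 3 by linarith
  also have "\<dots> = real J * (real J + real p / sqrt (real J))"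
    using J0 by (simp add: distrib_left real_div_sqrt field_simps)
  finally have "\<bar>real (c 0) - M\<bar> \<le> real J + real p / sqrt (real J)" using J0 by simp
  also have "\<dots> \<le> 3 * real p powr (3 / 4)"
  proof -
    have h: "sqrt (real p) = real p powr (1 / 2)" by (simp add: powr_half_sqrt)
    have "real p powr (1 / 2) \<le> real p powr (3 / 4)" "1 \<le> real p powr (3 / 4)"
      using p2 by (auto intro: powr_mono ge_one_powr_ge_zero)
    then have a: "real J \<le> 2 * real p powr (3 / 4)" using J(2) unfolding h by linarith
    have "real p / sqrt (real J) \<le> real p / sqrt (sqrt (real p))"
      using J(1) p2 J0 by (intro divide_left_mono real_sqrt_le_mono mult_pos_pos) auto
    also have "sqrt (sqrt (real p)) = real p powr (1 / 4)"
      using p2 by (simp add: powr_half_sqrt [symmetric] powr_powr)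
    also have "real p / real p powr (1 / 4) = real p powr (1 - 1 / 4)"
      using p2 by (simp only: powr_diff) simp
    finally show ?thesis using a by simp
  qed
  finally show ?thesis unfolding M_def c_def P_def by simp
qed

section \<open>Inclusion-exclusion over the primes of t\<close>

text \<open>Expansion of the product of 1 - [q divides k] over the primes q of t; subsets of primes
  take the place of the Moebius function.\<close>

lemma coprime_indicator:
  fixes k t :: nat
  assumes "t > 0"
  shows "(if coprime k t then 1 else 0 :: real) =
    (\<Sum>S\<in>Pow (prime_factors t). (-1) ^ card S * (if \<Prod>S dvd k then 1 else 0))"
proof -
  have "(if coprime k t then 1 else 0 :: real) = (\<Prod>q\<in>prime_factors t. - (if q dvd k then 1 else 0) + 1)"
  proof (cases "coprime k t")
    case True
    have "\<not> q dvd k" if "q \<in> prime_factors t" for q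
      using True that by (meson coprime_common_divisor in_prime_factors_imp_dvd in_prime_factors_imp_prime not_prime_unit)
    then have "(\<Prod>q\<in>prime_factors t. - (if q dvd k then 1 else 0) + 1 :: real) = (\<Prod>q\<in>prime_factors t. 1)"
      by (intro prod.cong) auto
    then show ?thesis using True by simp
  next
    case False
    then obtain q where q: "prime q" "q dvd k" "q dvd t"
      by (metis assms coprime_iff_gcd_eq_1 gcd_dvd1 gcd_dvd2 dvd_trans prime_factor_nat)
    then have "q \<in> prime_factors t" using assms by (simp add: prime_factors_dvd)
    then have "(\<Prod>q\<in>prime_factors t. - (if q dvd k then 1 else 0) + 1 :: real) = 0"
      using q by (intro prod_zero) auto
    then show ?thesis using False by simp
  qed
  also have "\<dots> = (\<Sum>S\<in>Pow (prime_factors t). (\<Prod>q\<in>S. - (if q dvd k then 1 else 0)) * (\<Prod>q\<in>prime_factors t - S. 1))"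
    by (rule prod_add) simp
  also have "\<dots> = (\<Sum>S\<in>Pow (prime_factors t). (-1) ^ card S * (if \<Prod>S dvd k then 1 else 0))"
  proof (rule sum.cong[OF refl])
    fix S assume "S \<in> Pow (prime_factors t)"
    then have S: "finite S" "\<And>q. q \<in> S \<Longrightarrow> prime q" by (auto intro: finite_subset)
    have "(\<Prod>q\<in>S. - (if q dvd k then 1 else 0)) * (\<Prod>q\<in>prime_factors t - S. 1 :: real) = (\<Prod>q\<in>S. (-1) * (if q dvd k then 1 else 0))"
      by (simp cong: prod.cong)
    also have "\<dots> = (-1) ^ card S * (\<Prod>q\<in>S. (if q dvd k then 1 else 0))" by (simp only: prod.distrib prod_constant)
    also have "(\<Prod>q\<in>S. (if q dvd k then 1 else 0 :: real)) = (if \<Prod>S dvd k then 1 else 0)"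
      using S
    proof (induction S rule: finite_induct)
      case (insert q S)
      have "coprime q (\<Prod>S)"
        using insert by (intro prod_coprime_right) (auto intro!: primes_coprime)
      then have "q * \<Prod>S dvd k \<longleftrightarrow> q dvd k \<and> \<Prod>S dvd k"
        by (meson divides_mult dvd_mult_left dvd_mult_right)
      then show ?case using insert by auto
    qed simp
    finally show "(\<Prod>q\<in>S. - (if q dvd k then 1 else 0)) * (\<Prod>q\<in>prime_factors t - S. 1 :: real) = (-1) ^ card S * (if \<Prod>S dvd k then 1 else 0)" .
  qed
  finally show ?thesis .
qed

text \<open>Distinct sets of primes of t have distinct products, namely the squarefree divisors of
  t.\<close>

lemma two_power_card_prime_factors_le:
  fixes t :: nat
  assumes "t > 0"
  shows "2 ^ card (prime_factors t) \<le> card {d. d dvd t}"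
proof -
  have "2 ^ card (prime_factors t) = card (Pow (prime_factors t))" by (simp add: card_Pow)
  also have "\<dots> \<le> card {d. d dvd t}"
  proof (rule card_inj_on_le[where f = "\<lambda>S. \<Prod>S"])
    have rec: "{q. prime q \<and> q dvd \<Prod>S} = S" if "S \<subseteq> prime_factors t" for S
    proof -
      have fin: "finite S" using that finite_subset by auto
      have pr: "prime q" if "q \<in> S" for q using that \<open>S \<subseteq> prime_factors t\<close> by auto
      have "q dvd \<Prod>S \<longleftrightarrow> q \<in> S" if "prime q" for q
        using fin that pr primes_dvd_imp_eq[of q] by (auto simp: prime_dvd_prod_iff intro: bexI[of _ q])
      then show ?thesis using pr by auto
    qed
    show "inj_on (\<lambda>S. \<Prod>S) (Pow (prime_factors t))"
      by (rule inj_onI) (metis PowD rec)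
    show "(\<lambda>S. \<Prod>S) ` Pow (prime_factors t) \<subseteq> {d. d dvd t}"
    proof safe
      fix S assume "S \<subseteq> prime_factors t"
      then have "\<Prod>S dvd \<Prod>(prime_factors t)" by (intro prod_dvd_prod_subset) auto
      also have "\<dots> dvd (\<Prod>q\<in>prime_factors t. q ^ multiplicity q t)"
        by (intro prod_dvd_prod) (auto simp: prime_factors_multiplicity intro!: dvd_power)
      also have "\<dots> = t" using assms by (simp add: prod_prime_factors)
      finally show "\<Prod>S dvd t" .
    qed
    show "finite {d. d dvd t}" using assms by simp
  qed
  finally show ?thesis .
qed

text \<open>N(t) and phi(t) are expanded by the same inclusion-exclusion and compared set by set:
  among the multiples of a product m of primes of t, those satisfying the subgroup condition number
  |H| / p times all multiples, up to 3 p^(3/4). So the main term needs no evaluation, and the error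
  is only multiplied by the number of squarefree divisors.\<close>

lemma card_Kset_le_totient:
  assumes p: "prime p" and t: "t dvd p - 1"
  shows "real (card (Kset p t)) \<le> real t * real (totient t) / real p + real (card {d. d dvd t}) * (3 * real p powr (3 / 4))"
proof -
  have p0: "p > 0" using prime_gt_0_nat[OF p] .
  have t0: "t > 0" by (rule dvd_pred_prime(1)[OF p t])
  define d where "d = (p - 1) div t"
  have d0: "d > 0" and dle: "d < p" unfolding d_def using cofactor_coprime[OF p t] by auto
  have tp: "t < p" by (rule dvd_pred_prime(2)[OF p t])
  define P where "P k \<longleftrightarrow> [(d * k) ^ t = 1] (mod p)" for k
  define R where "R = real (card (rootset p t)) / real p"
  define Q where "Q = prime_factors t"
  define b where "b S = real (card {k \<in> {1..t}. \<Prod>S dvd k \<and> P k})" for S :: "nat set"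
  define f where "f S = real (card {k \<in> {1..t}. \<Prod>S dvd k})" for S :: "nat set"
  have count: "real (card {k \<in> {1..t}. A k}) = (\<Sum>k\<in>{1..t}. if A k then 1 else 0)" for A
    by (simp add: sum.If_cases Int_def)
  have "real (card (Kset p t)) = (\<Sum>k\<in>{1..t}. if coprime k t \<and> P k then 1 else 0)"
    unfolding Kset_def P_def d_def by (rule count)
  also have "\<dots> = (\<Sum>k\<in>{1..t}. (if coprime k t then 1 else 0) * (if P k then 1 else 0))"
    by (intro sum.cong) auto
  also have "\<dots> = (\<Sum>k\<in>{1..t}. \<Sum>S\<in>Pow Q. (-1) ^ card S * (if \<Prod>S dvd k \<and> P k then 1 else 0))"
    unfolding coprime_indicator[OF t0] Q_def sum_distrib_right by (intro sum.cong refl) auto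
  also have "\<dots> = (\<Sum>S\<in>Pow Q. (-1) ^ card S * b S)"
    unfolding b_def count by (subst sum.swap) (simp add: sum_distrib_left)
  finally have N: "real (card (Kset p t)) = (\<Sum>S\<in>Pow Q. (-1) ^ card S * b S)" .
  have "real (totient t) = (\<Sum>k\<in>{1..t}. if coprime k t then 1 else 0)"
  proof -
    have "totatives t = {k \<in> {1..t}. coprime k t}" by (auto simp: totatives_def)
    then have "real (totient t) = real (card {k \<in> {1..t}. coprime k t})" by (simp add: totient_def)
    then show ?thesis by (simp only: count)
  qed
  also have "\<dots> = (\<Sum>k\<in>{1..t}. \<Sum>S\<in>Pow Q. (-1) ^ card S * (if \<Prod>S dvd k then 1 else 0))"
    unfolding coprime_indicator[OF t0] Q_def ..
  also have "\<dots> = (\<Sum>S\<in>Pow Q. (-1) ^ card S * f S)"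
    unfolding f_def count by (subst sum.swap) (simp add: sum_distrib_left)
  finally have T: "real (totient t) = (\<Sum>S\<in>Pow Q. (-1) ^ card S * f S)" .
  have err: "\<bar>b S - R * f S\<bar> \<le> 3 * real p powr (3 / 4)" if S: "S \<subseteq> Q" for S
  proof -
    define m where "m = \<Prod>S"
    have finS: "finite S" using S unfolding Q_def using finite_subset by auto
    have prS: "prime q" if "q \<in> S" for q using that S by (auto simp: Q_def)
    have m0: "m > 0" unfolding m_def using prS prime_gt_0_nat by (intro prod_pos) auto
    have img: "{k \<in> {1..t}. m dvd k \<and> A k} = (*) m ` {j \<in> {1..t div m}. A (m * j)}" for A
    proof (intro equalityI subsetI)
      fix k assume k: "k \<in> {k \<in> {1..t}. m dvd k \<and> A k}"
      then obtain j where j: "k = m * j" by auto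
      then have "j \<le> t div m" using k m0 by (simp add: less_eq_div_iff_mult_less_eq mult.commute)
      moreover have "j \<ge> 1" using j k by (cases j) auto
      ultimately show "k \<in> (*) m ` {j \<in> {1..t div m}. A (m * j)}" using j k by auto
    next
      fix k assume "k \<in> (*) m ` {j \<in> {1..t div m}. A (m * j)}"
      then obtain j where j: "k = m * j" "1 \<le> j" "j \<le> t div m" "A (m * j)" by auto
      then have "m * j \<le> t" using m0 by (simp add: less_eq_div_iff_mult_less_eq mult.commute)
      then show "k \<in> {k \<in> {1..t}. m dvd k \<and> A k}" using j m0 by auto
    qed
    have cardimg: "card {k \<in> {1..t}. m dvd k \<and> A k} = card {j \<in> {1..t div m}. A (m * j)}" for A
      unfolding img using m0 by (intro card_image) (auto simp: inj_on_def)
    have bS: "b S = real (card {j \<in> {1..t div m}. [((d * m) * j) ^ t = 1] (mod p)})"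
      unfolding b_def m_def [symmetric] cardimg P_def by (simp add: mult.assoc)
    have fS: "f S = real (t div m)"
      using cardimg[of "\<lambda>_. True"] unfolding f_def m_def [symmetric]
      by (simp flip: atLeastAtMost_iff)
    \<comment> \<open>Invertibility of the dilation: d is below p, and so is every prime in S, since
      it divides t.\<close>
    have "\<not> p dvd d * m"
    proof
      assume "p dvd d * m"
      then have "p dvd d \<or> p dvd m" using p by (simp add: prime_dvd_mult_iff)
      then have "p dvd m" using d0 dle nat_dvd_not_less by blast
      then obtain q where q: "q \<in> S" "p dvd q" using finS p by (auto simp: m_def prime_dvd_prod_iff)
      have "q dvd t" using q(1) S by (auto simp: Q_def)
      then have "q \<le> t" using t0 dvd_imp_le by blast
      moreover have "q > 0" using prS[OF q(1)] prime_gt_0_nat by auto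
      ultimately show False using q(2) tp by (meson dvd_imp_le leD order_le_less_trans)
    qed
    moreover have "t div m < p" using tp div_le_dividend[of t m] by linarith
    ultimately have "\<bar>b S - real (card (rootset p t)) * real (t div m) / real p\<bar> \<le> 3 * real p powr (3 / 4)"
      unfolding bS using p t0 by (intro interval_count_bound) auto
    then show ?thesis by (simp add: R_def fS)
  qed
  have "real (card (Kset p t)) - R * real (totient t) = (\<Sum>S\<in>Pow Q. (-1) ^ card S * (b S - R * f S))"
    unfolding N T by (simp add: sum_distrib_left sum_subtractf right_diff_distrib mult_ac)
  also have "\<dots> \<le> (\<Sum>S\<in>Pow Q. 3 * real p powr (3 / 4))"
  proof (rule sum_mono)
    fix S assume "S \<in> Pow Q"
    then have "\<bar>b S - R * f S\<bar> \<le> 3 * real p powr (3 / 4)" using err by auto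
    moreover have "(-1) ^ card S * (b S - R * f S) \<le> \<bar>b S - R * f S\<bar>"
      by (cases "even (card S)") auto
    ultimately show "(-1) ^ card S * (b S - R * f S) \<le> 3 * real p powr (3 / 4)" by linarith
  qed
  also have "\<dots> = real (2 ^ card Q) * (3 * real p powr (3 / 4))" by (simp add: Q_def card_Pow)
  also have "\<dots> \<le> real (card {d. d dvd t}) * (3 * real p powr (3 / 4))"
    using two_power_card_prime_factors_le[OF t0] unfolding Q_def by (intro mult_right_mono) (simp_all only: of_nat_le_iff, simp)
  finally have "real (card (Kset p t)) \<le> R * real (totient t) + real (card {d. d dvd t}) * (3 * real p powr (3 / 4))" by simp
  moreover have "R * real (totient t) \<le> real t * real (totient t) / real p"
  proof -
    have "card (rootset p t) \<le> t" unfolding rootset_def using p t0 by (intro roots_mod_prime_bound) auto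
    then have "R \<le> real t / real p" unfolding R_def by (intro divide_right_mono) auto
    then have "R * real (totient t) \<le> real t / real p * real (totient t)" by (intro mult_right_mono) auto
    then show ?thesis by simp
  qed
  ultimately show ?thesis by linarith
qed

section \<open>Bounds in terms of the iterated logarithm\<close>

lemma geometric_factor_le:
  fixes y :: real assumes "y > 0"
  shows "1 / (1 - exp (- y)) \<le> 1 + 1 / y"
proof -
  have "exp (- y) \<le> 1 / (1 + y)"
    using exp_ge_add_one_self[of y] assms by (simp add: exp_minus field_simps)
  then have "1 - exp (- y) \<ge> y / (1 + y)" using assms by (simp add: field_simps)
  then have "1 / (1 - exp (- y)) \<le> 1 / (y / (1 + y))" using assms by (intro divide_left_mono) auto
  also have "\<dots> = 1 + 1 / y" using assms by (simp add: field_simps)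
  finally show ?thesis .
qed

lemma prod_le_exp_card:
  fixes f :: "'a \<Rightarrow> real"
  assumes "finite P" "\<And>q. q \<in> P \<Longrightarrow> 0 \<le> f q \<and> f q \<le> B" "B \<ge> 1" "real (card P) \<le> k"
  shows "(\<Prod>q\<in>P. f q) \<le> exp (k * ln B)"
proof -
  have "(\<Prod>q\<in>P. f q) \<le> (\<Prod>q\<in>P. B)" using assms(2) by (intro prod_mono) auto
  also have "\<dots> = exp (real (card P) * ln B)" using assms(3) by (simp add: exp_of_nat_mult)
  also have "\<dots> \<le> exp (k * ln B)" using assms(3,4) by (simp add: mult_right_mono)
  finally show ?thesis .
qed

text \<open>The value is what the estimates below produce; only its being constant matters.\<close>
definition lattice_const :: real where "lattice_const = ln 150 + 767"

text \<open>With A = ln t / l there are about A pivots, and Rankin's trick with s = 1 / l costs e^A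
  and a factor of at most 1 + l / ln q per pivot q. Pivots are distinct primes, so all but sqrt A of
  them exceed sqrt A, where the factor is O(l / ln A). As A >= l^(1/50), this is O(l / ln l), and ln
  N(t) <= A (ln l - ln ln l + O(1)) results. The saving of ln ln l decides
  \<open>sum_subexponential_range\<close>.\<close>

lemma Kset_lattice_bound_aux:
  fixes p t :: nat and l :: real
  assumes e1: "l \<ge> 17" and e2: "ln (17 * l) \<le> 2 * ln l" and e3: "l powr (1 / 50) \<ge> (ln (3 * l))\<^sup>2"
    and e4: "l powr (1 / 50) \<ge> 2" and e5: "exp (2 / 5 * l) * l \<ge> 272" and e6: "exp l > 2 * ln 2"
    and p: "prime p" and lp: "ln (real p) = exp l" and t: "t dvd p - 1"
    and lo: "l powr (1 / 50) * l \<le> ln (real t)" and hi: "ln (real t) \<le> exp (3 / 10 * l)"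
  shows "real (card (Kset p t)) \<le> real t powr ((lattice_const + ln l - ln (ln l)) / l)"
proof -
  have p0: "real p > 0" using prime_gt_0_nat[OF p] by simp
  have t0: "t > 0" by (rule dvd_pred_prime(1)[OF p t])
  define x where "x = exp l"
  have px: "real p = exp x" using p0 lp by (simp add: x_def flip: lp)
  define A where "A = ln (real t) / l"
  have lnt: "ln (real t) = A * l" using e1 by (simp add: A_def)
  have A0: "A \<ge> l powr (1 / 50)" using lo e1 unfolding A_def by (simp add: pos_le_divide_eq)
  have A2: "A \<ge> 2" using A0 e4 by simp
  have Al: "A * l \<le> exp (3 / 10 * l)" using hi by (simp add: lnt)
  have lnA_hi: "ln A \<le> 3 / 10 * l - ln l"
  proof -
    have "ln (A * l) \<le> ln (exp (3 / 10 * l))" using Al A2 e1 by (intro ln_mono) auto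
    then show ?thesis using A2 e1 by (simp add: ln_mult)
  qed
  have lnl: "ln l \<ge> 1"
  proof -
    have "exp 1 \<le> (3::real)" by (rule exp_le)
    then have "exp 1 \<le> l" using e1 by simp
    then have "ln (exp 1) \<le> ln l" using e1 by (intro ln_mono) auto
    then show ?thesis by simp
  qed
  have lnA_lo: "ln A \<ge> ln l / 50"
  proof -
    have "ln (l powr (1 / 50)) \<le> ln A" using A0 e4 by (intro ln_mono) auto
    then show ?thesis using e1 by (simp add: ln_powr)
  qed
  \<comment> \<open>It will turn out that ln V >= l (1 - \<delta>): \<delta> collects the loss from
    V being only about x / (17 A^2 l) instead of x.\<close>
  define \<delta> where "\<delta> = (2 * ln A + ln (17 * l)) / l"
  have \<delta>6: "\<delta> \<le> 6 / 10"
  proof -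
    have "2 * ln A + ln (17 * l) \<le> 6 / 10 * l" using lnA_hi e2 by simp
    then show ?thesis using e1 unfolding \<delta>_def by (simp add: pos_divide_le_eq)
  qed
  have \<delta>0: "\<delta> \<ge> 0" unfolding \<delta>_def using A2 e1 by (intro divide_nonneg_pos add_nonneg_nonneg mult_nonneg_nonneg ln_ge_zero) auto
  have \<delta>a: "\<delta> \<le> 102 * (ln A / l)"
  proof -
    have "ln (17 * l) \<le> 100 * ln A" using e2 lnA_lo by simp
    then have "2 * ln A + ln (17 * l) \<le> 102 * ln A" by simp
    then show ?thesis using e1 unfolding \<delta>_def by (simp add: divide_right_mono)
  qed
  \<comment> \<open>The denominator makes 2 (m + 1) V ln t <= x / 2, given m + 1 <= 4 A and ln t = A
    l.\<close>
  define V where "V = nat \<lfloor>x / (16 * A\<^sup>2 * l)\<rfloor>"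
  have big: "x / (A\<^sup>2 * l) \<ge> 272"
  proof -
    have "(A * l)\<^sup>2 \<le> (exp (3 / 10 * l))\<^sup>2" using Al A2 e1 by (intro power_mono) auto
    also have "\<dots> = exp (6 / 10 * l)" by (simp add: power2_eq_square exp_add [symmetric])
    finally have *: "A\<^sup>2 * l * l \<le> exp (6 / 10 * l)" by (simp add: power_mult_distrib power2_eq_square mult_ac)
    have pos: "A\<^sup>2 * l > 0" using A2 e1 by simp
    have "272 * (A\<^sup>2 * l) \<le> (exp (2 / 5 * l) * l) * (A\<^sup>2 * l)" using e5 pos by (intro mult_right_mono) auto
    also have "\<dots> = exp (2 / 5 * l) * (A\<^sup>2 * l * l)" by (simp add: mult_ac)
    also have "\<dots> \<le> exp (2 / 5 * l) * exp (6 / 10 * l)" using * by (intro mult_left_mono) auto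
    also have "\<dots> = x" by (simp add: x_def exp_add [symmetric])
    finally show ?thesis using pos by (simp add: pos_le_divide_eq)
  qed
  define r where "r = x / (A\<^sup>2 * l)"
  have Veq: "x / (16 * A\<^sup>2 * l) = r / 16" "x / (17 * A\<^sup>2 * l) = r / 17" by (simp_all add: r_def)
  have r: "r \<ge> 272" using big by (simp add: r_def)
  have V_r: "real V \<le> r / 16" "real V > r / 16 - 1" unfolding V_def Veq using r by linarith+
  have V_hi: "real V \<le> x / (16 * A\<^sup>2 * l)" unfolding Veq using V_r by simp
  have V_lo: "real V \<ge> x / (17 * A\<^sup>2 * l)"
    unfolding Veq using V_r r by linarith
  have pos17: "x / (17 * A\<^sup>2 * l) > 0" using A2 e1 by (simp add: x_def)
  have lnV: "ln (real V) \<ge> l * (1 - \<delta>)"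
  proof -
    have "ln (x / (17 * A\<^sup>2 * l)) \<le> ln (real V)" using V_lo pos17 by (intro ln_mono) auto
    moreover have "ln (x / (17 * A\<^sup>2 * l)) = l - (2 * ln A + ln (17 * l))"
      using A2 e1 by (simp add: x_def ln_div ln_mult ln_realpow)
    moreover have "l * (1 - \<delta>) = l - (2 * ln A + ln (17 * l))" using e1 by (simp add: \<delta>_def field_simps)
    ultimately show ?thesis by simp
  qed
  \<comment> \<open>m + 1 is the first integer above A / (1 - \<delta>), so that (m + 1) ln V > A l
    = ln t.\<close>
  define m where "m = nat \<lfloor>A / (1 - \<delta>)\<rfloor>"
  have Ad: "A / (1 - \<delta>) > 0" using A2 \<delta>6 by simp
  have m_hi: "real m \<le> A / (1 - \<delta>)" and m_lo: "real (Suc m) > A / (1 - \<delta>)"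
    unfolding m_def using Ad by linarith+
  have m4: "real (Suc m) \<le> 4 * A"
  proof -
    have "A / (1 - \<delta>) \<le> A / (4 / 10)" using A2 \<delta>6 by (intro divide_left_mono) auto
    also have "\<dots> = 5 / 2 * A" by simp
    finally have "real m \<le> 5 / 2 * A" using m_hi by linarith
    then show ?thesis using A2 by simp
  qed
  have V0: "real V > 0" using V_lo pos17 by linarith
  have tV: "t < V ^ Suc m"
  proof -
    have "A * l = (A / (1 - \<delta>)) * (l * (1 - \<delta>))" using \<delta>6 by simp
    also have "\<dots> < real (Suc m) * (l * (1 - \<delta>))" using m_lo \<delta>6 e1 by (intro mult_strict_right_mono) auto
    also have "\<dots> \<le> real (Suc m) * ln (real V)" using lnV by (intro mult_left_mono) auto
    finally have "exp (ln (real t)) < exp (real (Suc m) * ln (real V))" by (simp add: lnt)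
    then have "real t < real V ^ Suc m" using t0 V0 by (simp only: exp_of_nat_mult exp_ln of_nat_0_less_iff)
    then have "real t < real (V ^ Suc m)" by (simp only: of_nat_power)
    then show ?thesis by (simp only: of_nat_less_iff)
  qed
  have small: "2 * t ^ (2 * Suc m * V) < p"
  proof -
    have "real (2 * Suc m * V) * ln (real t) = 2 * (real (Suc m) * real V) * (A * l)" by (simp add: lnt algebra_simps)
    also have "\<dots> \<le> 2 * ((4 * A) * (x / (16 * A\<^sup>2 * l))) * (A * l)"
      using m4 V_hi A2 e1 by (intro mult_right_mono mult_left_mono mult_mono) auto
    also have "\<dots> = x / 2" using A2 e1 by (simp add: power2_eq_square field_simps)
    finally have "exp (real (2 * Suc m * V) * ln (real t)) \<le> exp (x / 2)" by simp
    then have "real t ^ (2 * Suc m * V) \<le> exp (x / 2)" using t0 by (simp only: exp_of_nat_mult exp_ln of_nat_0_less_iff)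
    then have "2 * real t ^ (2 * Suc m * V) \<le> exp (ln 2) * exp (x / 2)" by simp
    also have "\<dots> = exp (ln 2 + x / 2)" by (simp add: exp_add)
    also have "\<dots> < exp x" using e6 by (simp add: x_def)
    finally have "real (2 * t ^ (2 * Suc m * V)) < real p" by (simp add: px)
    then show ?thesis by (simp only: of_nat_less_iff)
  qed
  obtain P where P: "finite P" "card P \<le> m" "\<forall>q\<in>P. prime q"
     "inj_on (\<lambda>k. restrict (\<lambda>q. multiplicity q k) P) (Kset p t)"
    using Kset_pivots[OF p t tV small] by blast
  have "real (card (Kset p t)) \<le> real t powr (1 / l) * (\<Prod>q\<in>P. 1 / (1 - real q powr - (1 / l)))"
    using P e1 KsetD(1,2) by (intro card_le_prime_product) auto
  also have "real t powr (1 / l) = exp A" using t0 e1 by (simp add: powr_def A_def)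
  finally have N1: "real (card (Kset p t)) \<le> exp A * (\<Prod>q\<in>P. 1 / (1 - real q powr - (1 / l)))" .
  define f where "f q = 1 / (1 - real q powr - (1 / l))" for q :: nat
  have f: "0 \<le> f q \<and> f q \<le> 1 + l / ln (real q)" if "q \<in> P" for q
  proof -
    have q1: "real q > 1" using P(3) that prime_gt_1_nat by auto
    have y: "ln (real q) / l > 0" using q1 e1 by simp
    have eq: "f q = 1 / (1 - exp (- (ln (real q) / l)))" using q1 by (simp add: f_def powr_def)
    have "f q \<le> 1 + 1 / (ln (real q) / l)" unfolding eq by (rule geometric_factor_le[OF y])
    moreover have "f q \<ge> 0" unfolding eq using y by simp
    ultimately show ?thesis by simp
  qed
  \<comment> \<open>Small primes produce the large factors l / ln q, but at most sqrt A pivots can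
    be that small.\<close>
  define P1 where "P1 = {q \<in> P. real q \<le> sqrt A}"
  define P2 where "P2 = {q \<in> P. \<not> real q \<le> sqrt A}"
  define a where "a = ln A / l"
  have a0: "a > 0" unfolding a_def using A2 e1 by simp
  have a1: "a \<le> 1" unfolding a_def using lnA_hi e1 lnl by (simp add: pos_divide_le_eq)
  have P1: "(\<Prod>q\<in>P1. f q) \<le> exp (sqrt A * ln (3 * l))"
  proof (rule prod_le_exp_card)
    show "finite P1" using P by (simp add: P1_def)
    show "3 * l \<ge> 1" using e1 by simp
    have "P1 \<subseteq> {1..nat \<lfloor>sqrt A\<rfloor>}"
    proof
      fix q assume q: "q \<in> P1"
      then have "real q \<le> sqrt A" "q > 0" using P(3) prime_gt_0_nat by (auto simp: P1_def)
      then show "q \<in> {1..nat \<lfloor>sqrt A\<rfloor>}" by (simp add: le_nat_floor Suc_le_eq)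
    qed
    then have "card P1 \<le> card {1..nat \<lfloor>sqrt A\<rfloor>}" by (intro card_mono) auto
    then have "card P1 \<le> nat \<lfloor>sqrt A\<rfloor>" by simp
    then show "real (card P1) \<le> sqrt A" using A2 by (simp add: le_nat_iff le_floor_iff)
    fix q assume q: "q \<in> P1"
    then have qP: "q \<in> P" by (simp add: P1_def)
    have "real q \<ge> 2" using P(3) qP prime_ge_2_nat by force
    then have "ln (real q) \<ge> ln 2" by (intro ln_mono) auto
    moreover have "ln (2::real) \<ge> 1 / 2" using ln_le_minus_one[of "1 / 2 :: real"] by (simp add: ln_div)
    ultimately have "l / ln (real q) \<le> l / (1 / 2)" using e1 by (intro divide_left_mono) auto
    then have "l / ln (real q) \<le> 2 * l" by simp
    then show "0 \<le> f q \<and> f q \<le> 3 * l" using f[OF qP] e1 by auto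
  qed
  have P2: "(\<Prod>q\<in>P2. f q) \<le> exp (A / (1 - \<delta>) * ln (3 / a))"
  proof (rule prod_le_exp_card)
    show "finite P2" using P by (simp add: P2_def)
    show "3 / a \<ge> 1" using a0 a1 by simp
    have "card P2 \<le> card P" using P(1) by (intro card_mono) (auto simp: P2_def)
    then show "real (card P2) \<le> A / (1 - \<delta>)" using P(2) m_hi by linarith
    fix q assume q: "q \<in> P2"
    then have qP: "q \<in> P" by (simp add: P2_def)
    have "ln (sqrt A) \<le> ln (real q)" using q A2 by (intro ln_mono) (auto simp: P2_def)
    then have "ln (real q) \<ge> ln A / 2" using A2 by (simp add: ln_sqrt)
    moreover have "ln A > 0" using A2 by simp
    ultimately have "l / ln (real q) \<le> l / (ln A / 2)" using e1 by (intro divide_left_mono mult_pos_pos) auto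
    also have "\<dots> = 2 / a" by (simp add: a_def)
    finally have "f q \<le> 1 + 2 / a" using f[OF qP] by linarith
    also have "\<dots> \<le> 3 / a" using a0 a1 by (simp add: field_simps)
    finally show "0 \<le> f q \<and> f q \<le> 3 / a" using f[OF qP] by simp
  qed
  have Psplit: "(\<Prod>q\<in>P. f q) = (\<Prod>q\<in>P1. f q) * (\<Prod>q\<in>P2. f q)"
  proof -
    have "P = P1 \<union> P2" by (auto simp: P1_def P2_def)
    moreover have "(\<Prod>q\<in>P1 \<union> P2. f q) = (\<Prod>q\<in>P1. f q) * (\<Prod>q\<in>P2. f q)"
      using P(1) by (intro prod.union_disjoint) (auto simp: P1_def P2_def)
    ultimately show ?thesis by simp
  qed
  have "(\<Prod>q\<in>P. f q) \<le> exp (sqrt A * ln (3 * l)) * exp (A / (1 - \<delta>) * ln (3 / a))"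
    unfolding Psplit using P1 P2 f by (intro mult_mono prod_nonneg) (auto simp: P2_def)
  then have "exp A * (\<Prod>q\<in>P. f q) \<le> exp A * (exp (sqrt A * ln (3 * l)) * exp (A / (1 - \<delta>) * ln (3 / a)))"
    by (intro mult_left_mono) auto
  then have N2: "real (card (Kset p t)) \<le> exp (A + sqrt A * ln (3 * l) + A / (1 - \<delta>) * ln (3 / a))"
    using N1 unfolding f_def [symmetric] by (simp only: exp_add mult.assoc)
  have s1: "sqrt A * ln (3 * l) \<le> A"
  proof -
    have "(ln (3 * l))\<^sup>2 \<le> A" using e3 A0 by simp
    then have "ln (3 * l) \<le> sqrt A" by (rule real_le_rsqrt)
    then have "sqrt A * ln (3 * l) \<le> sqrt A * sqrt A" using A2 by (intro mult_left_mono) auto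
    then show ?thesis using A2 by simp
  qed
  have l3a: "ln (3 / a) \<ge> 0" using a0 a1 by simp
  \<comment> \<open>Dividing by 1 - \<delta> costs only O(A), since \<delta> is O(a) and a ln (3 /
    a) <= 3. The constant is 765 = 3 * 255 with 255 = 5/2 * 102.\<close>
  have s2: "A / (1 - \<delta>) * ln (3 / a) \<le> A * (ln (3 / a) + 765)"
  proof -
    have "1 / (1 - \<delta>) \<le> 1 + 5 / 2 * \<delta>"
    proof -
      have "\<delta> * \<delta> \<le> \<delta> * (6 / 10)" using \<delta>0 \<delta>6 by (intro mult_left_mono)
      then have "1 \<le> (1 + 5 / 2 * \<delta>) * (1 - \<delta>)" by (simp add: algebra_simps)
      then show ?thesis using \<delta>6 by (simp add: pos_divide_le_eq)
    qed
    also have "\<dots> \<le> 1 + 255 * a" using \<delta>a by (simp add: a_def)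
    finally have "1 / (1 - \<delta>) * ln (3 / a) \<le> (1 + 255 * a) * ln (3 / a)" using l3a by (intro mult_right_mono)
    also have "\<dots> = ln (3 / a) + 255 * (a * ln (3 / a))" by (simp add: algebra_simps)
    also have "a * ln (3 / a) \<le> a * (3 / a)" using a0 ln_le_minus_one[of "3 / a"] by (intro mult_left_mono) auto
    also have "a * (3 / a) = 3" using a0 by simp
    finally have "1 / (1 - \<delta>) * ln (3 / a) \<le> ln (3 / a) + 765" by simp
    then have "A * (1 / (1 - \<delta>) * ln (3 / a)) \<le> A * (ln (3 / a) + 765)" using A2 by (intro mult_left_mono) auto
    then show ?thesis by simp
  qed
  have s3: "ln (3 / a) \<le> ln 150 + ln l - ln (ln l)"
  proof -
    have "a \<ge> ln l / 50 / l" unfolding a_def using lnA_lo e1 by (intro divide_right_mono) auto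
    then have "3 / a \<le> 3 / (ln l / 50 / l)" using a0 lnl e1 by (intro divide_left_mono mult_pos_pos) auto
    also have "\<dots> = 150 * l / ln l" by simp
    finally have "ln (3 / a) \<le> ln (150 * l / ln l)" using a0 by (intro ln_mono) auto
    also have "\<dots> = ln 150 + ln l - ln (ln l)" using e1 lnl by (simp add: ln_div ln_mult)
    finally show ?thesis .
  qed
  have "A + sqrt A * ln (3 * l) + A / (1 - \<delta>) * ln (3 / a) \<le> A + A + A * (ln (3 / a) + 765)" using s1 s2 by linarith
  also have "\<dots> = A * (ln (3 / a) + 767)" by (simp add: algebra_simps)
  also have "\<dots> \<le> A * (lattice_const + ln l - ln (ln l))" using s3 A2 by (intro mult_left_mono) (auto simp: lattice_const_def)
  finally have "real (card (Kset p t)) \<le> exp (A * (lattice_const + ln l - ln (ln l)))" using N2 by (simp add: order_trans)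
  also have "\<dots> = real t powr ((lattice_const + ln l - ln (ln l)) / l)" using t0 by (simp add: powr_def A_def)
  finally show ?thesis .
qed

lemma Kset_lattice_bound:
  "\<forall>\<^sub>F l in at_top. \<forall>p t. prime p \<longrightarrow> ln (real p) = exp l \<longrightarrow> t dvd p - 1 \<longrightarrow>
    l powr (1 / 50) * l \<le> ln (real t) \<longrightarrow> ln (real t) \<le> exp (3 / 10 * l) \<longrightarrow>
    real (card (Kset p t)) \<le> real t powr ((lattice_const + ln l - ln (ln l)) / l)"
proof -
  have "\<forall>\<^sub>F l::real in at_top. l \<ge> 17" by real_asymp
  moreover have "\<forall>\<^sub>F l::real in at_top. ln (17 * l) \<le> 2 * ln l" by real_asymp
  moreover have "\<forall>\<^sub>F l::real in at_top. (ln (3 * l))\<^sup>2 \<le> l powr (1 / 50)" by real_asymp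
  moreover have "\<forall>\<^sub>F l::real in at_top. 2 \<le> l powr (1 / 50)" by real_asymp
  moreover have "\<forall>\<^sub>F l::real in at_top. 272 \<le> exp (2 / 5 * l) * l" by real_asymp
  moreover have "\<forall>\<^sub>F l::real in at_top. 2 * ln 2 < exp l" by real_asymp
  ultimately show ?thesis
    by eventually_elim (intro allI impI Kset_lattice_bound_aux)
qed

text \<open>The depth I is taken about as large as E^I ln t < ln p permits, that is, about l / ln E,
  and N(t)^I <= t gives the exponent 1 / I. Condition \<open>E2\<close> says that ln (2 B) and
  rounding lose at most half of it.\<close>

lemma Kset_digit_bound:
  fixes p t h E :: nat and l B :: real
  assumes p: "prime p" and lp: "ln (real p) = exp l" and t: "t dvd p - 1"
    and l: "l > 0" and B: "ln (real t) \<le> B" "B \<ge> 1"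
    and sep: "\<And>k k'. k \<in> Kset p t \<Longrightarrow> k' \<in> Kset p t \<Longrightarrow> k \<noteq> k' \<Longrightarrow> h \<le> max (k div gcd k k') (k' div gcd k k')"
    and h: "h \<ge> 2" and E: "E \<ge> 2" "t \<le> h ^ (E - 1)" and E2: "ln (2 * B) + ln (real E) \<le> l / 2"
  shows "real (card (Kset p t)) \<le> real t powr (2 * ln (real E) / l)"
proof -
  have p0: "real p > 0" using prime_gt_0_nat[OF p] by simp
  have t0: "t > 0" by (rule dvd_pred_prime(1)[OF p t])
  define x where "x = exp l"
  have px: "real p = exp x" using p0 lp by (simp add: x_def flip: lp)
  have lnE: "ln (real E) > 0" using E by simp
  define I where "I = nat \<lfloor>(l - ln (2 * B)) / ln (real E)\<rfloor>"
  have I_hi: "real I \<le> (l - ln (2 * B)) / ln (real E)"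
  proof -
    have "(l - ln (2 * B)) / ln (real E) \<ge> 0" using E2 lnE l by (intro divide_nonneg_pos) auto
    then show ?thesis unfolding I_def by linarith
  qed
  have I_lo: "real I > (l - ln (2 * B)) / ln (real E) - 1" unfolding I_def by linarith
  have I_lo2: "real I \<ge> l / (2 * ln (real E))"
  proof -
    have "(l - ln (2 * B)) / ln (real E) - 1 = (l - ln (2 * B) - ln (real E)) / ln (real E)"
      using lnE by (simp add: diff_divide_distrib)
    also have "\<dots> \<ge> (l / 2) / ln (real E)" using E2 lnE by (intro divide_right_mono) auto
    finally show ?thesis using I_lo by simp
  qed
  have I0: "I > 0"
  proof -
    have "l / (2 * ln (real E)) > 0" using l lnE by simp
    then have "real I > 0" using I_lo2 by linarith
    then show ?thesis by simp
  qed
  have EI: "real E ^ I \<le> x / (2 * B)"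
  proof -
    have "real I * ln (real E) \<le> l - ln (2 * B)" using I_hi lnE by (simp add: pos_le_divide_eq)
    then have "exp (real I * ln (real E)) \<le> exp (l - ln (2 * B))" by simp
    then show ?thesis using E B by (simp add: exp_of_nat_mult exp_diff x_def)
  qed
  have small: "t ^ (E ^ I) < p"
  proof -
    have "real (E ^ I) * ln (real t) \<le> (x / (2 * B)) * B"
      using EI B t0 by (intro mult_mono) (auto simp: x_def)
    also have "\<dots> = x / 2" using B by simp
    also have "\<dots> < x" by (simp add: x_def)
    finally have "exp (real (E ^ I) * ln (real t)) < exp x" by simp
    then have "real t ^ (E ^ I) < real p" using t0 by (simp only: exp_of_nat_mult exp_ln of_nat_0_less_iff px)
    then have "real (t ^ (E ^ I)) < real p" by (simp only: of_nat_power)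
    then show ?thesis by (simp only: of_nat_less_iff)
  qed
  have "card (Kset p t) ^ I \<le> t" by (rule Kset_card_power_le[OF p t sep h E small])
  then have NI: "real (card (Kset p t)) ^ I \<le> real t" by (simp only: of_nat_power [symmetric] of_nat_le_iff)
  show ?thesis
  proof (cases "card (Kset p t) = 0")
    case False
    then have N0: "real (card (Kset p t)) > 0" by linarith
    have "ln (real (card (Kset p t)) ^ I) \<le> ln (real t)" using NI N0 by (intro ln_mono) auto
    then have "real I * ln (real (card (Kset p t))) \<le> ln (real t)" using N0 by (simp add: ln_realpow)
    then have "ln (real (card (Kset p t))) \<le> ln (real t) / real I" using I0 by (simp add: pos_le_divide_eq mult.commute)
    also have "\<dots> \<le> ln (real t) / (l / (2 * ln (real E)))"
      using I_lo2 I0 l lnE t0 by (intro divide_left_mono mult_pos_pos) auto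
    also have "\<dots> = 2 * ln (real E) / l * ln (real t)" by simp
    finally have "exp (ln (real (card (Kset p t)))) \<le> exp (2 * ln (real E) / l * ln (real t))" by simp
    then show ?thesis using N0 t0 by (simp add: powr_def)
  qed simp
qed

section \<open>Large divisors\<close>

text \<open>Divided by t > p^(9/10), the equidistribution error is p^(1/100 + 3/4 - 9/10) =
  p^(-14/100) up to a constant, small enough to be summed over O(p^(1/100)) divisors. The main terms
  add up to at most (p - 1) / p.\<close>

lemma sum_top_range:
  "\<exists>C. \<forall>p. prime p \<longrightarrow> (\<Sum>t | t dvd p - 1 \<and> real p powr (9 / 10) < real t. real (card (Kset p t)) / real t) \<le> C"
proof -
  obtain C :: real where C: "C > 0" "\<And>n. n > 0 \<Longrightarrow> real (card {t. t dvd n}) \<le> C * real n powr (1 / 100)"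
    using divisor_count_bound by blast
  have "(\<Sum>t | t dvd p - 1 \<and> real p powr (9 / 10) < real t. real (card (Kset p t)) / real t) \<le> 1 + 3 * C\<^sup>2" if p: "prime p" for p
  proof -
    have n0: "p - 1 > 0" using prime_gt_1_nat[OF p] by simp
    have p1: "real p \<ge> 1" using n0 by simp
    define S where "S = {t. t dvd p - 1 \<and> real p powr (9 / 10) < real t}"
    have SD: "S \<subseteq> {t. t dvd p - 1}" by (auto simp: S_def)
    have finD: "finite {t. t dvd p - 1}" using n0 by simp
    have tau: "real (card {d. d dvd t}) \<le> C * real p powr (1 / 100)" if t: "t dvd p - 1" for t
    proof -
      have t0: "t > 0" "t \<le> p" using dvd_pred_prime[OF p t] by auto
      have "real (card {d. d dvd t}) \<le> C * real t powr (1 / 100)" using C(2) t0 by simp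
      also have "\<dots> \<le> C * real p powr (1 / 100)" using t0 C by (intro mult_left_mono powr_mono2) auto
      finally show ?thesis .
    qed
    have "(\<Sum>t\<in>S. real (card (Kset p t)) / real t) \<le> (\<Sum>t\<in>S. real (totient t) / real p + 3 * C * real p powr (- 14 / 100))"
    proof (rule sum_mono)
      fix t assume t: "t \<in> S"
      then have tn: "t dvd p - 1" and big: "real p powr (9 / 10) < real t" by (auto simp: S_def)
      have t0: "real t > 0" using dvd_pred_prime[OF p tn] by auto
      have "real (card (Kset p t)) \<le> real t * real (totient t) / real p + real (card {d. d dvd t}) * (3 * real p powr (3 / 4))"
        by (rule card_Kset_le_totient[OF p tn])
      also have "\<dots> \<le> real t * real (totient t) / real p + (C * real p powr (1 / 100)) * (3 * real p powr (3 / 4))"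
        using tau[OF tn] by (intro add_left_mono mult_right_mono) auto
      also have "(C * real p powr (1 / 100)) * (3 * real p powr (3 / 4)) = 3 * C * real p powr (- 14 / 100) * real p powr (9 / 10)"
        by (simp add: powr_add [symmetric])
      also have "\<dots> \<le> 3 * C * real p powr (- 14 / 100) * real t" using big C by (intro mult_left_mono) auto
      finally have "real (card (Kset p t)) / real t \<le> (real t * real (totient t) / real p + 3 * C * real p powr (- 14 / 100) * real t) / real t"
        using t0 by (simp add: divide_right_mono)
      also have "\<dots> = real (totient t) / real p + 3 * C * real p powr (- 14 / 100)" using t0 by (simp add: field_simps)
      finally show "real (card (Kset p t)) / real t \<le> real (totient t) / real p + 3 * C * real p powr (- 14 / 100)" .
    qed
    also have "\<dots> \<le> (\<Sum>t | t dvd p - 1. real (totient t) / real p + 3 * C * real p powr (- 14 / 100))"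
      using finD SD C by (intro sum_mono2) auto
    also have "\<dots> = (\<Sum>t | t dvd p - 1. real (totient t)) / real p + real (card {t. t dvd p - 1}) * (3 * C * real p powr (- 14 / 100))"
      by (simp add: sum.distrib sum_divide_distrib)
    also have "(\<Sum>t | t dvd p - 1. real (totient t)) = real (p - 1)"
      using totient_divisor_sum[of "p - 1"] by (metis of_nat_sum)
    also have "real (p - 1) / real p + real (card {t. t dvd p - 1}) * (3 * C * real p powr (- 14 / 100))
        \<le> 1 + (C * real p powr (1 / 100)) * (3 * C * real p powr (- 14 / 100))"
      using tau[of "p - 1"] C p1 by (intro add_mono mult_right_mono) auto
    also have "(C * real p powr (1 / 100)) * (3 * C * real p powr (- 14 / 100)) = 3 * C\<^sup>2 * real p powr (- 13 / 100)"
      by (simp add: powr_add [symmetric] power2_eq_square)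
    also have "\<dots> \<le> 3 * C\<^sup>2 * real p powr 0" using p1 C by (intro mult_left_mono powr_mono) auto
    finally show ?thesis unfolding S_def using p1 by simp
  qed
  then show ?thesis by blast
qed

lemma Kset_product_bound_real:
  assumes C: "C > 0" "\<And>n. n > 0 \<Longrightarrow> real (card {t. t dvd n}) \<le> C * real n powr (1 / 100)"
    and p: "prime p" and t: "t dvd p - 1"
  shows "real (card (Kset p t)) ^ v \<le> real t * (real t ^ v / real p + 1) * (C * real t powr (real v / 100)) ^ v"
proof -
  have t0: "t > 0" by (rule dvd_pred_prime(1)[OF p t])
  define y where "y = C * real t powr (real v / 100)"
  have y0: "y \<ge> 0" using C by (simp add: y_def)
  define D where "D = nat \<lfloor>y\<rfloor>"
  have "card (Kset p t) ^ v \<le> t * (t ^ v div p + 1) * D ^ v"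
  proof (rule Kset_product_bound[OF p t])
    fix X assume X: "0 < X" "X \<le> t ^ v"
    have "real (card {d. d dvd X}) \<le> C * real X powr (1 / 100)" using C X by simp
    also have "\<dots> \<le> C * real (t ^ v) powr (1 / 100)" using C X by (intro mult_left_mono powr_mono2) auto
    also have "\<dots> = y" using t0 by (simp add: y_def powr_realpow [symmetric] powr_powr)
    finally show "card {d. d dvd X} \<le> D" by (simp add: D_def le_nat_floor)
  qed
  then have "real (card (Kset p t) ^ v) \<le> real (t * (t ^ v div p + 1) * D ^ v)" by (simp only: of_nat_le_iff)
  also have "\<dots> = real t * (real (t ^ v div p) + 1) * real D ^ v" by (simp only: of_nat_mult of_nat_add of_nat_power of_nat_1)
  also have "\<dots> \<le> real t * (real t ^ v / real p + 1) * y ^ v"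
  proof (intro mult_mono add_mono power_mono)
    show "real (t ^ v div p) \<le> real t ^ v / real p" using of_nat_div_le_of_nat[of "t ^ v" p, where ?'a = real] by simp
    show "real D \<le> y" using y0 by (simp add: D_def)
  qed (use y0 in auto)
  finally show ?thesis by (simp add: y_def)
qed

text \<open>Products of two elements suffice: up to a constant, (N(t) / t)^2 is at most (t / p + 1 /
  t) t^(4/100), a negative power of p on this range.\<close>

lemma sum_middle_range:
  "\<exists>C. \<forall>p. prime p \<longrightarrow> (\<Sum>t | t dvd p - 1 \<and> real p powr (1 / 6) < real t \<and> real t \<le> real p powr (9 / 10). real (card (Kset p t)) / real t) \<le> C"
proof -
  obtain C :: real where C: "C > 0" "\<And>n. n > 0 \<Longrightarrow> real (card {t. t dvd n}) \<le> C * real n powr (1 / 100)"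
    using divisor_count_bound by blast
  have "(\<Sum>t | t dvd p - 1 \<and> real p powr (1 / 6) < real t \<and> real t \<le> real p powr (9 / 10). real (card (Kset p t)) / real t) \<le> 2 * C\<^sup>2" if p: "prime p" for p
  proof -
    have n0: "p - 1 > 0" using prime_gt_1_nat[OF p] by simp
    have p1: "real p \<ge> 1" using n0 by simp
    define S where "S = {t. t dvd p - 1 \<and> real p powr (1 / 6) < real t \<and> real t \<le> real p powr (9 / 10)}"
    have finD: "finite {t. t dvd p - 1}" using n0 by simp
    have each: "real (card (Kset p t)) / real t \<le> 2 * C * real p powr (- 3 / 100)" if t: "t \<in> S" for t
    proof -
      have tn: "t dvd p - 1" and lo: "real p powr (1 / 6) < real t" and hi: "real t \<le> real p powr (9 / 10)"
        using t by (auto simp: S_def)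
      have t0: "real t > 0" using dvd_pred_prime[OF p tn] by auto
      have 1: "real (card (Kset p t)) ^ 2 \<le> real t * (real t ^ 2 / real p + 1) * (C * real t powr (real 2 / 100)) ^ 2"
        by (rule Kset_product_bound_real[OF C p tn])
      have "(real (card (Kset p t)) / real t)\<^sup>2 = real (card (Kset p t)) ^ 2 / real t ^ 2" by (simp add: power_divide)
      also have "\<dots> \<le> (real t * (real t ^ 2 / real p + 1) * (C * real t powr (2 / 100)) ^ 2) / real t ^ 2"
        using 1 by (intro divide_right_mono) auto
      also have "\<dots> = (real t / real p + 1 / real t) * (C\<^sup>2 * real t powr (4 / 100))"
        using t0 p1 by (simp add: power_mult_distrib power2_eq_square powr_add [symmetric] field_simps)
      also have "\<dots> \<le> (real p powr (- 1 / 10) + real p powr (- 1 / 6)) * (C\<^sup>2 * real p powr (36 / 1000))"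
      proof (rule mult_mono)
        have "real t / real p \<le> real p powr (9 / 10) / real p powr 1" using hi p1 by (intro divide_mono) auto
        also have "\<dots> = real p powr (- 1 / 10)" by (simp only: powr_diff [symmetric]) simp
        finally have a: "real t / real p \<le> real p powr (- 1 / 10)" .
        have "1 / real t \<le> 1 / real p powr (1 / 6)" using lo p1 t0 by (intro divide_left_mono) auto
        also have "\<dots> = real p powr (- 1 / 6)" by (simp add: powr_minus_divide [symmetric])
        finally show "real t / real p + 1 / real t \<le> real p powr (- 1 / 10) + real p powr (- 1 / 6)" using a by linarith
        have "real t powr (4 / 100) \<le> (real p powr (9 / 10)) powr (4 / 100)" using hi t0 by (intro powr_mono2) auto
        then show "C\<^sup>2 * real t powr (4 / 100) \<le> C\<^sup>2 * real p powr (36 / 1000)" by (intro mult_left_mono) (auto simp: powr_powr)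
      qed auto
      also have "\<dots> \<le> (2 * real p powr (- 1 / 10)) * (C\<^sup>2 * real p powr (36 / 1000))"
      proof (rule mult_right_mono)
        have "real p powr (- 1 / 6) \<le> real p powr (- 1 / 10)" using p1 by (intro powr_mono) auto
        then show "real p powr (- 1 / 10) + real p powr (- 1 / 6) \<le> 2 * real p powr (- 1 / 10)" by simp
      qed simp
      also have "\<dots> = 2 * C\<^sup>2 * real p powr (- 64 / 1000)" by (simp add: powr_add [symmetric])
      also have "\<dots> \<le> 4 * C\<^sup>2 * real p powr (- 6 / 100)" using p1 C by (intro mult_mono powr_mono) auto
      also have "\<dots> = (2 * C * real p powr (- 3 / 100))\<^sup>2" by (simp add: power_mult_distrib power2_eq_square powr_add [symmetric])
      finally show ?thesis by (rule power2_le_imp_le) (use C in simp)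
    qed
    have "(\<Sum>t\<in>S. real (card (Kset p t)) / real t) \<le> (\<Sum>t\<in>S. 2 * C * real p powr (- 3 / 100))" using each by (rule sum_mono)
    also have "\<dots> = real (card S) * (2 * C * real p powr (- 3 / 100))" by simp
    also have "\<dots> \<le> (C * real p powr (1 / 100)) * (2 * C * real p powr (- 3 / 100))"
    proof (rule mult_right_mono)
      have "card S \<le> card {t. t dvd p - 1}" using finD by (intro card_mono) (auto simp: S_def)
      then have "real (card S) \<le> C * real (p - 1) powr (1 / 100)" using C(2)[OF n0] by linarith
      also have "\<dots> \<le> C * real p powr (1 / 100)" using C by (intro mult_left_mono powr_mono2) auto
      finally show "real (card S) \<le> C * real p powr (1 / 100)" .
    qed (use C in simp)
    also have "\<dots> = 2 * C\<^sup>2 * real p powr (- 2 / 100)" by (simp add: powr_add [symmetric] power2_eq_square)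
    also have "\<dots> \<le> 2 * C\<^sup>2 * real p powr 0" using p1 C by (intro mult_left_mono powr_mono) auto
    also have "\<dots> = 2 * C\<^sup>2" using p1 by simp
    finally show ?thesis unfolding S_def .
  qed
  then show ?thesis by blast
qed

text \<open>For t^6 <= p sixfold products do not exceed p, so N(t) = O(t^(23/100)), the exponent
  being 1/6 plus divisor losses. Rankin with shift 1/100 then meets a prime sum of order x^(24/100)
  ln x and gains x^(3/10) / 100, which is why the range starts at ln t = x^(3/10).\<close>

lemma sum_low_range:
  "\<exists>C x0. \<forall>p. prime p \<longrightarrow> ln (real p) \<ge> x0 \<longrightarrow> (\<Sum>t | t dvd p - 1 \<and> ln (real p) powr (3 / 10) < ln (real t) \<and> real t \<le> real p powr (1 / 6). real (card (Kset p t)) / real t) \<le> C"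
proof -
  obtain C :: real where C: "C > 0" "\<And>n. n > 0 \<Longrightarrow> real (card {t. t dvd n}) \<le> C * real n powr (1 / 100)"
    using divisor_count_bound by blast
  have "\<forall>\<^sub>F x in at_top. 4 * ((2 * x + 1) powr (24 / 100) * (2 + ln (2 * x + 1))) \<le> 1 / 100 * (x::real) powr (3 / 10)"
    by real_asymp
  then obtain x0 :: real where x0: "\<And>x. x \<ge> x0 \<Longrightarrow> 4 * ((2 * x + 1) powr (24 / 100) * (2 + ln (2 * x + 1))) \<le> 1 / 100 * x powr (3 / 10)"
    unfolding eventually_at_top_linorder by blast
  have "(\<Sum>t | t dvd p - 1 \<and> ln (real p) powr (3 / 10) < ln (real t) \<and> real t \<le> real p powr (1 / 6). real (card (Kset p t)) / real t) \<le> 2 * C"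
    if p: "prime p" and px: "ln (real p) \<ge> x0" for p
  proof -
    define x where "x = ln (real p)"
    have n0: "p - 1 > 0" using prime_gt_1_nat[OF p] by simp
    have p1: "real p \<ge> 1" using n0 by simp
    have xpos: "x \<ge> 0" using p1 by (simp add: x_def)
    define S where "S = {t. t dvd p - 1 \<and> ln (real p) powr (3 / 10) < ln (real t) \<and> real t \<le> real p powr (1 / 6)}"
    have finD: "finite {t. t dvd p - 1}" using n0 by simp
    have finS: "finite S" using finD by (rule rev_finite_subset) (auto simp: S_def)
    have each: "real (card (Kset p t)) / real t \<le> 2 * C * real t powr (23 / 100 - 1)" if t: "t \<in> S" for t
    proof -
      have tn: "t dvd p - 1" and hi: "real t \<le> real p powr (1 / 6)" using t by (auto simp: S_def)
      have t0: "real t > 0" using dvd_pred_prime[OF p tn] by auto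
      have t1: "real t \<ge> 1" using t0 by simp
      have "real t ^ 6 \<le> (real p powr (1 / 6)) ^ 6" using hi by (intro power_mono) auto
      also have "\<dots> = real p" using p1 by (simp add: powr_realpow [symmetric] powr_powr)
      finally have t6: "real t ^ 6 / real p \<le> 1" using p1 by simp
      have "real (card (Kset p t)) ^ 6 \<le> real t * (real t ^ 6 / real p + 1) * (C * real t powr (6 / 100)) ^ 6"
        using Kset_product_bound_real[OF C p tn, of 6] by simp
      also have "\<dots> \<le> real t * 2 * (C * real t powr (6 / 100)) ^ 6"
        using t6 C(1) by (intro mult_right_mono mult_left_mono) auto
      also have "\<dots> = 2 * C ^ 6 * (real t powr 1 * real t powr (36 / 100))"
        using t0 by (simp add: power_mult_distrib powr_power)
      also have "\<dots> = 2 * C ^ 6 * real t powr (136 / 100)" by (simp only: powr_add [symmetric]) simp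
      also have "\<dots> \<le> 64 * C ^ 6 * real t powr (138 / 100)" using t1 C by (intro mult_mono powr_mono) auto
      also have "\<dots> = (2 * C * real t powr (23 / 100)) ^ 6" using t0 by (simp add: power_mult_distrib powr_power)
      finally have "real (card (Kset p t)) \<le> 2 * C * real t powr (23 / 100)"
        using C by (subst (asm) power_mono_iff) auto
      then have "real (card (Kset p t)) / real t \<le> 2 * C * real t powr (23 / 100) / real t" using t0 by (simp add: divide_right_mono)
      also have "\<dots> = 2 * C * real t powr (23 / 100 - 1)" using t0 powr_diff[of "real t" "23 / 100" 1] by simp
      finally show ?thesis .
    qed
    have "ln (real (p - 1)) \<le> x" unfolding x_def using n0 by (intro ln_mono) auto
    then have sumQ: "(\<Sum>q\<in>prime_factors (p - 1). real q powr - (76 / 100)) \<le> (2 * x + 1) powr (24 / 100) * (2 + ln (2 * x + 1))"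
      using sum_prime_factors_le_ln[OF n0, of x "76 / 100"] by simp
    have "(\<Sum>t\<in>S. real (card (Kset p t)) / real t) \<le> (\<Sum>t\<in>S. 2 * C * real t powr (23 / 100 - 1))" using each by (rule sum_mono)
    also have "\<dots> = 2 * C * (\<Sum>t\<in>S. real t powr (23 / 100 - 1))" by (simp add: sum_distrib_left)
    also have "\<dots> \<le> 2 * C * 1"
    proof (rule mult_left_mono)
      have "(\<Sum>t\<in>S. real t powr (23 / 100 - 1)) \<le> exp (x powr (3 / 10)) powr - (1 / 100) * exp (4 * (\<Sum>q\<in>prime_factors (p - 1). real q powr (23 / 100 + 1 / 100 - 1)))"
      proof (rule rankin_bound[OF finS])
        fix t assume t: "t \<in> S"
        then have tn: "t dvd p - 1" by (simp add: S_def)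
        then have t0: "t > 0" using dvd_pred_prime[OF p] by auto
        have "exp (x powr (3 / 10)) \<le> exp (ln (real t))" using t by (simp add: S_def x_def)
        then show "t > 0 \<and> prime_factors t \<subseteq> prime_factors (p - 1) \<and> exp (x powr (3 / 10)) \<le> real t"
          using t0 tn n0 dvd_prime_factors[of "p - 1" t] by auto
      qed auto
      also have "\<dots> = exp (- (1 / 100 * x powr (3 / 10)) + 4 * (\<Sum>q\<in>prime_factors (p - 1). real q powr - (76 / 100)))"
        by (simp add: powr_def exp_add [symmetric])
      also have "\<dots> \<le> exp 0"
      proof -
        have "4 * (\<Sum>q\<in>prime_factors (p - 1). real q powr - (76 / 100)) \<le> 4 * ((2 * x + 1) powr (24 / 100) * (2 + ln (2 * x + 1)))"
          using sumQ by simp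
        also have "\<dots> \<le> 1 / 100 * x powr (3 / 10)" using px by (intro x0) (simp add: x_def)
        finally show ?thesis by simp
      qed
      finally show "(\<Sum>t\<in>S. real t powr (23 / 100 - 1)) \<le> 1" by simp
    qed (use C in simp)
    finally show ?thesis unfolding S_def by simp
  qed
  then show ?thesis by blast
qed

section \<open>Splitting by prime factors\<close>

text \<open>The two kinds of primes enter differently: those up to e^u carry the smaller weight exp
  ((\<eta> + \<theta>) u), while those from x^(1 - \<epsilon>) on are so few that 8 \<epsilon> + 13
  / l compensates exp ((\<eta> + \<theta>) l).\<close>

lemma rest_sum_le:
  fixes p :: nat and l u \<epsilon> \<eta> \<theta> T0 :: real
  assumes p: "prime p" and lp: "ln (real p) = exp l" and l: "exp l \<ge> 16"
    and fin: "finite S"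
    and S: "\<And>t. t \<in> S \<Longrightarrow> t dvd p - 1 \<and> T0 \<le> ln (real t)"
    and Sq: "\<And>t q. t \<in> S \<Longrightarrow> prime q \<Longrightarrow> q dvd t \<Longrightarrow> real q \<le> exp u \<or> exp ((1 - \<epsilon>) * l) \<le> real q"
    and u: "u \<ge> 1" and \<epsilon>: "0 \<le> \<epsilon>" "\<epsilon> \<le> 1 / 2" and e: "\<eta> \<ge> 0" "\<theta> \<ge> 0" "\<eta> + \<theta> \<le> 1 / 2"
  shows "(\<Sum>t\<in>S. real t powr (\<eta> - 1)) \<le>
    exp (- (\<theta> * T0) + 4 * (exp ((\<eta> + \<theta>) * u) * (2 + 2 * ln (u / ln 2)) + exp ((\<eta> + \<theta>) * l) * (8 * \<epsilon> + 13 / l)))"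
proof -
  have n0: "p - 1 > 0" using prime_gt_1_nat[OF p] by simp
  have p0: "real p > 0" using n0 by simp
  have px: "real p = exp (exp l)" using p0 lp by (metis exp_ln)
  define Q where "Q = {q \<in> prime_factors (p - 1). real q \<le> exp u \<or> exp ((1 - \<epsilon>) * l) \<le> real q}"
  define Q1 where "Q1 = {q \<in> Q. real q \<le> exp u}"
  define Q2 where "Q2 = {q \<in> Q. \<not> real q \<le> exp u}"
  have finQ: "finite Q" by (simp add: Q_def)
  have prQ: "prime q" if "q \<in> Q" for q using that by (auto simp: Q_def)
  have "(\<Sum>t\<in>S. real t powr (\<eta> - 1)) \<le> exp T0 powr - \<theta> * exp (4 * (\<Sum>q\<in>Q. real q powr (\<eta> + \<theta> - 1)))"
  proof (rule rankin_bound[OF fin finQ prQ])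
    fix t assume t: "t \<in> S"
    then have tn: "t dvd p - 1" using S by blast
    have t0: "t > 0" using dvd_pred_prime[OF p tn] by simp
    have "exp T0 \<le> exp (ln (real t))" using S[OF t] by simp
    then have 1: "exp T0 \<le> real t" using t0 by simp
    have 2: "prime_factors t \<subseteq> Q"
    proof
      fix q assume "q \<in> prime_factors t"
      then have q: "prime q" "q dvd t" by auto
      then have "q dvd p - 1" using tn dvd_trans by blast
      then show "q \<in> Q" using q Sq[OF t q] n0 by (simp add: Q_def prime_factors_dvd)
    qed
    show "t > 0 \<and> prime_factors t \<subseteq> Q \<and> exp T0 \<le> real t" using t0 1 2 by simp
  qed (use e in auto)
  also have "\<dots> = exp (- (\<theta> * T0) + 4 * (\<Sum>q\<in>Q. real q powr (\<eta> + \<theta> - 1)))"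
    by (simp add: powr_def exp_add [symmetric])
  also have "\<dots> \<le> exp (- (\<theta> * T0) + 4 * (exp ((\<eta> + \<theta>) * u) * (2 + 2 * ln (u / ln 2)) + exp ((\<eta> + \<theta>) * l) * (8 * \<epsilon> + 13 / l)))"
  proof -
    have "exp 1 \<le> exp u" using u by simp
    moreover have "(2::real) \<le> exp 1" using exp_ge_add_one_self[of "1::real"] by simp
    ultimately have u2: "exp u \<ge> 2" by linarith
    have "(\<Sum>q\<in>Q1. real q powr ((\<eta> + \<theta>) - 1)) \<le> exp u powr (\<eta> + \<theta>) * (2 + 2 * ln (log 2 (exp u)))"
      using finQ prQ u2 e by (intro sum_small_primes_le) (auto simp: Q1_def)
    also have "\<dots> = exp ((\<eta> + \<theta>) * u) * (2 + 2 * ln (u / ln 2))" by (simp add: powr_def log_def)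
    finally have 1: "(\<Sum>q\<in>Q1. real q powr ((\<eta> + \<theta>) - 1)) \<le> exp ((\<eta> + \<theta>) * u) * (2 + 2 * ln (u / ln 2))" .
    have "(\<Sum>q\<in>Q2. real q powr ((\<eta> + \<theta>) - 1)) \<le> exp l powr (\<eta> + \<theta>) * (8 * \<epsilon> + 13 / ln (exp l))"
    proof (rule sum_large_prime_factors_le[OF n0])
      show "real (p - 1) \<le> exp (exp l)" using px by simp
      fix q assume "q \<in> Q2"
      then show "exp l powr (1 - \<epsilon>) \<le> real q" by (auto simp: Q2_def Q_def powr_def)
    qed (use l e \<epsilon> in \<open>auto simp: Q2_def Q_def\<close>)
    then have 2: "(\<Sum>q\<in>Q2. real q powr ((\<eta> + \<theta>) - 1)) \<le> exp ((\<eta> + \<theta>) * l) * (8 * \<epsilon> + 13 / l)" by (simp add: powr_def)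
    have "Q = Q1 \<union> Q2" by (auto simp: Q1_def Q2_def)
    moreover have "(\<Sum>q\<in>Q1 \<union> Q2. real q powr (\<eta> + \<theta> - 1)) = (\<Sum>q\<in>Q1. real q powr (\<eta> + \<theta> - 1)) + (\<Sum>q\<in>Q2. real q powr (\<eta> + \<theta> - 1))"
      using finQ by (intro sum.union_disjoint) (auto simp: Q1_def Q2_def)
    ultimately show ?thesis using 1 2 by simp
  qed
  finally show ?thesis .
qed

text \<open>With T = exp (l^2 / 2) and m about l^2, a V of about x / (4 l^4) keeps 2 m V ln T at x /
  4 or less. Primes up to Y = x / l^5 then satisfy V >= 3 Y, so (V / Y)^m >= 3^m > T; this is the
  origin of the fifth power. Each cofactor has at most 11 l^4 prime extensions.\<close>

lemma sparse_sum_aux: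
  fixes p :: nat and l y :: real
  assumes e1: "l \<ge> 1" and e2: "exp l / (4 * (l\<^sup>2 + 1) * l\<^sup>2) - 1 \<ge> 3 * (exp l / l ^ 5)" and e3: "exp l > 2"
    and p: "prime p" and lp: "ln (real p) = exp l" and y: "y > 0" and fin: "finite S"
    and S: "\<And>t. t \<in> S \<Longrightarrow> t dvd p - 1 \<and> Kset p t \<noteq> {} \<and> ln (real t) \<le> l\<^sup>2 / 2 \<and>
       (\<exists>q. prime q \<and> q dvd t \<and> y \<le> real q \<and> real q \<le> exp l / l ^ 5)"
  shows "(\<Sum>t\<in>S. 1 / real t) \<le> 11 * l ^ 4 / y * (1 + l\<^sup>2 / 2)"
proof -
  have p0: "real p > 0" using prime_gt_0_nat[OF p] by simp
  have px: "real p = exp (exp l)" using p0 lp by (metis exp_ln)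
  define T where "T = nat \<lfloor>exp (l\<^sup>2 / 2)\<rfloor>"
  have T_le: "real T \<le> exp (l\<^sup>2 / 2)" by (simp add: T_def)
  have T1: "T \<ge> 1" by (simp add: T_def le_nat_iff)
  have tT: "t \<le> T" "t \<ge> 1" if "t \<in> S" for t
  proof -
    have t0: "t > 0" using dvd_pred_prime[OF p] S[OF that] by blast
    then show "t \<ge> 1" by simp
    have "exp (ln (real t)) \<le> exp (l\<^sup>2 / 2)" using S[OF that] by simp
    then show "t \<le> T" using t0 by (simp add: T_def le_nat_floor)
  qed
  define m where "m = nat \<lceil>l\<^sup>2\<rceil>"
  have l21: "l\<^sup>2 \<ge> 1" using e1 by simp
  have c0: "l\<^sup>2 + 1 > 0" "l\<^sup>2 > 0" using l21 by linarith+
  have m: "real m \<ge> l\<^sup>2" "real m < l\<^sup>2 + 1" unfolding m_def using l21 by linarith+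
  have m0: "m > 0" using m l21 by (cases m) auto
  define L where "L = m + 1"
  have TL: "T < 2 ^ L"
  proof -
    have "l\<^sup>2 / 2 < real L * (1 / 2)" using m by (simp add: L_def)
    also have "\<dots> \<le> real L * ln 2" using half_le_ln2 by (intro mult_left_mono) auto
    finally have "exp (l\<^sup>2 / 2) < exp (real L * ln 2)" by simp
    then have "exp (l\<^sup>2 / 2) < 2 ^ L" by (simp only: exp_of_nat_mult exp_ln zero_less_numeral)
    then have "real T < 2 ^ L" using T_le by linarith
    then have "real T < real (2 ^ L)" by (simp only: of_nat_power of_nat_numeral)
    then show ?thesis by (simp only: of_nat_less_iff)
  qed
  define V where "V = nat \<lfloor>exp l / (4 * (l\<^sup>2 + 1) * l\<^sup>2)\<rfloor>"
  define Y where "Y = nat \<lfloor>exp l / l ^ 5\<rfloor>"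
  have Y_le: "real Y \<le> exp l / l ^ 5" using e1 by (simp add: Y_def)
  have Vpos: "exp l / (4 * (l\<^sup>2 + 1) * l\<^sup>2) > 0" by (intro divide_pos_pos mult_pos_pos exp_gt_zero c0) simp
  have V_hi: "real V \<le> exp l / (4 * (l\<^sup>2 + 1) * l\<^sup>2)" using Vpos by (simp add: V_def)
  have V_lo: "real V \<ge> 3 * (exp l / l ^ 5)"
  proof -
    have "real V > exp l / (4 * (l\<^sup>2 + 1) * l\<^sup>2) - 1" unfolding V_def by linarith
    then show ?thesis using e2 by linarith
  qed
  have V0: "real V > 0"
  proof -
    have "3 * (exp l / l ^ 5) > 0" using e1 by simp
    then show ?thesis using V_lo by linarith
  qed
  have TYV: "T * Y ^ m < V ^ m"
  proof -
    have "real Y \<le> real V / 3" using Y_le V_lo by linarith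
    then have "real T * real Y ^ m \<le> exp (l\<^sup>2 / 2) * (real V / 3) ^ m"
      using T_le by (intro mult_mono power_mono) auto
    also have "\<dots> < exp (real m * 1) * (real V / 3) ^ m"
      using m l21 V0 by (intro mult_strict_right_mono) auto
    also have "\<dots> = (exp 1 * (real V / 3)) ^ m" by (simp only: exp_of_nat_mult power_mult_distrib)
    also have "\<dots> \<le> real V ^ m"
    proof (rule power_mono)
      have "exp 1 * (real V / 3) \<le> 3 * (real V / 3)" using exp_le by (intro mult_right_mono) auto
      then show "exp 1 * (real V / 3) \<le> real V" by simp
    qed simp
    finally have "real (T * Y ^ m) < real (V ^ m)" by simp
    then show ?thesis by (simp only: of_nat_less_iff)
  qed
  have small: "2 * T ^ (2 * m * V) < p"
  proof -
    have lT: "ln (real T) \<le> l\<^sup>2 / 2"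
    proof -
      have "ln (real T) \<le> ln (exp (l\<^sup>2 / 2))" using T_le T1 by (intro ln_mono) auto
      then show ?thesis by simp
    qed
    have "real (2 * m * V) * ln (real T) = 2 * (real m * real V) * ln (real T)" by simp
    also have "\<dots> \<le> 2 * ((l\<^sup>2 + 1) * (exp l / (4 * (l\<^sup>2 + 1) * l\<^sup>2))) * (l\<^sup>2 / 2)"
      using lT m V_hi T1 l21 by (intro mult_mono mult_left_mono) auto
    also have "\<dots> = exp l / 4"
    proof -
      have "2 * (a * (E / (4 * a * b))) * (b / 2) = E / 4" if "a > 0" "b > 0" for a b E :: real
        using that by (simp add: field_simps)
      then show ?thesis using c0 by blast
    qed
    finally have "exp (real (2 * m * V) * ln (real T)) \<le> exp (exp l / 4)" by simp
    then have "real T ^ (2 * m * V) \<le> exp (exp l / 4)" using T1 by (simp only: exp_of_nat_mult exp_ln of_nat_0_less_iff Suc_le_eq One_nat_def)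
    then have "2 * real T ^ (2 * m * V) \<le> exp (ln 2) * exp (exp l / 4)" by simp
    also have "\<dots> = exp (ln 2 + exp l / 4)" by (simp add: exp_add)
    also have "\<dots> < exp (exp l)"
    proof -
      have "ln (2::real) \<le> 1" using ln_le_minus_one[of "2::real"] by simp
      then show ?thesis using e3 by simp
    qed
    finally have "real (2 * T ^ (2 * m * V)) < real p" by (simp add: px)
    then show ?thesis by (simp only: of_nat_less_iff)
  qed
  have cnt: "real (L + m * (L + 1)) \<le> 11 * l ^ 4"
  proof -
    have "real (L + m * (L + 1)) = real m + 1 + real m * (real m + 2)" by (simp add: L_def algebra_simps)
    also have "\<dots> \<le> (l\<^sup>2 + 1) + 1 + (l\<^sup>2 + 1) * ((l\<^sup>2 + 1) + 2)" using m by (intro add_mono mult_mono) auto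
    also have "\<dots> = l ^ 4 + 5 * l\<^sup>2 + 5" by (simp add: algebra_simps power2_eq_square power4_eq_xxxx)
    also have "\<dots> \<le> l ^ 4 + 5 * l ^ 4 + 5 * l ^ 4"
      using e1 power_increasing[of 2 4 l] one_le_power[of l 4] by (intro add_mono mult_left_mono) auto
    finally show ?thesis by simp
  qed
  \<comment> \<open>One prime factor from the forbidden window is selected per t. Grouping by the
    cofactor g = t / q leaves at most 11 l^4 terms, each at most 1 / (g y), for every g.\<close>
  define qq where "qq t = (SOME q. prime q \<and> q dvd t \<and> y \<le> real q \<and> real q \<le> exp l / l ^ 5)" for t :: nat
  have qq: "prime (qq t) \<and> qq t dvd t \<and> y \<le> real (qq t) \<and> real (qq t) \<le> exp l / l ^ 5" if "t \<in> S" for t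
    unfolding qq_def using S[OF that] by (intro someI_ex[of "\<lambda>q. prime q \<and> q dvd t \<and> y \<le> real q \<and> real q \<le> exp l / l ^ 5"]) blast
  define gg where "gg t = t div qq t" for t
  have tg: "t = gg t * qq t" if "t \<in> S" for t using qq[OF that] by (simp add: gg_def)
  have gT: "gg t \<in> {1..T}" if "t \<in> S" for t
  proof -
    have "gg t \<noteq> 0" using tg[OF that] tT(2)[OF that] by (metis mult_0 not_one_le_zero)
    moreover have "gg t \<le> t" unfolding gg_def by simp
    ultimately show ?thesis using tT(1)[OF that] by simp
  qed
  have "(\<Sum>t\<in>S. 1 / real t) = (\<Sum>g\<in>{1..T}. \<Sum>t\<in>{t \<in> S. gg t = g}. 1 / real t)"
    using fin gT by (intro sum.group [symmetric]) auto
  also have "\<dots> \<le> (\<Sum>g\<in>{1..T}. (11 * l ^ 4 / y) * (1 / real g))"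
  proof (rule sum_mono)
    fix g assume g: "g \<in> {1..T}"
    define R where "R = {t \<in> S. gg t = g}"
    define Q where "Q = qq ` R"
    have finR: "finite R" using fin by (simp add: R_def)
    have "inj_on qq R" by (rule inj_onI) (metis (mono_tags, lifting) R_def mem_Collect_eq tg)
    then have cardR: "card R = card Q" by (simp add: Q_def card_image)
    have "card Q \<le> L + m * (L + 1)"
    proof (rule sparse_prime_extensions[OF p _ _ _ TL m0 TYV small, where g = g])
      show "finite Q" using finR by (simp add: Q_def)
      fix q assume "q \<in> Q"
      then obtain t where t: "t \<in> S" "gg t = g" "q = qq t" by (auto simp: Q_def R_def)
      have "g * q = t" using tg[OF t(1)] t by simp
      then show "prime q \<and> q \<le> Y \<and> g * q \<le> T \<and> g * q dvd p - 1 \<and> Kset p (g * q) \<noteq> {}"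
        using S[OF t(1)] qq[OF t(1)] t tT[OF t(1)] by (auto simp: Y_def le_nat_floor)
    qed (use g in auto)
    then have cR: "real (card R) \<le> 11 * l ^ 4" using cnt cardR by linarith
    have "(\<Sum>t\<in>R. 1 / real t) \<le> (\<Sum>t\<in>R. 1 / (real g * y))"
    proof (rule sum_mono)
      fix t assume t: "t \<in> R"
      then have tS: "t \<in> S" "gg t = g" by (auto simp: R_def)
      have "real t = real g * real (qq t)" using tg[OF tS(1)] tS(2) by (metis of_nat_mult)
      moreover have "real g * y \<le> real g * real (qq t)" using qq[OF tS(1)] by (intro mult_left_mono) auto
      ultimately show "1 / real t \<le> 1 / (real g * y)" using g y by (intro divide_left_mono mult_pos_pos) auto
    qed
    also have "\<dots> = real (card R) * (1 / (real g * y))" by simp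
    also have "\<dots> \<le> (11 * l ^ 4) * (1 / (real g * y))" using cR y by (intro mult_right_mono) auto
    also have "\<dots> = (11 * l ^ 4 / y) * (1 / real g)" by simp
    finally show "(\<Sum>t | t \<in> S \<and> gg t = g. 1 / real t) \<le> (11 * l ^ 4 / y) * (1 / real g)" by (simp add: R_def)
  qed
  also have "\<dots> = (11 * l ^ 4 / y) * (\<Sum>g\<in>{1..T}. 1 / real g)" by (simp only: sum_distrib_left)
  also have "\<dots> \<le> (11 * l ^ 4 / y) * (1 + l\<^sup>2 / 2)"
  proof (rule mult_left_mono)
    have "ln (real T) \<le> ln (exp (l\<^sup>2 / 2))" using T_le T1 by (intro ln_mono) auto
    then show "(\<Sum>g\<in>{1..T}. 1 / real g) \<le> 1 + l\<^sup>2 / 2" using harm_le[OF T1] by simp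
  qed (use e1 y in simp)
  finally show ?thesis .
qed

lemma sparse_sum:
  "\<forall>\<^sub>F l in at_top. \<forall>p y S. prime p \<longrightarrow> ln (real p) = exp l \<longrightarrow> y > 0 \<longrightarrow> finite S \<longrightarrow>
    (\<forall>t\<in>S. t dvd p - 1 \<and> Kset p t \<noteq> {} \<and> ln (real t) \<le> l\<^sup>2 / 2 \<and>
       (\<exists>q. prime q \<and> q dvd t \<and> y \<le> real q \<and> real q \<le> exp l / l ^ 5)) \<longrightarrow>
    (\<Sum>t\<in>S. 1 / real t) \<le> 11 * l ^ 4 / y * (1 + l\<^sup>2 / 2)"
proof -
  have "\<forall>\<^sub>F l::real in at_top. l \<ge> 1" by real_asymp
  moreover have "\<forall>\<^sub>F l::real in at_top. exp l / (4 * (l\<^sup>2 + 1) * l\<^sup>2) - 1 \<ge> 3 * (exp l / l ^ 5)" by real_asymp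
  moreover have "\<forall>\<^sub>F l::real in at_top. exp l > 2" by real_asymp
  ultimately show ?thesis
    by eventually_elim (intro allI impI, rule sparse_sum_aux, auto)
qed

lemma weight_le:
  assumes "prime p" "t dvd p - 1" "real (card (Kset p t)) \<le> real t powr \<eta>"
  shows "real (card (Kset p t)) / real t \<le> real t powr (\<eta> - 1)"
proof -
  have "real t > 0" using dvd_pred_prime[OF assms(1,2)] by simp
  then have "real (card (Kset p t)) / real t \<le> real t powr \<eta> / real t powr 1" using assms(3) by (simp add: divide_right_mono)
  then show ?thesis by (simp only: powr_diff)
qed

text \<open>The set is split according to whether t has a prime factor between e^u and x / l^5. With
  such a factor, the crude bound N(t) <= exp (Thi \<eta>) is played against the sparse sum
  (\<open>c1\<close>). The rest goes to Rankin (\<open>c2\<close>), where \<epsilon> = 5 ln l / l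
  because x^(1 - \<epsilon>) = x / l^5.\<close>

lemma sparse_or_rest_sum:
  fixes l u \<eta> \<theta> Tlo Thi :: real
  assumes sparse: "\<forall>p y S. prime p \<longrightarrow> ln (real p) = exp l \<longrightarrow> y > 0 \<longrightarrow> finite S \<longrightarrow>
    (\<forall>t\<in>S. t dvd p - 1 \<and> Kset p t \<noteq> {} \<and> ln (real t) \<le> l\<^sup>2 / 2 \<and>
       (\<exists>q. prime q \<and> q dvd t \<and> y \<le> real q \<and> real q \<le> exp l / l ^ 5)) \<longrightarrow>
    (\<Sum>t\<in>S. 1 / real t) \<le> 11 * l ^ 4 / y * (1 + l\<^sup>2 / 2)"
    and p: "prime p" and lp: "ln (real p) = exp l" and l: "exp l \<ge> 16" "l > 1" "5 * ln l / l \<le> 1 / 2"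
    and fin: "finite S"
    and S: "\<And>t. t \<in> S \<Longrightarrow> t dvd p - 1 \<and> Kset p t \<noteq> {} \<and> Tlo \<le> ln (real t) \<and> ln (real t) \<le> Thi \<and> real (card (Kset p t)) \<le> real t powr \<eta>"
    and Thi: "Thi \<le> l\<^sup>2 / 2"
    and u: "u \<ge> 1" and e: "\<eta> \<ge> 0" "\<theta> \<ge> 0" "\<eta> + \<theta> \<le> 1 / 2"
    and c1: "exp (Thi * \<eta>) * (11 * l ^ 4 / exp u * (1 + l\<^sup>2 / 2)) \<le> 1"
    and c2: "- (\<theta> * Tlo) + 4 * (exp ((\<eta> + \<theta>) * u) * (2 + 2 * ln (u / ln 2)) + exp ((\<eta> + \<theta>) * l) * (8 * (5 * ln l / l) + 13 / l)) \<le> 0"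
  shows "(\<Sum>t\<in>S. real (card (Kset p t)) / real t) \<le> 2"
proof -
  define A where "A = {t \<in> S. \<exists>q. prime q \<and> q dvd t \<and> exp u \<le> real q \<and> real q \<le> exp l / l ^ 5}"
  define B where "B = {t \<in> S. \<not> (\<exists>q. prime q \<and> q dvd t \<and> exp u \<le> real q \<and> real q \<le> exp l / l ^ 5)}"
  have finAB: "finite A" "finite B" using fin by (auto simp: A_def B_def)
  have t0: "real t > 0" if "t \<in> S" for t using dvd_pred_prime[OF p] S[OF that] by auto
  have "(\<Sum>t\<in>A. real (card (Kset p t)) / real t) \<le> (\<Sum>t\<in>A. exp (Thi * \<eta>) * (1 / real t))"
  proof (rule sum_mono)
    fix t assume "t \<in> A"
    then have t: "t \<in> S" by (simp add: A_def)
    have "real (card (Kset p t)) \<le> real t powr \<eta>" using S[OF t] by simp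
    also have "\<dots> = exp (\<eta> * ln (real t))" using t0[OF t] by (simp add: powr_def)
    also have "\<dots> \<le> exp (Thi * \<eta>)"
    proof -
      have "\<eta> * ln (real t) \<le> \<eta> * Thi" using S[OF t] e by (intro mult_left_mono) auto
      then show ?thesis by (simp add: mult.commute)
    qed
    finally show "real (card (Kset p t)) / real t \<le> exp (Thi * \<eta>) * (1 / real t)" using t0[OF t] by (simp add: divide_right_mono)
  qed
  also have "\<dots> = exp (Thi * \<eta>) * (\<Sum>t\<in>A. 1 / real t)" by (simp only: sum_distrib_left)
  also have "\<dots> \<le> exp (Thi * \<eta>) * (11 * l ^ 4 / exp u * (1 + l\<^sup>2 / 2))"
  proof (rule mult_left_mono)
    have "\<forall>t\<in>A. t dvd p - 1 \<and> Kset p t \<noteq> {} \<and> ln (real t) \<le> l\<^sup>2 / 2 \<and>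
       (\<exists>q. prime q \<and> q dvd t \<and> exp u \<le> real q \<and> real q \<le> exp l / l ^ 5)"
    proof
      fix t assume t: "t \<in> A"
      then have tS: "t \<in> S" "\<exists>q. prime q \<and> q dvd t \<and> exp u \<le> real q \<and> real q \<le> exp l / l ^ 5" by (auto simp: A_def)
      have "ln (real t) \<le> l\<^sup>2 / 2" using S[OF tS(1)] Thi by linarith
      then show "t dvd p - 1 \<and> Kset p t \<noteq> {} \<and> ln (real t) \<le> l\<^sup>2 / 2 \<and>
        (\<exists>q. prime q \<and> q dvd t \<and> exp u \<le> real q \<and> real q \<le> exp l / l ^ 5)"
        using S[OF tS(1)] tS(2) by blast
    qed
    then show "(\<Sum>t\<in>A. 1 / real t) \<le> 11 * l ^ 4 / exp u * (1 + l\<^sup>2 / 2)"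
      using sparse p lp finAB(1) exp_gt_zero[of u] by blast
  qed simp
  also have "\<dots> \<le> 1" by (rule c1)
  finally have 1: "(\<Sum>t\<in>A. real (card (Kset p t)) / real t) \<le> 1" .
  have "(\<Sum>t\<in>B. real (card (Kset p t)) / real t) \<le> (\<Sum>t\<in>B. real t powr (\<eta> - 1))"
    using S p by (intro sum_mono weight_le) (auto simp: B_def)
  also have "\<dots> \<le> exp (- (\<theta> * Tlo) + 4 * (exp ((\<eta> + \<theta>) * u) * (2 + 2 * ln (u / ln 2)) + exp ((\<eta> + \<theta>) * l) * (8 * (5 * ln l / l) + 13 / l)))"
  proof (rule rest_sum_le[OF p lp l(1) finAB(2)])
    fix t q assume t: "t \<in> B" and q: "prime q" "q dvd t"
    have "exp ((1 - 5 * ln l / l) * l) = exp (l - 5 * ln l)" using l by (simp add: field_simps)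
    also have "\<dots> = exp l / exp (real 5 * ln l)" by (simp add: exp_diff)
    also have "\<dots> = exp l / l ^ 5" using l by (simp only: exp_of_nat_mult) simp
    finally have eq: "exp ((1 - 5 * ln l / l) * l) = exp l / l ^ 5" .
    have "\<not> (exp u \<le> real q \<and> real q \<le> exp l / l ^ 5)" using t q unfolding B_def by blast
    then show "real q \<le> exp u \<or> exp ((1 - 5 * ln l / l) * l) \<le> real q"
      unfolding eq by linarith
  qed (use S u e l in \<open>auto simp: B_def\<close>)
  also have "\<dots> \<le> exp 0" using c2 by (simp only: exp_le_cancel_iff)
  finally have 2: "(\<Sum>t\<in>B. real (card (Kset p t)) / real t) \<le> 1" by simp
  have "S = A \<union> B" by (auto simp: A_def B_def)
  moreover have "(\<Sum>t\<in>A \<union> B. real (card (Kset p t)) / real t) = (\<Sum>t\<in>A. real (card (Kset p t)) / real t) + (\<Sum>t\<in>B. real (card (Kset p t)) / real t)"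
    using finAB by (intro sum.union_disjoint) (auto simp: A_def B_def)
  ultimately show ?thesis using 1 2 by simp
qed

section \<open>Summation over all divisors\<close>

abbreviation wt :: "nat \<Rightarrow> nat \<Rightarrow> real" where
  "wt p t \<equiv> real (card (Kset p t)) / real t"

text \<open>Empty sets have weight 0; dropping them supplies the nonemptiness that the sparseness
  bound asks for.\<close>

lemma sum_nonempty_Kset:
  assumes "prime p"
  shows "(\<Sum>t | t dvd p - 1 \<and> P t. wt p t) = (\<Sum>t | t dvd p - 1 \<and> P t \<and> Kset p t \<noteq> {}. wt p t)"
    and "finite {t. t dvd p - 1 \<and> P t \<and> Kset p t \<noteq> {}}"
proof -
  have fin: "finite {t. t dvd p - 1}" using prime_gt_1_nat[OF assms] by simp
  show "finite {t. t dvd p - 1 \<and> P t \<and> Kset p t \<noteq> {}}" by (rule finite_subset[OF _ fin]) auto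
  show "(\<Sum>t | t dvd p - 1 \<and> P t. wt p t) = (\<Sum>t | t dvd p - 1 \<and> P t \<and> Kset p t \<noteq> {}. wt p t)"
    by (rule sum.mono_neutral_right) (auto intro: finite_subset[OF _ fin])
qed

text \<open>For t up to x^(9/10) the product t ln t is o(x), so 2 t^(2 (t + 1)) < p and only t = 1
  survives.\<close>

lemma sum_tiny_range:
  "\<forall>\<^sub>F l in at_top. \<forall>p. prime p \<longrightarrow> ln (real p) = exp l \<longrightarrow>
    (\<Sum>t | t dvd p - 1 \<and> ln (real t) < 9 / 10 * l. wt p t) \<le> 1"
proof -
  have "\<forall>\<^sub>F l::real in at_top. ln 2 + 2 * (exp (9 / 10 * l) + 1) * (9 / 10 * l) < exp l" by real_asymp
  then show ?thesis
  proof eventually_elim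
    case (elim l)
    show ?case
    proof (intro allI impI)
      fix p :: nat assume p: "prime p" and lp: "ln (real p) = exp l"
      have p0: "real p > 0" using prime_gt_0_nat[OF p] by simp
      have px: "real p = exp (exp l)" using p0 lp by (metis exp_ln)
      have "{t. t dvd p - 1 \<and> ln (real t) < 9 / 10 * l \<and> Kset p t \<noteq> {}} \<subseteq> {1}"
      proof
        fix t assume "t \<in> {t. t dvd p - 1 \<and> ln (real t) < 9 / 10 * l \<and> Kset p t \<noteq> {}}"
        then have t: "t dvd p - 1" "ln (real t) < 9 / 10 * l" "Kset p t \<noteq> {}" by auto
        have t0: "t > 0" using dvd_pred_prime[OF p t(1)] by simp
        have "t = 1"
        proof (rule ccontr)
          assume "t \<noteq> 1"
          then have t1: "t > 1" using t0 by simp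
          have te: "real t \<le> exp (9 / 10 * l)" using t(2) t0 by (metis exp_less_cancel_iff exp_ln less_eq_real_def of_nat_0_less_iff)
          have lt: "ln (real t) \<ge> 0" using t0 by simp
          have "real (2 * (t + 1)) * ln (real t) = 2 * (real t + 1) * ln (real t)" by simp
          also have "\<dots> \<le> 2 * (exp (9 / 10 * l) + 1) * (9 / 10 * l)"
            using te t(2) lt by (intro mult_mono) auto
          finally have "ln 2 + real (2 * (t + 1)) * ln (real t) < exp l" using elim by linarith
          then have "exp (ln 2 + real (2 * (t + 1)) * ln (real t)) < exp (exp l)" by simp
          then have "2 * real t ^ (2 * (t + 1)) < real p" using t0
            by (simp only: exp_add exp_of_nat_mult exp_ln of_nat_0_less_iff px zero_less_numeral)
          then have "real (2 * t ^ (2 * (t + 1))) < real p" by (simp only: of_nat_mult of_nat_power of_nat_numeral)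
          then have "2 * t ^ (2 * (t + 1)) < p" by (simp only: of_nat_less_iff)
          then show False using Kset_empty_if_small[OF p t(1) t1] t(3) by blast
        qed
        then show "t \<in> {1}" by simp
      qed
      then have "(\<Sum>t | t dvd p - 1 \<and> ln (real t) < 9 / 10 * l \<and> Kset p t \<noteq> {}. wt p t) \<le> (\<Sum>t\<in>{1}. wt p t)"
        by (intro sum_mono2) auto
      also have "\<dots> \<le> 1"
      proof -
        have "card (Kset p 1) \<le> card {1..1::nat}" by (intro card_mono) (auto simp: Kset_def)
        then show ?thesis by simp
      qed
      finally show "(\<Sum>t | t dvd p - 1 \<and> ln (real t) < 9 / 10 * l. wt p t) \<le> 1"
        using sum_nonempty_Kset(1)[OF p, of "\<lambda>t. ln (real t) < 9 / 10 * l"] by simp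
    qed
  qed
qed

text \<open>The upper limit keeps t^\<eta> at about exp (l / 400) or less, which the divisor e^u =
  exp (l / 100) of the sparse sum beats. In Rankin, \<theta> = 1 / l changes x^\<eta> only by the
  factor e and gains l^(1/50). The small primes cost about (l / ln l)^(1/100) times ln l. The large
  ones cost O(1), as x^\<eta> = O(l / ln l) meets a prime sum O(ln l / l).\<close>

lemma sum_second_log_range:
  "\<forall>\<^sub>F l in at_top. \<forall>p. prime p \<longrightarrow> ln (real p) = exp l \<longrightarrow>
    (\<Sum>t | t dvd p - 1 \<and> (l powr (1 / 50) * l < ln (real t) \<and> ln (real t) \<le> l / (400 * ln l) * l). wt p t) \<le> 2"
proof -
  define c where "c = lattice_const"
  have "\<forall>\<^sub>F l::real in at_top. exp (l / (400 * ln l) * (c + ln l - ln (ln l))) * (11 * l ^ 4 / exp (l / 100) * (1 + l\<^sup>2 / 2)) \<le> 1"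
    by real_asymp
  moreover have "\<forall>\<^sub>F l::real in at_top. - (l powr (1 / 50)) + 4 * (exp ((c + 1 + ln l - ln (ln l)) / 100) * (2 + 2 * ln (l / 100 / ln 2)) + exp (c + 1 + ln l - ln (ln l)) * (8 * (5 * ln l / l) + 13 / l)) \<le> 0"
    by real_asymp
  moreover have "\<forall>\<^sub>F l::real in at_top. exp l \<ge> 16" by real_asymp
  moreover have "\<forall>\<^sub>F l::real in at_top. l \<ge> 100" by real_asymp
  moreover have "\<forall>\<^sub>F l::real in at_top. 5 * ln l / l \<le> 1 / 2" by real_asymp
  moreover have "\<forall>\<^sub>F l::real in at_top. l / (400 * ln l) * l \<le> l\<^sup>2 / 2" by real_asymp
  moreover have "\<forall>\<^sub>F l::real in at_top. l / (400 * ln l) * l \<le> exp (3 / 10 * l)" by real_asymp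
  moreover have "\<forall>\<^sub>F l::real in at_top. c + ln l - ln (ln l) \<ge> 0" by real_asymp
  moreover have "\<forall>\<^sub>F l::real in at_top. (c + ln l - ln (ln l)) / l + 1 / l \<le> 1 / 2" by real_asymp
  ultimately show ?thesis using sparse_sum Kset_lattice_bound
  proof eventually_elim
    case (elim l)
    show ?case
    proof (intro allI impI)
      fix p :: nat assume p: "prime p" and lp: "ln (real p) = exp l"
      define \<eta> where "\<eta> = (c + ln l - ln (ln l)) / l"
      have l0: "l > 0" using elim(4) by simp
      have \<eta>l: "\<eta> * l = c + ln l - ln (ln l)" using l0 by (simp add: \<eta>_def)
      define S where "S = {t. t dvd p - 1 \<and> (l powr (1 / 50) * l < ln (real t) \<and> ln (real t) \<le> l / (400 * ln l) * l) \<and> Kset p t \<noteq> {}}"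
      have "(\<Sum>t\<in>S. wt p t) \<le> 2"
      proof (rule sparse_or_rest_sum[where Tlo = "l powr (1 / 50) * l" and Thi = "l / (400 * ln l) * l" and \<eta> = \<eta> and \<theta> = "1 / l" and u = "l / 100" and l = l, OF elim(10) p lp elim(3) _ elim(5) _ _ elim(6)])
        show "finite S" unfolding S_def by (rule sum_nonempty_Kset(2)[OF p])
        show "1 < l" using elim(4) by simp
        show "1 \<le> l / 100" using elim(4) by simp
        show "0 \<le> 1 / l" using l0 by simp
        show "0 \<le> \<eta>" unfolding \<eta>_def using elim(8) l0 by simp
        show "\<eta> + 1 / l \<le> 1 / 2" unfolding \<eta>_def by (rule elim(9))
        have "l / (400 * ln l) * l * \<eta> = l / (400 * ln l) * (c + ln l - ln (ln l))" unfolding \<eta>l [symmetric] by (simp only: mult.assoc mult.commute mult.left_commute)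
        then show "exp (l / (400 * ln l) * l * \<eta>) * (11 * l ^ 4 / exp (l / 100) * (1 + l\<^sup>2 / 2)) \<le> 1" using elim(1) by (simp only:)
        have \<eta>1: "1 / l * (l powr (1 / 50) * l) = l powr (1 / 50)" using l0 by simp
        have "(\<eta> + 1 / l) * (l / 100) = (c + 1 + ln l - ln (ln l)) / 100" "(\<eta> + 1 / l) * l = c + 1 + ln l - ln (ln l)"
          using \<eta>l l0 by (simp_all add: distrib_right)
        then show "- (1 / l * (l powr (1 / 50) * l)) + 4 * (exp ((\<eta> + 1 / l) * (l / 100)) * (2 + 2 * ln (l / 100 / ln 2)) + exp ((\<eta> + 1 / l) * l) * (8 * (5 * ln l / l) + 13 / l)) \<le> 0"
          using elim(2) unfolding \<eta>1 by (simp only:)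
        fix t assume t: "t \<in> S"
        then have t': "t dvd p - 1" "l powr (1 / 50) * l \<le> ln (real t)" "ln (real t) \<le> l / (400 * ln l) * l" "Kset p t \<noteq> {}"
          by (auto simp: S_def)
        have "ln (real t) \<le> exp (3 / 10 * l)" using t'(3) elim(7) by linarith
        then have "real (card (Kset p t)) \<le> real t powr \<eta>"
          unfolding \<eta>_def c_def using elim(11) p lp t'(1,2) by blast
        then show "t dvd p - 1 \<and> Kset p t \<noteq> {} \<and> l powr (1 / 50) * l \<le> ln (real t) \<and> ln (real t) \<le> l / (400 * ln l) * l \<and> real (card (Kset p t)) \<le> real t powr \<eta>"
          using t' by simp
      qed
      then show "(\<Sum>t | t dvd p - 1 \<and> (l powr (1 / 50) * l < ln (real t) \<and> ln (real t) \<le> l / (400 * ln l) * l). wt p t) \<le> 2"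
        unfolding S_def by (subst sum_nonempty_Kset(1)[OF p])
    qed
  qed
qed

text \<open>With u = (1 - \<epsilon>) l the two classes of primes cover everything, so no t is
  excluded. The value \<epsilon> = 1 / sqrt (ln l) is large enough for the small primes to save
  about exp (- sqrt (ln l)), and small enough for the large ones to save 8 / sqrt (ln l). Both costs
  are then o(l / ln l), below the gain l / (400 ln l) from \<theta> = 1 / l.\<close>

lemma sum_subexponential_range:
  "\<forall>\<^sub>F l in at_top. \<forall>p. prime p \<longrightarrow> ln (real p) = exp l \<longrightarrow>
    (\<Sum>t | t dvd p - 1 \<and> (l / (400 * ln l) * l < ln (real t) \<and> ln (real t) \<le> exp (3 / 10 * l)). wt p t) \<le> 1"
proof -
  define c where "c = lattice_const"
  have "\<forall>\<^sub>F l::real in at_top. - (l / (400 * ln l)) + 4 * (exp (((c + ln l - ln (ln l)) / l + 1 / l) * ((1 - 1 / sqrt (ln l)) * l)) * (2 + 2 * ln ((1 - 1 / sqrt (ln l)) * l / ln 2)) + exp (((c + ln l - ln (ln l)) / l + 1 / l) * l) * (8 * (1 / sqrt (ln l)) + 13 / l)) \<le> 0"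
    by real_asymp
  moreover have "\<forall>\<^sub>F l::real in at_top. exp l \<ge> 16" by real_asymp
  moreover have "\<forall>\<^sub>F l::real in at_top. l \<ge> 100" by real_asymp
  moreover have "\<forall>\<^sub>F l::real in at_top. l powr (1 / 50) * l \<le> l / (400 * ln l) * l" by real_asymp
  moreover have "\<forall>\<^sub>F l::real in at_top. c + ln l - ln (ln l) \<ge> 0" by real_asymp
  moreover have "\<forall>\<^sub>F l::real in at_top. (c + ln l - ln (ln l)) / l + 1 / l \<le> 1 / 2" by real_asymp
  moreover have "\<forall>\<^sub>F l::real in at_top. (1 - 1 / sqrt (ln l)) * l \<ge> 1" by real_asymp
  moreover have "\<forall>\<^sub>F l::real in at_top. 1 / sqrt (ln l) \<ge> 0" by real_asymp
  moreover have "\<forall>\<^sub>F l::real in at_top. 1 / sqrt (ln l) \<le> 1 / 2" by real_asymp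
  ultimately show ?thesis using Kset_lattice_bound
  proof eventually_elim
    case (elim l)
    show ?case
    proof (intro allI impI)
      fix p :: nat assume p: "prime p" and lp: "ln (real p) = exp l"
      define \<eta> where "\<eta> = (c + ln l - ln (ln l)) / l"
      have l0: "l > 0" using elim(3) by simp
      define S where "S = {t. t dvd p - 1 \<and> (l / (400 * ln l) * l < ln (real t) \<and> ln (real t) \<le> exp (3 / 10 * l)) \<and> Kset p t \<noteq> {}}"
      have finS: "finite S" unfolding S_def by (rule sum_nonempty_Kset(2)[OF p])
      have S: "t dvd p - 1 \<and> l / (400 * ln l) * l \<le> ln (real t) \<and> real (card (Kset p t)) \<le> real t powr \<eta>" if "t \<in> S" for t
      proof -
        have t: "t dvd p - 1" "l / (400 * ln l) * l \<le> ln (real t)" "ln (real t) \<le> exp (3 / 10 * l)" using that by (auto simp: S_def)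
        have "l powr (1 / 50) * l \<le> ln (real t)" using t(2) elim(4) by linarith
        then have "real (card (Kset p t)) \<le> real t powr \<eta>"
          unfolding \<eta>_def c_def using elim(10) p lp t(1,3) by blast
        then show ?thesis using t by simp
      qed
      have "(\<Sum>t\<in>S. wt p t) \<le> (\<Sum>t\<in>S. real t powr (\<eta> - 1))"
        using S p by (intro sum_mono weight_le) auto
      also have "\<dots> \<le> exp (- (1 / l * (l / (400 * ln l) * l)) + 4 * (exp ((\<eta> + 1 / l) * ((1 - 1 / sqrt (ln l)) * l)) * (2 + 2 * ln ((1 - 1 / sqrt (ln l)) * l / ln 2)) + exp ((\<eta> + 1 / l) * l) * (8 * (1 / sqrt (ln l)) + 13 / l)))"
      proof (rule rest_sum_le[OF p lp elim(2) finS])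
        show "1 \<le> (1 - 1 / sqrt (ln l)) * l" by (rule elim(7))
        show "0 \<le> 1 / sqrt (ln l)" by (rule elim(8))
        show "1 / sqrt (ln l) \<le> 1 / 2" by (rule elim(9))
        show "\<eta> + 1 / l \<le> 1 / 2" unfolding \<eta>_def by (rule elim(6))
        show "0 \<le> \<eta>" unfolding \<eta>_def using elim(5) l0 by simp
        show "0 \<le> 1 / l" using l0 by simp
        show "\<And>t q. t \<in> S \<Longrightarrow> prime q \<Longrightarrow> q dvd t \<Longrightarrow> real q \<le> exp ((1 - 1 / sqrt (ln l)) * l) \<or> exp ((1 - 1 / sqrt (ln l)) * l) \<le> real q"
          by (rule linear)
        show "\<And>t. t \<in> S \<Longrightarrow> t dvd p - 1 \<and> l / (400 * ln l) * l \<le> ln (real t)" using S by blast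
      qed
      also have "\<dots> \<le> exp 0"
      proof -
        have "1 / l * (l / (400 * ln l) * l) = l / (400 * ln l)" using l0 by simp
        then show ?thesis using elim(1) unfolding \<eta>_def exp_le_cancel_iff by (simp only:)
      qed
      finally have "(\<Sum>t\<in>S. wt p t) \<le> 1" by simp
      then show "(\<Sum>t | t dvd p - 1 \<and> (l / (400 * ln l) * l < ln (real t) \<and> ln (real t) \<le> exp (3 / 10 * l)). wt p t) \<le> 1"
        unfolding S_def by (subst sum_nonempty_Kset(1)[OF p])
    qed
  qed
qed

text \<open>Here ln t / l may be bounded, where the pivot bound saves nothing. The digit bound with
  E about 4 l^(1/50) gives x^\<eta> = O(l^(1/25)) instead, but requires all ratios to have height at
  least h, about x^(1/4). The reciprocals of the t violating this sum to x^(-1/2) up to smaller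
  factors, from h^2 / x, which absorbs the crude bound obtained with h = 2. For the others \<theta>
  = ln l / (2 l) gains 0.45 ln l. With u = l^(3/100) the small primes cost about 8 * 0.03 ln l =
  0.24 ln l, and the large ones o(1). The sparse sum needs u to outgrow l^(1/50) ln l, which it
  does.\<close>

lemma sum_first_log_range:
  "\<forall>\<^sub>F l in at_top. \<forall>p. prime p \<longrightarrow> ln (real p) = exp l \<longrightarrow>
    (\<Sum>t | t dvd p - 1 \<and> (9 / 10 * l \<le> ln (real t) \<and> ln (real t) \<le> l powr (1 / 50) * l). wt p t) \<le> 3"
proof -
  have "\<forall>\<^sub>F l::real in at_top. exp (l powr (1 / 50) * (2 * ln (2 * (l powr (1 / 50) * l) + 3))) * ((2 * exp (l / 4))\<^sup>2 * ((l / 4 + ln 2) / exp l * (1 + l powr (1 / 50) * l))) \<le> 1"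
    by real_asymp
  moreover have "\<forall>\<^sub>F l::real in at_top. exp (l powr (1 / 50) * (2 * ln (4 * l powr (1 / 50) + 3))) * (11 * l ^ 4 / exp (l powr (3 / 100)) * (1 + l\<^sup>2 / 2)) \<le> 1"
    by real_asymp
  moreover have "\<forall>\<^sub>F l::real in at_top. - (ln l / (2 * l) * (9 / 10 * l)) + 4 * (exp ((2 * ln (4 * l powr (1 / 50) + 3) / l + ln l / (2 * l)) * l powr (3 / 100)) * (2 + 2 * ln (l powr (3 / 100) / ln 2)) + exp ((2 * ln (4 * l powr (1 / 50) + 3) / l + ln l / (2 * l)) * l) * (8 * (5 * ln l / l) + 13 / l)) \<le> 0"
    by real_asymp
  moreover have "\<forall>\<^sub>F l::real in at_top. exp l \<ge> 16" by real_asymp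
  moreover have "\<forall>\<^sub>F l::real in at_top. l \<ge> 100" by real_asymp
  moreover have "\<forall>\<^sub>F l::real in at_top. 5 * ln l / l \<le> 1 / 2" by real_asymp
  moreover have "\<forall>\<^sub>F l::real in at_top. l powr (1 / 50) * l \<le> l\<^sup>2 / 2" by real_asymp
  moreover have "\<forall>\<^sub>F l::real in at_top. l powr (3 / 100) \<ge> 1" by real_asymp
  moreover have "\<forall>\<^sub>F l::real in at_top. 2 * ln (4 * l powr (1 / 50) + 3) / l + ln l / (2 * l) \<le> 1 / 2" by real_asymp
  moreover have "\<forall>\<^sub>F l::real in at_top. ln (2 * (l powr (1 / 50) * l)) + ln (2 * (l powr (1 / 50) * l) + 3) \<le> l / 2" by real_asymp
  moreover have "\<forall>\<^sub>F l::real in at_top. ln (2 * (l powr (1 / 50) * l)) + ln (4 * l powr (1 / 50) + 3) \<le> l / 2" by real_asymp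
  moreover have "\<forall>\<^sub>F l::real in at_top. l powr (1 / 50) \<ge> 1" by real_asymp
  moreover have "\<forall>\<^sub>F l::real in at_top. 2 * exp (l / 4) \<le> exp (exp l)" by real_asymp
  ultimately show ?thesis using sparse_sum
  proof eventually_elim
    case (elim l)
    show ?case
    proof (intro allI impI)
      fix p :: nat assume p: "prime p" and lp: "ln (real p) = exp l"
      have p0: "real p > 0" using prime_gt_0_nat[OF p] by simp
      have px: "real p = exp (exp l)" using p0 lp by (metis exp_ln)
      have l0: "l > 0" using elim(5) by simp
      define a where "a = l powr (1 / 50)"
      have a1: "a \<ge> 1" using elim(12) by (simp add: a_def)
      have al1: "a * l \<ge> 1" using a1 elim(5) mult_mono[of 1 a 1 l] by simp
      define \<eta> where "\<eta> = 2 * ln (4 * a + 3) / l"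
      define S where "S = {t. t dvd p - 1 \<and> (9 / 10 * l \<le> ln (real t) \<and> ln (real t) \<le> a * l) \<and> Kset p t \<noteq> {}}"
      have finS: "finite S" unfolding S_def by (rule sum_nonempty_Kset(2)[OF p])
      have S: "t dvd p - 1" "9 / 10 * l \<le> ln (real t)" "ln (real t) \<le> a * l" "Kset p t \<noteq> {}" "t \<ge> 1" if "t \<in> S" for t
        using that dvd_pred_prime(1)[OF p, of t] by (auto simp: S_def Suc_le_eq)
      have te: "real t \<le> exp (a * l)" if "t \<in> S" for t
      proof -
        have "exp (ln (real t)) \<le> exp (a * l)" using S(3)[OF that] by simp
        then show ?thesis using S(5)[OF that] by simp
      qed
      define h where "h = nat \<lceil>exp (l / 4)\<rceil>"
      have h_lo: "real h \<ge> exp (l / 4)" unfolding h_def by linarith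
      have e4: "exp (l / 4) \<ge> 1" using l0 by simp
      have e4': "exp (l / 4) > 1" using l0 by simp
      have h_hi: "real h \<le> 2 * exp (l / 4)" unfolding h_def using e4 by linarith
      have h2: "h \<ge> 2"
      proof -
        have "real h > 1" using h_lo e4' by linarith
        then show ?thesis by simp
      qed
      have hp: "h \<le> p"
      proof -
        have "real h \<le> real p" using h_hi elim(13) unfolding px by linarith
        then show ?thesis by simp
      qed
      define X where "X = {t \<in> S. \<exists>k\<in>Kset p t. \<exists>k'\<in>Kset p t. k \<noteq> k' \<and> max (k div gcd k k') (k' div gcd k k') < h}"
      define Z where "Z = {t \<in> S. \<not> (\<exists>k\<in>Kset p t. \<exists>k'\<in>Kset p t. k \<noteq> k' \<and> max (k div gcd k k') (k' div gcd k k') < h)}"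
      have finXZ: "finite X" "finite Z" using finS by (auto simp: X_def Z_def)
      define N where "N = exp (a * (2 * ln (2 * (a * l) + 3)))"
      have crude: "real (card (Kset p t)) \<le> N" if t: "t \<in> S" for t
      proof -
        \<comment> \<open>Ratios of distinct numbers always have height at least 2; the price is an
          E of order a l instead of a.\<close>
        define E where "E = nat \<lceil>2 * (a * l)\<rceil> + 2"
        have E: "real E \<ge> 2 * (a * l) + 2" "real E \<le> 2 * (a * l) + 3" unfolding E_def using al1 by linarith+
        have tE: "t \<le> 2 ^ (E - 1)"
        proof -
          have "ln (real t) \<le> real (E - 1) * (1 / 2)" using S(3)[OF t] E by (simp add: E_def of_nat_diff)
          also have "\<dots> \<le> real (E - 1) * ln 2" using half_le_ln2 by (intro mult_left_mono) auto
          finally have "exp (ln (real t)) \<le> exp (real (E - 1) * ln 2)" by simp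
          then have "real t \<le> 2 ^ (E - 1)" using S(5)[OF t] by (simp only: exp_of_nat_mult exp_ln zero_less_numeral of_nat_0_less_iff Suc_le_eq One_nat_def)
          then have "real t \<le> real (2 ^ (E - 1))" by (simp only: of_nat_power of_nat_numeral)
          then show ?thesis by (simp only: of_nat_le_iff)
        qed
        have lnE: "ln (real E) \<le> ln (2 * (a * l) + 3)" using E al1 by (intro ln_mono) auto
        have lnE0: "ln (real E) \<ge> 0" using E al1 by (intro ln_ge_zero) linarith
        have "real (card (Kset p t)) \<le> real t powr (2 * ln (real E) / l)"
        proof (rule Kset_digit_bound[OF p lp S(1)[OF t] l0 S(3)[OF t] al1, where h = 2 and E = E])
          fix k k' assume k: "k \<in> Kset p t" "k' \<in> Kset p t" "k \<noteq> k'"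
          have c: "k div gcd k k' \<noteq> k' div gcd k k'" "k div gcd k k' \<ge> 1" "k' div gcd k k' \<ge> 1"
            using Kset_close_pair[OF p S(1)[OF t] k] by auto
          then show "2 \<le> max (k div gcd k k') (k' div gcd k k')" by linarith
        next
          show "ln (2 * (a * l)) + ln (real E) \<le> l / 2" using elim(10) lnE unfolding a_def by linarith
          show "2 \<le> E" by (simp add: E_def)
        qed (use tE in auto)
        also have "\<dots> = exp (2 * ln (real E) / l * ln (real t))" using S(5)[OF t] by (simp add: powr_def)
        also have "\<dots> \<le> exp (2 * ln (2 * (a * l) + 3) / l * (a * l))"
        proof -
          have "2 * ln (real E) / l * ln (real t) \<le> 2 * ln (2 * (a * l) + 3) / l * (a * l)"
            using lnE lnE0 S(3,5)[OF t] l0 al1 by (intro mult_mono divide_right_mono) auto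
          then show ?thesis by simp
        qed
        also have "\<dots> = N" using l0 by (simp add: N_def)
        finally show ?thesis .
      qed
      have "(\<Sum>t\<in>X. wt p t) \<le> 1"
      proof -
        have XS: "t \<in> S" if "t \<in> X" for t using that by (simp add: X_def)
        define T where "T = nat \<lfloor>exp (a * l)\<rfloor>"
        have T1: "T \<ge> 1" using al1 by (simp add: T_def le_nat_iff)
        have lT: "ln (real T) \<le> a * l"
        proof -
          have "real T \<le> exp (a * l)" by (simp add: T_def)
          then have "ln (real T) \<le> ln (exp (a * l))" using T1 by (intro ln_mono) auto
          then show ?thesis by simp
        qed
        have "(\<Sum>t\<in>X. wt p t) \<le> (\<Sum>t\<in>X. N * (1 / real t))"
        proof (rule sum_mono)
          fix t assume "t \<in> X"
          then show "wt p t \<le> N * (1 / real t)" using crude[OF XS] by (simp add: divide_right_mono)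
        qed
        also have "\<dots> = N * (\<Sum>t\<in>X. 1 / real t)" by (simp only: sum_distrib_left)
        also have "\<dots> \<le> N * ((2 * exp (l / 4))\<^sup>2 * ((l / 4 + ln 2) / exp l * (1 + a * l)))"
        proof (rule mult_left_mono)
          have "(\<Sum>t\<in>X. 1 / real t) \<le> real h ^ 2 * (ln (real h) / ln (real p) * (1 + ln (real T)))"
          proof (rule exceptional_sum_le[OF p T1 h2 hp])
            show "X \<subseteq> {1..T}" using S(5)[OF XS] te[OF XS] by (auto simp: T_def le_nat_floor)
            fix t assume "t \<in> X"
            then obtain k k' where k: "k \<in> Kset p t" "k' \<in> Kset p t" "k \<noteq> k'" "max (k div gcd k k') (k' div gcd k k') < h"
              and tS: "t \<in> S" by (auto simp: X_def)
            show "\<exists>u w. u \<noteq> w \<and> 1 \<le> u \<and> 1 \<le> w \<and> u < h \<and> w < h \<and> [u ^ t = w ^ t] (mod p)"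
              using Kset_close_pair[OF p S(1)[OF tS] k(1-3)] k(4)
              by (intro exI[of _ "k div gcd k k'"] exI[of _ "k' div gcd k k'"]) simp
          qed
          also have "\<dots> \<le> (2 * exp (l / 4))\<^sup>2 * ((l / 4 + ln 2) / exp l * (1 + a * l))"
          proof (intro mult_mono divide_mono power_mono add_mono)
            have "ln (real h) \<le> ln (2 * exp (l / 4))" using h_hi h2 by (intro ln_mono) auto
            then show "ln (real h) \<le> l / 4 + ln 2" by (simp add: ln_mult)
          qed (use h_hi h2 lT lp l0 T1 in auto)
          finally show "(\<Sum>t\<in>X. 1 / real t) \<le> (2 * exp (l / 4))\<^sup>2 * ((l / 4 + ln 2) / exp l * (1 + a * l))" .
        qed (simp add: N_def)
        also have "\<dots> \<le> 1" using elim(1) unfolding N_def a_def .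
        finally show ?thesis .
      qed
      moreover have "(\<Sum>t\<in>Z. wt p t) \<le> 2"
      proof (rule sparse_or_rest_sum[where Tlo = "9 / 10 * l" and Thi = "a * l" and \<eta> = \<eta> and \<theta> = "ln l / (2 * l)" and u = "l powr (3 / 100)" and l = l, OF elim(14) p lp elim(4) _ elim(6)])
        show "finite Z" by (rule finXZ)
        show "1 < l" using elim(5) by simp
        show "0 \<le> ln l / (2 * l)" using elim(5) by simp
        show "0 \<le> \<eta>" unfolding \<eta>_def using a1 l0 by simp
        show "\<eta> + ln l / (2 * l) \<le> 1 / 2" unfolding \<eta>_def a_def by (rule elim(9))
        have "a * l * \<eta> = a * (2 * ln (4 * a + 3))" using l0 by (simp add: \<eta>_def)
        then show "exp (a * l * \<eta>) * (11 * l ^ 4 / exp (l powr (3 / 100)) * (1 + l\<^sup>2 / 2)) \<le> 1"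
          using elim(2) unfolding a_def by (simp only:)
        show "- (ln l / (2 * l) * (9 / 10 * l)) + 4 * (exp ((\<eta> + ln l / (2 * l)) * l powr (3 / 100)) * (2 + 2 * ln (l powr (3 / 100) / ln 2)) + exp ((\<eta> + ln l / (2 * l)) * l) * (8 * (5 * ln l / l) + 13 / l)) \<le> 0"
          using elim(3) unfolding \<eta>_def a_def .
        show "a * l \<le> l\<^sup>2 / 2" unfolding a_def by (rule elim(7))
        show "1 \<le> l powr (3 / 100)" by (rule elim(8))
        fix t assume tZ: "t \<in> Z"
        then have t: "t \<in> S" by (simp add: Z_def)
        \<comment> \<open>From t <= exp (a l) and h >= exp (l / 4), the condition t <= h^(E - 1)
          holds once E - 1 >= 4 a.\<close>
        define E where "E = nat \<lceil>4 * a\<rceil> + 2"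
        have E: "real E \<ge> 4 * a + 2" "real E \<le> 4 * a + 3" unfolding E_def using a1 by linarith+
        have tE: "t \<le> h ^ (E - 1)"
        proof -
          have "ln (real t) \<le> (4 * a) * (l / 4)" using S(3)[OF t] by simp
          also have "\<dots> \<le> real (E - 1) * (l / 4)" using E l0 by (intro mult_right_mono) (auto simp: E_def of_nat_diff)
          finally have "exp (ln (real t)) \<le> exp (real (E - 1) * (l / 4))" by simp
          then have "real t \<le> exp (l / 4) ^ (E - 1)" using S(5)[OF t] by (simp only: exp_of_nat_mult exp_ln of_nat_0_less_iff Suc_le_eq One_nat_def)
          also have "\<dots> \<le> real h ^ (E - 1)" using h_lo by (intro power_mono) auto
          finally have "real t \<le> real (h ^ (E - 1))" by (simp only: of_nat_power)
          then show ?thesis by (simp only: of_nat_le_iff)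
        qed
        have lnE: "ln (real E) \<le> ln (4 * a + 3)" using E a1 by (intro ln_mono) auto
        have "real (card (Kset p t)) \<le> real t powr (2 * ln (real E) / l)"
        proof (rule Kset_digit_bound[OF p lp S(1)[OF t] l0 S(3)[OF t] al1 _ h2, where E = E])
          fix k k' assume k: "k \<in> Kset p t" "k' \<in> Kset p t" "k \<noteq> k'"
          have "\<not> max (k div gcd k k') (k' div gcd k k') < h" using tZ k unfolding Z_def by blast
          then show "h \<le> max (k div gcd k k') (k' div gcd k k')" by (simp only: not_less)
        next
          show "ln (2 * (a * l)) + ln (real E) \<le> l / 2" using elim(11) lnE unfolding a_def by linarith
          show "2 \<le> E" by (simp add: E_def)
        qed (use tE in auto)
        also have "\<dots> \<le> real t powr \<eta>"
          unfolding \<eta>_def using lnE l0 S(5)[OF t] by (intro powr_mono divide_right_mono) auto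
        finally show "t dvd p - 1 \<and> Kset p t \<noteq> {} \<and> 9 / 10 * l \<le> ln (real t) \<and> ln (real t) \<le> a * l \<and> real (card (Kset p t)) \<le> real t powr \<eta>"
          using S[OF t] by simp
      qed
      moreover have "(\<Sum>t\<in>S. wt p t) = (\<Sum>t\<in>X. wt p t) + (\<Sum>t\<in>Z. wt p t)"
      proof -
        have "S = X \<union> Z" by (auto simp: X_def Z_def)
        moreover have "(\<Sum>t\<in>X \<union> Z. wt p t) = (\<Sum>t\<in>X. wt p t) + (\<Sum>t\<in>Z. wt p t)"
          using finXZ by (intro sum.union_disjoint) (auto simp: X_def Z_def)
        ultimately show ?thesis by simp
      qed
      ultimately have "(\<Sum>t\<in>S. wt p t) \<le> 3" by linarith
      then show "(\<Sum>t | t dvd p - 1 \<and> (9 / 10 * l \<le> ln (real t) \<and> ln (real t) \<le> l powr (1 / 50) * l). wt p t) \<le> 3"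
        unfolding S_def a_def by (subst sum_nonempty_Kset(1)[OF p])
    qed
  qed
qed

lemma sum_weights_bounded:
  "\<exists>C. \<forall>p. prime p \<longrightarrow> (\<Sum>t | t dvd p - 1. wt p t) \<le> C"
proof -
  obtain C7 where C7: "\<And>p. prime p \<Longrightarrow> (\<Sum>t | t dvd p - 1 \<and> real p powr (9 / 10) < real t. wt p t) \<le> C7"
    using sum_top_range by blast
  obtain C6 where C6: "\<And>p. prime p \<Longrightarrow> (\<Sum>t | t dvd p - 1 \<and> real p powr (1 / 6) < real t \<and> real t \<le> real p powr (9 / 10). wt p t) \<le> C6"
    using sum_middle_range by blast
  obtain C5 x5 where C5: "\<And>p. prime p \<Longrightarrow> ln (real p) \<ge> x5 \<Longrightarrow> (\<Sum>t | t dvd p - 1 \<and> ln (real p) powr (3 / 10) < ln (real t) \<and> real t \<le> real p powr (1 / 6). wt p t) \<le> C5"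
    using sum_low_range by blast
  have "\<forall>\<^sub>F l in at_top. \<forall>p. prime p \<longrightarrow> ln (real p) = exp l \<longrightarrow> (\<Sum>t | t dvd p - 1. wt p t) \<le> 7 + C5 + C6 + C7"
    using sum_tiny_range sum_first_log_range sum_second_log_range sum_subexponential_range eventually_ge_at_top[of x5]
  proof eventually_elim
    case (elim l)
    show ?case
    proof (intro allI impI)
      fix p :: nat assume p: "prime p" and lp: "ln (real p) = exp l"
      \<comment> \<open>The threshold \<open>x5\<close> concerns ln p = exp l, and exp l >= l >=
        x5.\<close>
      have "l \<le> exp l" using exp_ge_add_one_self[of l] by linarith
      then have x5: "ln (real p) \<ge> x5" using elim(5) lp by linarith
      have e3: "ln (real p) powr (3 / 10) = exp (3 / 10 * l)" by (simp add: lp powr_def)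
      have fin: "finite {t. t dvd p - 1}" using prime_gt_1_nat[OF p] by simp
      define R where "R i = (if i = (1::nat) then {t. t dvd p - 1 \<and> ln (real t) < 9 / 10 * l}
        else if i = 2 then {t. t dvd p - 1 \<and> (9 / 10 * l \<le> ln (real t) \<and> ln (real t) \<le> l powr (1 / 50) * l)}
        else if i = 3 then {t. t dvd p - 1 \<and> (l powr (1 / 50) * l < ln (real t) \<and> ln (real t) \<le> l / (400 * ln l) * l)}
        else if i = 4 then {t. t dvd p - 1 \<and> (l / (400 * ln l) * l < ln (real t) \<and> ln (real t) \<le> exp (3 / 10 * l))}
        else if i = 5 then {t. t dvd p - 1 \<and> ln (real p) powr (3 / 10) < ln (real t) \<and> real t \<le> real p powr (1 / 6)}
        else if i = 6 then {t. t dvd p - 1 \<and> real p powr (1 / 6) < real t \<and> real t \<le> real p powr (9 / 10)}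
        else {t. t dvd p - 1 \<and> real p powr (9 / 10) < real t})" for i
      have finR: "finite (R i)" for i by (rule finite_subset[OF _ fin]) (auto simp: R_def)
      have "{t. t dvd p - 1} \<subseteq> (\<Union>i\<in>{1..7}. R i)"
      proof
        fix t assume "t \<in> {t. t dvd p - 1}"
        then have t: "t dvd p - 1" by simp
        consider "ln (real t) < 9 / 10 * l" | "9 / 10 * l \<le> ln (real t) \<and> ln (real t) \<le> l powr (1 / 50) * l"
          | "l powr (1 / 50) * l < ln (real t) \<and> ln (real t) \<le> l / (400 * ln l) * l"
          | "l / (400 * ln l) * l < ln (real t) \<and> ln (real t) \<le> exp (3 / 10 * l)"
          | "ln (real p) powr (3 / 10) < ln (real t) \<and> real t \<le> real p powr (1 / 6)"
          | "real p powr (1 / 6) < real t \<and> real t \<le> real p powr (9 / 10)"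
          | "real p powr (9 / 10) < real t" unfolding e3 by linarith
        then show "t \<in> (\<Union>i\<in>{1..7}. R i)"
        proof cases
          case 1 then show ?thesis using t by (intro UN_I[of 1]) (auto simp: R_def)
        next
          case 2 then show ?thesis using t by (intro UN_I[of 2]) (auto simp: R_def)
        next
          case 3 then show ?thesis using t by (intro UN_I[of 3]) (auto simp: R_def)
        next
          case 4 then show ?thesis using t by (intro UN_I[of 4]) (auto simp: R_def)
        next
          case 5 then show ?thesis using t by (intro UN_I[of 5]) (auto simp: R_def)
        next
          case 6 then show ?thesis using t by (intro UN_I[of 6]) (auto simp: R_def)
        next
          case 7 then show ?thesis using t by (intro UN_I[of 7]) (auto simp: R_def)
        qed
      qed
      then have "(\<Sum>t | t dvd p - 1. wt p t) \<le> (\<Sum>t\<in>(\<Union>i\<in>{1..7}. R i). wt p t)"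
        using finR by (intro sum_mono2) auto
      also have "\<dots> \<le> (\<Sum>i\<in>{1..7}. \<Sum>t\<in>R i. wt p t)" using finR by (intro sum_UNION_le) auto
      also have "{1..7} = {1, 2, 3, 4, 5, 6, 7::nat}" by auto
      also have "(\<Sum>i\<in>{1, 2, 3, 4, 5, 6, 7::nat}. \<Sum>t\<in>R i. wt p t) =
          (\<Sum>t\<in>R 1. wt p t) + (\<Sum>t\<in>R 2. wt p t) + (\<Sum>t\<in>R 3. wt p t) + (\<Sum>t\<in>R 4. wt p t) + (\<Sum>t\<in>R 5. wt p t) + (\<Sum>t\<in>R 6. wt p t) + (\<Sum>t\<in>R 7. wt p t)"
        by simp
      also have "\<dots> \<le> 1 + 3 + 2 + 1 + C5 + C6 + C7"
      proof (intro add_mono)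
        show "(\<Sum>t\<in>R 1. wt p t) \<le> 1" using elim(1) p lp by (simp add: R_def)
        show "(\<Sum>t\<in>R 2. wt p t) \<le> 3" using elim(2) p lp by (simp add: R_def)
        show "(\<Sum>t\<in>R 3. wt p t) \<le> 2" using elim(3) p lp by (simp add: R_def)
        show "(\<Sum>t\<in>R 4. wt p t) \<le> 1" using elim(4) p lp by (simp add: R_def)
        show "(\<Sum>t\<in>R 5. wt p t) \<le> C5" using C5[OF p x5] by (simp add: R_def)
        show "(\<Sum>t\<in>R 6. wt p t) \<le> C6" using C6[OF p] by (simp add: R_def)
        show "(\<Sum>t\<in>R 7. wt p t) \<le> C7" using C7[OF p] by (simp add: R_def)
      qed
      finally show "(\<Sum>t | t dvd p - 1. wt p t) \<le> 7 + C5 + C6 + C7" by simp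
    qed
  qed
  then obtain l0 where l0: "\<And>l p. l \<ge> l0 \<Longrightarrow> prime p \<Longrightarrow> ln (real p) = exp l \<Longrightarrow> (\<Sum>t | t dvd p - 1. wt p t) \<le> 7 + C5 + C6 + C7"
    unfolding eventually_at_top_linorder by blast
  have "(\<Sum>t | t dvd p - 1. wt p t) \<le> \<bar>7 + C5 + C6 + C7\<bar> + exp (exp l0)" if p: "prime p" for p
  proof (cases "ln (real p) \<ge> exp l0")
    case True
    have pos: "ln (real p) > 0" using prime_gt_1_nat[OF p] by simp
    have "ln (exp l0) \<le> ln (ln (real p))" using True by (intro ln_mono) auto
    then have "(\<Sum>t | t dvd p - 1. wt p t) \<le> 7 + C5 + C6 + C7" using l0[of "ln (ln (real p))", OF _ p] pos by simp
    then show ?thesis using exp_gt_zero[of "exp l0"] by linarith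
  next
    \<comment> \<open>The finitely many p below exp (exp l0): every weight is at most 1, so the sum
      is at most the number of divisors of p - 1.\<close>
    case False
    have p1: "p > 1" using prime_gt_1_nat[OF p] .
    have "wt p t \<le> 1" for t
    proof -
      have "card (Kset p t) \<le> card {1..t}" by (intro card_mono) (auto simp: Kset_def)
      then show ?thesis by (cases "t = 0") (auto simp: divide_le_eq)
    qed
    then have "(\<Sum>t | t dvd p - 1. wt p t) \<le> (\<Sum>t | t dvd p - 1. 1)" by (intro sum_mono)
    also have "\<dots> = real (card {t. t dvd p - 1})" by simp
    also have "\<dots> \<le> real (card {..<p})" using dvd_pred_prime(2)[OF p] by (intro of_nat_mono card_mono) auto
    also have "\<dots> = exp (ln (real p))" using p1 by simp
    also have "\<dots> \<le> exp (exp l0)" using False by (subst exp_le_cancel_iff) linarith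
    finally show ?thesis by linarith
  qed
  then show ?thesis by blast
qed

theorem theorem1p14:
  shows "\<exists>c::real. c > 0 \<and> (\<forall>p::nat. prime p \<longrightarrow> real (F p) \<le> c * real p)"
proof -
  obtain C where C: "\<And>p. prime p \<Longrightarrow> (\<Sum>t | t dvd p - 1. wt p t) \<le> C" using sum_weights_bounded by blast
  have "real (F p) \<le> (\<bar>C\<bar> + 1) * real p" if p: "prime p" for p
  proof -
    have "real (F p) \<le> real (p - 1) * (\<Sum>t | t dvd p - 1. wt p t)" by (rule F_le_sum_Kset[OF p])
    also have "\<dots> \<le> real (p - 1) * (\<bar>C\<bar> + 1)" using C[OF p] by (intro mult_left_mono) auto
    also have "\<dots> \<le> real p * (\<bar>C\<bar> + 1)" by (intro mult_right_mono) auto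
    finally show ?thesis by (simp add: mult.commute)
  qed
  then show ?thesis by (intro exI[of _ "\<bar>C\<bar> + 1"]) auto
qed

end
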